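(* Let $n\ge1$ and $d\ge2$ be integers, let $\underline{\ell}$ be a (connected) Kupisch series of type $\mathbb{A}_n$ and consider a subset $I\subseteq\operatorname{os}_{\underline{\ell}}^{d+1}$. The subcategory $\mathcal{U}_I=\operatorname{add}\{M_y\mid y\in I\}$ is a $d$-torsion class in $\mathcal{M}_{\underline{\ell}}^d$ if and only if the following hold for any elements $x,z\in\operatorname{os}_{\underline{\ell}}^{d+1}$: (1) If $x\le z$ and $x_d=z_d$, then $x\in I$ implies $z\in I$. (2) If $x\rightsquigarrow\tau_d(z)$ and $x,z\in I$, then any $y\in\operatorname{os}_{\underline{\ell}}^{d+1}$ with $y_i\in\{x_i,z_i\}$ for each $i$ must be in $I$.
   Context: Let $\Bbbk$ be a field. All subcategories are full and closed under isomorphisms, finite direct sums and direct summands; $\operatorname{add}(\mathcal{X})$ is the smallest such subcategory containing $\mathcal{X}$. For a finite-dimensional algebra $A$, $\operatorname{mod}A$ is the category of finitely presented right $A$-modules. Higher Auslander algebras: $N_n=\{0,\dots,n-1\}$; $N_n^d$ is the poset of $d$-tuples $(x_0,\dots,x_{d-1})$ over $N_n$ with the product order ($x\le y$ iff $x_i\le y_i$ for all $i$), also viewed as a $\Bbbk$-linear category ($\Bbbk$-linearisation of the poset) and so as a finite-dimensional $\Bbbk$-algebra. $\operatorname{os}_n^d\subseteq N_n^d$ is the set of non-decreasing tuples. $A_n^d=N_n^d/(N_n^d\setminus\operatorname{os}_n^d)$ is the quotient by the ideal generated by the idempotents at vertices in $N_n^d\setminus\operatorname{os}_n^d$; right modules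 are contravariant functors on the corresponding category. For $x\in\operatorname{os}_n^{d+1}$, $M_x$ is the indecomposable $A_n^d$-module with support in all $y\in\operatorname{os}_n^d$ satisfying $x_0\le y_0\le x_1\le\cdots\le x_{d-1}\le y_{d-1}\le x_d$ (the interval module: $\Bbbk$ at each such $y$, zero elsewhere, with identity structure maps inside the support). Set $\mathcal{M}_n^d=\operatorname{add}\{M_x\mid x\in\operatorname{os}_n^{d+1}\}\subseteq\operatorname{mod}A_n^d$. Higher Nakayama algebras: a (connected) Kupisch series of type $\mathbb{A}_n$ is a tuple $\underline{\ell}=(\ell_0,\dots,\ell_{n-1})$ of positive integers with $\ell_0=1$ and $2\le\ell_i\le\ell_{i-1}+1$ for $1\le i\le n-1$. For $m\ge1$, $\operatorname{os}_{\underline{\ell}}^{m}=\{y\in\operatorname{os}_n^{m}\mid y_{m-1}-y_0+1\le\ell_{y_{m-1}}\}$. For $d\ge2$, the $d$-th Nakayama algebra with Kupisch series $\underline{\ell}$ is $A_{\underline{\ell}}^d=A_n^d/(\operatorname{os}_n^d\setminus\operatorname{os}_{\underline{\ell}}^d)$, i.e. $A_n^d/A_n^d e A_n^d$ with $e$ the sum of the idempotents at vertices in $\operatorname{os}_n^d\setminus\operatorname{os}_{\underline{\ell}}^d$. The subcategory $\mathcal{M}_{\underline{\ell}}^d=\mathcal{M}_n^d\cap\operatorname{mod}A_{\underline{\ell}}^d$ is known to be $d$-cluster tilting in $\operatorname{mod}A_{\underline{\ell}}^d$ and equal to $\operatorname{add}\{M_x\mid x\in\operatorname{os}_{\underline{\ell}}^{d+1}\}$.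 On $\mathbb{Z}^{d+1}$ write $x\rightsquigarrow y$ iff $x_0\le y_0\le x_1\le y_1\le\cdots\le x_d\le y_d$, and $\tau_d(x_0,\dots,x_d)=(x_0-1,\dots,x_d-1)$. $d$-torsion classes: put $\mathcal{M}=\mathcal{M}_{\underline{\ell}}^d$. A $d$-cokernel of $f_0\colon X_0\to X_1$ in $\mathcal{M}$ is a sequence $X_1\xrightarrow{f_1}\cdots\xrightarrow{f_d}X_{d+1}\to0$ in $\mathcal{M}$ such that $0\to\operatorname{Hom}(X_{d+1},M)\to\cdots\to\operatorname{Hom}(X_1,M)\to\operatorname{Hom}(X_0,M)$ is exact for every $M\in\mathcal{M}$; $d$-kernels are dual. A sequence $0\to X_0\xrightarrow{f_0}\cdots\xrightarrow{f_d}X_{d+1}\to0$ in $\mathcal{M}$ is $d$-exact if $(f_1,\dots,f_d)$ is a $d$-cokernel of $f_0$ and $(f_0,\dots,f_{d-1})$ is a $d$-kernel of $f_d$. A subcategory $\mathcal{U}\subseteq\mathcal{M}$ is a $d$-torsion class in $\mathcal{M}$ if for every $M\in\mathcal{M}$ there is a $d$-exact sequence $0\to U_M\to M\to V_1\to\cdots\to V_d\to0$ in $\mathcal{M}$ with $U_M\in\mathcal{U}$ such that $0\to\operatorname{Hom}(U,V_1)\to\cdots\to\operatorname{Hom}(U,V_d)\to0$ is exact for every $U\in\mathcal{U}$. *)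

theory Defs
  imports "Jordan_Normal_Form.Matrix" "HOL-Library.FuncSet"
begin

section \<open>Preadditive categories, subcategories and \<open>d\<close>-exactness\<close>

text \<open>Composition is written in the usual order: for \<open>f \<in> Mor C X Y\<close> and \<open>g \<in> Mor C Y Z\<close>
  the composite \<open>X \<rightarrow> Y \<rightarrow> Z\<close> is \<open>Cmp C X Y Z g f\<close>.\<close>

record ('o, 'm) precat =
  Objs :: "'o set"
  Mor :: "'o \<Rightarrow> 'o \<Rightarrow> 'm set"
  Cmp :: "'o \<Rightarrow> 'o \<Rightarrow> 'o \<Rightarrow> 'm \<Rightarrow> 'm \<Rightarrow> 'm"
  Idm :: "'o \<Rightarrow> 'm"
  Zero :: "'o \<Rightarrow> 'o \<Rightarrow> 'm"
  Plus :: "'o \<Rightarrow> 'o \<Rightarrow> 'm \<Rightarrow> 'm \<Rightarrow> 'm"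

definition isomorphic :: "('o, 'm) precat \<Rightarrow> 'o \<Rightarrow> 'o \<Rightarrow> bool" where
  "isomorphic C X Y \<longleftrightarrow> (\<exists>f \<in> Mor C X Y. \<exists>g \<in> Mor C Y X.
     Cmp C X Y X g f = Idm C X \<and> Cmp C Y X Y f g = Idm C Y)"

definition zero_object :: "('o, 'm) precat \<Rightarrow> 'o \<Rightarrow> bool" where
  "zero_object C Z \<longleftrightarrow> Z \<in> Objs C \<and> Idm C Z = Zero C Z Z"

definition direct_sum :: "('o, 'm) precat \<Rightarrow> 'o \<Rightarrow> 'o \<Rightarrow> 'o \<Rightarrow> bool" where
  "direct_sum C X Y S \<longleftrightarrow> X \<in> Objs C \<and> Y \<in> Objs C \<and> S \<in> Objs C \<and>
     (\<exists>i \<in> Mor C X S. \<exists>j \<in> Mor C Y S. \<exists>p \<in> Mor C S X. \<exists>q \<in> Mor C S Y.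
        Cmp C X S X p i = Idm C X \<and> Cmp C Y S Y q j = Idm C Y \<and>
        Cmp C Y S X p j = Zero C Y X \<and> Cmp C X S Y q i = Zero C X Y \<and>
        Plus C S S (Cmp C S X S i p) (Cmp C S Y S j q) = Idm C S)"

text \<open>A (full) subcategory is given by its class of objects. The empty direct sum is included
  in the finite ones, so every subcategory contains the zero objects.\<close>

definition subcategory :: "('o, 'm) precat \<Rightarrow> 'o set \<Rightarrow> bool" where
  "subcategory C U \<longleftrightarrow> U \<subseteq> Objs C \<and>
     (\<forall>X\<in>U. \<forall>Y\<in>Objs C. isomorphic C X Y \<longrightarrow> Y \<in> U) \<and>
     (\<forall>Z. zero_object C Z \<longrightarrow> Z \<in> U) \<and>
     (\<forall>X\<in>U. \<forall>Y\<in>U. \<forall>S. direct_sum C X Y S \<longrightarrow> S \<in> U) \<and>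
     (\<forall>X Y. \<forall>S\<in>U. direct_sum C X Y S \<longrightarrow> X \<in> U \<and> Y \<in> U)"

definition add_closure :: "('o, 'm) precat \<Rightarrow> 'o set \<Rightarrow> 'o set" where
  "add_closure C \<X> = \<Inter>{U. subcategory C U \<and> \<X> \<subseteq> U}"

text \<open>For \<open>f : X \<rightarrow> Y\<close>, kernel and image of \<open>Hom(f,W) : Hom(Y,W) \<rightarrow> Hom(X,W)\<close> and of
  \<open>Hom(W,f) : Hom(W,X) \<rightarrow> Hom(W,Y)\<close>.\<close>

definition ker_pre :: "('o, 'm) precat \<Rightarrow> 'o \<Rightarrow> 'o \<Rightarrow> 'm \<Rightarrow> 'o \<Rightarrow> 'm set" where
  "ker_pre C X Y f W = {g \<in> Mor C Y W. Cmp C X Y W g f = Zero C X W}"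

definition im_pre :: "('o, 'm) precat \<Rightarrow> 'o \<Rightarrow> 'o \<Rightarrow> 'm \<Rightarrow> 'o \<Rightarrow> 'm set" where
  "im_pre C X Y f W = (\<lambda>g. Cmp C X Y W g f) ` Mor C Y W"

definition ker_post :: "('o, 'm) precat \<Rightarrow> 'o \<Rightarrow> 'o \<Rightarrow> 'm \<Rightarrow> 'o \<Rightarrow> 'm set" where
  "ker_post C X Y f W = {g \<in> Mor C W X. Cmp C W X Y f g = Zero C W Y}"

definition im_post :: "('o, 'm) precat \<Rightarrow> 'o \<Rightarrow> 'o \<Rightarrow> 'm \<Rightarrow> 'o \<Rightarrow> 'm set" where
  "im_post C X Y f W = (\<lambda>g. Cmp C W X Y f g) ` Mor C W X"

text \<open>A sequence \<open>X\<^sub>0 \<rightarrow> X\<^sub>1 \<rightarrow> \<dots> \<rightarrow> X\<^sub>d\<^sub>+\<^sub>1\<close> consists of \<open>X 0, \<dots>, X (d+1)\<close> and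
  \<open>f i : X i \<rightarrow> X (i+1)\<close> for \<open>i \<le> d\<close>; values at other indices are ignored.\<close>

definition sequence_in ::
  "('o, 'm) precat \<Rightarrow> 'o set \<Rightarrow> nat \<Rightarrow> (nat \<Rightarrow> 'o) \<Rightarrow> (nat \<Rightarrow> 'm) \<Rightarrow> bool" where
  "sequence_in C \<M> d X f \<longleftrightarrow>
     (\<forall>i\<le>d + 1. X i \<in> \<M>) \<and> (\<forall>i\<le>d. f i \<in> Mor C (X i) (X (i + 1)))"

text \<open>\<open>(f\<^sub>1, \<dots>, f\<^sub>d)\<close> is a \<open>d\<close>-cokernel of \<open>f\<^sub>0\<close>: exactness of
  \<open>0 \<rightarrow> Hom(X\<^sub>d\<^sub>+\<^sub>1,W) \<rightarrow> \<dots> \<rightarrow> Hom(X\<^sub>1,W) \<rightarrow> Hom(X\<^sub>0,W)\<close>.\<close>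

definition d_cokernel ::
  "('o, 'm) precat \<Rightarrow> 'o set \<Rightarrow> nat \<Rightarrow> (nat \<Rightarrow> 'o) \<Rightarrow> (nat \<Rightarrow> 'm) \<Rightarrow> bool" where
  "d_cokernel C \<M> d X f \<longleftrightarrow> sequence_in C \<M> d X f \<and>
     (\<forall>W\<in>\<M>.
        ker_pre C (X d) (X (d + 1)) (f d) W = {Zero C (X (d + 1)) W} \<and>
        (\<forall>i\<in>{1..d}. ker_pre C (X (i - 1)) (X i) (f (i - 1)) W
                    = im_pre C (X i) (X (i + 1)) (f i) W))"

text \<open>\<open>(f\<^sub>0, \<dots>, f\<^sub>d\<^sub>-\<^sub>1)\<close> is a \<open>d\<close>-kernel of \<open>f\<^sub>d\<close>: exactness of
  \<open>0 \<rightarrow> Hom(W,X\<^sub>0) \<rightarrow> \<dots> \<rightarrow> Hom(W,X\<^sub>d) \<rightarrow> Hom(W,X\<^sub>d\<^sub>+\<^sub>1)\<close>.\<close>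

definition d_kernel ::
  "('o, 'm) precat \<Rightarrow> 'o set \<Rightarrow> nat \<Rightarrow> (nat \<Rightarrow> 'o) \<Rightarrow> (nat \<Rightarrow> 'm) \<Rightarrow> bool" where
  "d_kernel C \<M> d X f \<longleftrightarrow> sequence_in C \<M> d X f \<and>
     (\<forall>W\<in>\<M>.
        ker_post C (X 0) (X 1) (f 0) W = {Zero C W (X 0)} \<and>
        (\<forall>i\<in>{1..d}. ker_post C (X i) (X (i + 1)) (f i) W
                    = im_post C (X (i - 1)) (X i) (f (i - 1)) W))"

definition d_exact ::
  "('o, 'm) precat \<Rightarrow> 'o set \<Rightarrow> nat \<Rightarrow> (nat \<Rightarrow> 'o) \<Rightarrow> (nat \<Rightarrow> 'm) \<Rightarrow> bool" where
  "d_exact C \<M> d X f \<longleftrightarrow> d_cokernel C \<M> d X f \<and> d_kernel C \<M> d X f"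

text \<open>In the \<open>d\<close>-exact sequence below, \<open>X 0 = U\<^sub>M\<close>, \<open>X 1 = M\<close> and \<open>X (i + 1) = V\<^sub>i\<close>. The last
  three conditions say that \<open>0 \<rightarrow> Hom(U,V\<^sub>1) \<rightarrow> \<dots> \<rightarrow> Hom(U,V\<^sub>d) \<rightarrow> 0\<close> is exact, for \<open>d \<ge> 2\<close>:
  at \<open>V\<^sub>1\<close>, at the intermediate terms and at \<open>V\<^sub>d\<close>.\<close>

definition d_torsion_class ::
  "('o, 'm) precat \<Rightarrow> 'o set \<Rightarrow> nat \<Rightarrow> 'o set \<Rightarrow> bool" where
  "d_torsion_class C \<M> d \<U> \<longleftrightarrow> subcategory C \<U> \<and> \<U> \<subseteq> \<M> \<and>
     (\<forall>M\<in>\<M>. \<exists>X f. d_exact C \<M> d X f \<and> X 0 \<in> \<U> \<and> X 1 = M \<and>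
        (\<forall>U\<in>\<U>.
           ker_post C (X 2) (X 3) (f 2) U = {Zero C U (X 2)} \<and>
           (\<forall>i\<in>{3..d}. ker_post C (X i) (X (i + 1)) (f i) U
                       = im_post C (X (i - 1)) (X i) (f (i - 1)) U) \<and>
           im_post C (X d) (X (d + 1)) (f d) U = Mor C U (X (d + 1))))"


section \<open>Quotients of linearised posets and their modules\<close>

definition tuple_le :: "nat list \<Rightarrow> nat list \<Rightarrow> bool" where
  "tuple_le x y \<longleftrightarrow> list_all2 (\<le>) x y"

text \<open>The linearisation of the product order: \<open>Hom(x,y)\<close> is one-dimensional if \<open>x \<le> y\<close> and zero
  otherwise. The morphism \<open>c\<close> times the basis vector of \<open>Hom(x,y)\<close> is represented by the scalar
  \<open>c\<close>, so that composition is multiplication of scalars.\<close>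

definition lin_hom :: "nat list \<Rightarrow> nat list \<Rightarrow> 'k::field set" where
  "lin_hom x y = (if tuple_le x y then UNIV else {0})"

text \<open>A quotient of such a linear category is recorded by its vertices and the ideal that is
  factored out: the morphisms from \<open>x\<close> to \<open>y\<close> are \<open>lin_hom x y\<close> modulo \<open>Null x y\<close>.\<close>

record 'k bound_cat =
  Vert :: "nat list set"
  Null :: "nat list \<Rightarrow> nat list \<Rightarrow> 'k set"

inductive ideal_gen :: "'k::field bound_cat \<Rightarrow> nat list set \<Rightarrow> nat list \<Rightarrow> nat list \<Rightarrow> 'k \<Rightarrow> bool"
  for A S where
  base: "\<lbrakk>x \<in> Vert A; y \<in> Vert A; c \<in> Null A x y\<rbrakk> \<Longrightarrow> ideal_gen A S x y c"
| idem: "\<lbrakk>z \<in> Vert A; z \<in> S\<rbrakk> \<Longrightarrow> ideal_gen A S z z 1"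
| sum: "\<lbrakk>ideal_gen A S x y a; ideal_gen A S x y b\<rbrakk> \<Longrightarrow> ideal_gen A S x y (a + b)"
| comp: "\<lbrakk>ideal_gen A S x y a; w \<in> Vert A; z \<in> Vert A; b \<in> lin_hom w x; c \<in> lin_hom y z\<rbrakk>
    \<Longrightarrow> ideal_gen A S w z (c * a * b)"

text \<open>The quotient \<open>A/S\<close> by the ideal generated by the idempotents at the vertices in \<open>S\<close>.\<close>

definition idem_quotient :: "'k::field bound_cat \<Rightarrow> nat list set \<Rightarrow> 'k bound_cat" where
  "idem_quotient A S = A\<lparr>Null := \<lambda>x y. {c. ideal_gen A S x y c}\<rparr>"

text \<open>Finite-dimensional right modules: contravariant linear functors to finite-dimensional
  vector spaces, the latter taken as the coordinate spaces \<open>k\<^sup>m\<close> with matrices as linear maps.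
  For \<open>x \<le> y\<close>, \<open>act V x y\<close> is the value \<open>V y \<rightarrow> V x\<close> on the basis vector of \<open>Hom(x,y)\<close>; linearity
  forces the value on the morphism represented by \<open>c\<close> to be \<open>c\<close> times this matrix.
  Being a functor on the quotient means that the morphisms in \<open>Null\<close> act as zero.\<close>

record 'k rep =
  dimv :: "nat list \<Rightarrow> nat"
  act :: "nat list \<Rightarrow> nat list \<Rightarrow> 'k mat"

definition is_module :: "'k::field bound_cat \<Rightarrow> 'k rep \<Rightarrow> bool" where
  "is_module A V \<longleftrightarrow>
     (\<forall>x\<in>Vert A. \<forall>y\<in>Vert A. tuple_le x y \<longrightarrow> act V x y \<in> carrier_mat (dimv V x) (dimv V y)) \<and>
     (\<forall>x\<in>Vert A. act V x x = 1\<^sub>m (dimv V x)) \<and>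
     (\<forall>x\<in>Vert A. \<forall>y\<in>Vert A. \<forall>z\<in>Vert A. tuple_le x y \<and> tuple_le y z \<longrightarrow>
        act V x z = act V x y * act V y z) \<and>
     (\<forall>x\<in>Vert A. \<forall>y\<in>Vert A. tuple_le x y \<longrightarrow>
        (\<forall>c\<in>Null A x y. c \<cdot>\<^sub>m act V x y = 0\<^sub>m (dimv V x) (dimv V y)))"

text \<open>Morphisms are the natural transformations, extensional outside the vertices.\<close>

definition rep_hom ::
  "'k::field bound_cat \<Rightarrow> 'k rep \<Rightarrow> 'k rep \<Rightarrow> (nat list \<Rightarrow> 'k mat) set" where
  "rep_hom A V W = {\<phi> \<in> (\<Pi>\<^sub>E x\<in>Vert A. carrier_mat (dimv W x) (dimv V x)).
     \<forall>x\<in>Vert A. \<forall>y\<in>Vert A. tuple_le x y \<longrightarrow> \<phi> x * act V x y = act W x y * \<phi> y}"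

definition mod_cat :: "'k::field bound_cat \<Rightarrow> ('k rep, nat list \<Rightarrow> 'k mat) precat" where
  "mod_cat A = \<lparr>
     Objs = {V. is_module A V},
     Mor = rep_hom A,
     Cmp = (\<lambda>U V W \<psi> \<phi>. \<lambda>x\<in>Vert A. \<psi> x * \<phi> x),
     Idm = (\<lambda>V. \<lambda>x\<in>Vert A. 1\<^sub>m (dimv V x)),
     Zero = (\<lambda>V W. \<lambda>x\<in>Vert A. 0\<^sub>m (dimv W x) (dimv V x)),
     Plus = (\<lambda>V W \<phi> \<psi>. \<lambda>x\<in>Vert A. \<phi> x + \<psi> x)\<rparr>"


section \<open>Higher Auslander and higher Nakayama algebras of type A\<close>

definition grid :: "nat \<Rightarrow> nat \<Rightarrow> nat list set" where
  "grid n d = {x. length x = d \<and> set x \<subseteq> {0..<n}}"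

definition os :: "nat \<Rightarrow> nat \<Rightarrow> nat list set" where
  "os n d = {x \<in> grid n d. sorted x}"

definition grid_cat :: "nat \<Rightarrow> nat \<Rightarrow> 'k::field bound_cat" where
  "grid_cat n d = \<lparr>Vert = grid n d, Null = (\<lambda>x y. {0})\<rparr>"

definition auslander_alg :: "nat \<Rightarrow> nat \<Rightarrow> 'k::field bound_cat" where
  "auslander_alg n d = idem_quotient (grid_cat n d) (grid n d - os n d)"

definition M_support :: "nat \<Rightarrow> nat \<Rightarrow> nat list \<Rightarrow> nat list set" where
  "M_support n d x = {y \<in> os n d. \<forall>i<d. x ! i \<le> y ! i \<and> y ! i \<le> x ! (i + 1)}"

text \<open>The structure maps of the interval module are the \<open>1 \<times> 1\<close> identity matrix inside the
  support, and a matrix with no rows or no columns otherwise.\<close>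

definition M_int :: "nat \<Rightarrow> nat \<Rightarrow> nat list \<Rightarrow> 'k::field rep" where
  "M_int n d x =
     (let \<delta> = (\<lambda>y. if y \<in> M_support n d x then 1 else 0)
      in \<lparr>dimv = \<delta>, act = (\<lambda>y y'. mat (\<delta> y) (\<delta> y') (\<lambda>_. 1))\<rparr>)"

definition auslander_M :: "nat \<Rightarrow> nat \<Rightarrow> 'k::field rep set" where
  "auslander_M n d = add_closure (mod_cat (auslander_alg n d)) (M_int n d ` os n (d + 1))"

definition kupisch :: "nat \<Rightarrow> nat list \<Rightarrow> bool" where
  "kupisch n \<ll> \<longleftrightarrow> length \<ll> = n \<and> \<ll> ! 0 = 1 \<and>
     (\<forall>i. 1 \<le> i \<and> i < n \<longrightarrow> 2 \<le> \<ll> ! i \<and> \<ll> ! i \<le> \<ll> ! (i - 1) + 1)"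

text \<open>Here \<open>m \<ge> 1\<close>; since \<open>y\<close> is non-decreasing, the subtraction does not truncate.\<close>

definition os_kup :: "nat list \<Rightarrow> nat \<Rightarrow> nat list set" where
  "os_kup \<ll> m = {y \<in> os (length \<ll>) m. y ! (m - 1) - y ! 0 + 1 \<le> \<ll> ! (y ! (m - 1))}"

definition nakayama_alg :: "nat list \<Rightarrow> nat \<Rightarrow> 'k::field bound_cat" where
  "nakayama_alg \<ll> d =
     idem_quotient (auslander_alg (length \<ll>) d) (os (length \<ll>) d - os_kup \<ll> d)"

definition nakayama_M :: "nat list \<Rightarrow> nat \<Rightarrow> 'k::field rep set" where
  "nakayama_M \<ll> d = auslander_M (length \<ll>) d \<inter> Objs (mod_cat (nakayama_alg \<ll> d))"

definition U_class :: "nat list \<Rightarrow> nat \<Rightarrow> nat list set \<Rightarrow> 'k::field rep set" where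
  "U_class \<ll> d I = add_closure (mod_cat (nakayama_alg \<ll> d)) (M_int (length \<ll>) d ` I)"

text \<open>The relation \<open>x \<leadsto> y\<close>, i.e. \<open>x\<^sub>0 \<le> y\<^sub>0 \<le> x\<^sub>1 \<le> y\<^sub>1 \<le> \<dots> \<le> x\<^sub>d \<le> y\<^sub>d\<close>, and the
  translation \<open>\<tau>\<^sub>d\<close>, on integer tuples.\<close>

definition squig :: "int list \<Rightarrow> int list \<Rightarrow> bool" where
  "squig x y \<longleftrightarrow> length x = length y \<and> (\<forall>i<length x. x ! i \<le> y ! i) \<and>
     (\<forall>i. i + 1 < length x \<longrightarrow> y ! i \<le> x ! (i + 1))"

definition tau :: "int list \<Rightarrow> int list" where
  "tau x = map (\<lambda>a. a - 1) x"

end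

theory Submission
  imports Defs
begin

text \<open>Write \<open>x \<leadsto> y\<close> for \<open>x\<^sub>0 \<le> y\<^sub>0 \<le> x\<^sub>1 \<le> \<dots> \<le> x\<^sub>d \<le> y\<^sub>d\<close> (\<open>interlace d x y\<close> below). The image of a nonzero map
  \<open>M\<^sub>x \<rightarrow> M\<^sub>y\<close> is the intersection of the two supports, which must contain the top \<open>(x\<^sub>1, \<dots>, x\<^sub>d)\<close> of \<open>M\<^sub>x\<close>
  and the socle \<open>(y\<^sub>0, \<dots>, y\<^sub>d\<^sub>-\<^sub>1)\<close> of \<open>M\<^sub>y\<close>. Hence \<open>Hom(M\<^sub>x, M\<^sub>y)\<close> is one-dimensional if \<open>x \<leadsto> y\<close> and zero otherwise,
  and a composite of nonzero maps along \<open>x \<leadsto> y \<leadsto> z\<close> is nonzero exactly if \<open>x \<leadsto> z\<close>. Endomorphism rings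
  of the \<open>M\<^sub>x\<close> are the ground field, so every object of \<open>add\<close> is a finite direct sum of them
  (\<open>add_closure_eq_dsums\<close>), and exactness of a \<open>Hom\<close>-sequence has to be tested on the \<open>M\<^sub>w\<close> only. On a
  sequence of \<open>M\<^sub>x\<close>s joined by nonzero maps, \<open>Hom(M\<^sub>w, -)\<close> is exact at a place if and only if \<open>w\<close> is
  interlaced with exactly one of the two neighbours of that term, or not with the term itself.

  Only one family of sequences is required. For admissible \<open>x\<close> and \<open>t > x\<^sub>d\<close>, put \<open>z = (x\<^sub>1 + 1, \<dots>, x\<^sub>d + 1, t)\<close>; the tuples
  \<open>(x\<^sub>0, \<dots>, x\<^sub>k\<^sub>-\<^sub>1, z\<^sub>k, \<dots>, z\<^sub>d)\<close> for \<open>k = d + 1, \<dots>, 0\<close> give a \<open>d\<close>-exact sequence from \<open>M\<^sub>x\<close> to \<open>M\<^sub>z\<close> whose second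
  term is \<open>M\<^sub>y\<close> with \<open>y = (x\<^sub>0, \<dots>, x\<^sub>d\<^sub>-\<^sub>1, t)\<close>, provided that \<open>y\<close> is admissible too (\<open>stair_exact\<close>).

  Suppose that the two conditions hold. By the first, the largest number \<open>c\<close> such that \<open>u\<^sub>d = c\<close> for some
  \<open>u \<in> I\<close> with \<open>u \<leadsto> y\<close> gives \<open>x = (y\<^sub>0, \<dots>, y\<^sub>d\<^sub>-\<^sub>1, c) \<in> I\<close>, and \<open>M\<^sub>x \<subseteq> M\<^sub>y\<close> is the largest subobject in the
  class. If there is no such \<open>u\<close> or \<open>c = y\<^sub>d\<close>, then \<open>M\<^sub>y\<close> is
  torsion-free or torsion. If \<open>c < y\<^sub>d\<close>, the sequence above with \<open>t = y\<^sub>d\<close> is the one that the definition asks for: the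
  only obstruction to surjectivity of \<open>Hom(M\<^sub>w, V\<^sub>d\<^sub>-\<^sub>1) \<rightarrow> Hom(M\<^sub>w, V\<^sub>d)\<close> is a \<open>w\<close> to which the second condition
  applies together with \<open>x\<close>, and this would yield an element of \<open>I\<close> contradicting the maximality of \<open>c\<close>
  (\<open>closed_imp_torsion_at\<close>). General objects follow by taking direct sums (\<open>torsion_seq_sum\<close>).

  Conversely, let the class be a torsion class. If \<open>x \<in> I\<close>, \<open>x \<leadsto> z\<close> and \<open>x\<^sub>d = z\<^sub>d\<close>, then \<open>M\<^sub>x \<rightarrow> M\<^sub>z\<close> factors
  through the subobject \<open>U\<close> of \<open>M\<^sub>z\<close>, and a summand of \<open>U\<close> that carries the factorisation can only be
  \<open>M\<^sub>z\<close>; changing one coordinate at a time gives the first condition. For the second, if \<open>y = (x\<^sub>0, \<dots>, x\<^sub>d\<^sub>-\<^sub>1, z\<^sub>d)\<close>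
  were not in \<open>I\<close>, comparing the torsion sequence of \<open>M\<^sub>y\<close> with the explicit one would transport
  surjectivity at the last term to the latter, where it fails at \<open>M\<^sub>z\<close> (\<open>torsion_class_compare\<close>). All
  other cases of the second condition reduce to this one by means of the first.\<close>

section \<open>Semiadditive categories and exactness\<close>

definition arr :: "('o, 'm) precat \<Rightarrow> 'm \<Rightarrow> 'o \<Rightarrow> 'o \<Rightarrow> bool" where
  "arr C f X Y \<longleftrightarrow> X \<in> Objs C \<and> Y \<in> Objs C \<and> f \<in> Mor C X Y"

text \<open>Statements about \<open>Hom(-, W)\<close> are obtained from those about \<open>Hom(W, -)\<close> by passing to the opposite category.\<close>
definition opp :: "('o, 'm) precat \<Rightarrow> ('o, 'm) precat" where
  "opp C = \<lparr>Objs = Objs C, Mor = (\<lambda>X Y. Mor C Y X), Cmp = (\<lambda>X Y Z g f. Cmp C Z Y X f g),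
     Idm = Idm C, Zero = (\<lambda>X Y. Zero C Y X), Plus = (\<lambda>X Y. Plus C Y X)\<rparr>"

lemma opp_simps [simp]:
  "Objs (opp C) = Objs C" "Mor (opp C) X Y = Mor C Y X" "Cmp (opp C) X Y Z g f = Cmp C Z Y X f g"
  "Idm (opp C) = Idm C" "Zero (opp C) X Y = Zero C Y X" "Plus (opp C) X Y = Plus C Y X"
  by (simp_all add: opp_def)

lemma arr_opp [simp]: "arr (opp C) f X Y = arr C f Y X"
  by (auto simp: arr_def)

lemma zero_object_opp [simp]: "zero_object (opp C) Z = zero_object C Z"
  by (simp add: zero_object_def)

lemma ker_im_opp:
  "ker_pre C X Y f W = ker_post (opp C) Y X f W"
  "im_pre C X Y f W = im_post (opp C) Y X f W"
  by (simp_all add: ker_pre_def ker_post_def im_pre_def im_post_def)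

text \<open>Composition and addition of matrices do not depend on the objects, so they are binary operations
  here; this keeps compound expressions readable.\<close>
locale lin_category =
  fixes C :: "('o, 'm) precat"
    and cmp :: "'m \<Rightarrow> 'm \<Rightarrow> 'm" (infixr "\<star>" 70)
    and pls :: "'m \<Rightarrow> 'm \<Rightarrow> 'm" (infixl "\<uplus>" 65)
  assumes Cmp: "Cmp C X Y Z g f = g \<star> f"
    and Plus: "Plus C X Y f g = f \<uplus> g"
    and arr_id: "X \<in> Objs C \<Longrightarrow> arr C (Idm C X) X X"
    and arr_zero: "X \<in> Objs C \<Longrightarrow> Y \<in> Objs C \<Longrightarrow> arr C (Zero C X Y) X Y"
    and arr_cmp: "arr C f X Y \<Longrightarrow> arr C g Y Z \<Longrightarrow> arr C (g \<star> f) X Z"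
    and arr_pls: "arr C f X Y \<Longrightarrow> arr C g X Y \<Longrightarrow> arr C (f \<uplus> g) X Y"
    and assoc: "arr C f W X \<Longrightarrow> arr C g X Y \<Longrightarrow> arr C h Y Z \<Longrightarrow> (h \<star> g) \<star> f = h \<star> g \<star> f"
    and id_cmp: "arr C f X Y \<Longrightarrow> Idm C Y \<star> f = f"
    and cmp_id: "arr C f X Y \<Longrightarrow> f \<star> Idm C X = f"
    and zero_cmp: "arr C f X Y \<Longrightarrow> Z \<in> Objs C \<Longrightarrow> Zero C Y Z \<star> f = Zero C X Z"
    and cmp_zero: "arr C f X Y \<Longrightarrow> W \<in> Objs C \<Longrightarrow> f \<star> Zero C W X = Zero C W Y"
    and pls_zero: "arr C f X Y \<Longrightarrow> f \<uplus> Zero C X Y = f"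
    and zero_pls: "arr C f X Y \<Longrightarrow> Zero C X Y \<uplus> f = f"
    and pls_assoc: "arr C f X Y \<Longrightarrow> arr C g X Y \<Longrightarrow> arr C h X Y \<Longrightarrow> f \<uplus> g \<uplus> h = f \<uplus> (g \<uplus> h)"
    and pls_cmp: "arr C f X Y \<Longrightarrow> arr C g Y Z \<Longrightarrow> arr C h Y Z \<Longrightarrow> (g \<uplus> h) \<star> f = g \<star> f \<uplus> h \<star> f"
    and cmp_pls: "arr C f X Y \<Longrightarrow> arr C g X Y \<Longrightarrow> arr C h Y Z \<Longrightarrow> h \<star> (f \<uplus> g) = h \<star> f \<uplus> h \<star> g"
begin

lemma lin_category_opp: "lin_category (opp C) (\<lambda>g f. f \<star> g) (\<uplus>)"
proof unfold_locales
  fix f W X g Y h Z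
  assume "arr (opp C) f W X" "arr (opp C) g X Y" "arr (opp C) h Y Z"
  then show "f \<star> g \<star> h = (f \<star> g) \<star> h"
    using assoc[of h Z Y g X f W] by simp
qed (simp_all add: Cmp Plus arr_id arr_zero zero_cmp cmp_zero pls_zero zero_pls pls_assoc id_cmp cmp_id
      pls_cmp cmp_pls arr_cmp arr_pls)

definition biprod :: "'o \<Rightarrow> 'o \<Rightarrow> 'o \<Rightarrow> 'm \<Rightarrow> 'm \<Rightarrow> 'm \<Rightarrow> 'm \<Rightarrow> bool" where
  "biprod X Y S i j p q \<longleftrightarrow> arr C i X S \<and> arr C j Y S \<and> arr C p S X \<and> arr C q S Y \<and>
     p \<star> i = Idm C X \<and> q \<star> j = Idm C Y \<and> p \<star> j = Zero C Y X \<and> q \<star> i = Zero C X Y \<and>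
     i \<star> p \<uplus> j \<star> q = Idm C S"

lemma direct_sum_iff: "direct_sum C X Y S \<longleftrightarrow> (\<exists>i j p q. biprod X Y S i j p q)"
  unfolding direct_sum_def biprod_def arr_def Cmp Plus by blast

lemma biprod_split:
  assumes "biprod X Y S i j p q" "arr C h W S"
  shows "h = i \<star> p \<star> h \<uplus> j \<star> q \<star> h"
proof -
  have a: "arr C i X S" "arr C j Y S" "arr C p S X" "arr C q S Y" and e: "i \<star> p \<uplus> j \<star> q = Idm C S"
    using assms(1) by (auto simp: biprod_def)
  have "h = (i \<star> p \<uplus> j \<star> q) \<star> h"
    using id_cmp[OF assms(2)] e by simp
  also have "\<dots> = (i \<star> p) \<star> h \<uplus> (j \<star> q) \<star> h"
    by (rule pls_cmp[OF assms(2)]) (blast intro: arr_cmp a)+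
  also have "\<dots> = i \<star> p \<star> h \<uplus> j \<star> q \<star> h"
    using assoc[OF assms(2) a(3) a(1)] assoc[OF assms(2) a(4) a(2)] by simp
  finally show ?thesis .
qed

lemma biprod_split_pre:
  assumes "biprod X Y S i j p q" "arr C h S W"
  shows "h = (h \<star> i) \<star> p \<uplus> (h \<star> j) \<star> q"
proof -
  have a: "arr C i X S" "arr C j Y S" "arr C p S X" "arr C q S Y" and e: "i \<star> p \<uplus> j \<star> q = Idm C S"
    using assms(1) by (auto simp: biprod_def)
  have "h = h \<star> (i \<star> p \<uplus> j \<star> q)"
    using cmp_id[OF assms(2)] e by simp
  also have "\<dots> = h \<star> i \<star> p \<uplus> h \<star> j \<star> q"
    by (rule cmp_pls[OF _ _ assms(2)]) (blast intro: arr_cmp a)+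
  also have "\<dots> = (h \<star> i) \<star> p \<uplus> (h \<star> j) \<star> q"
    using assoc[OF a(3) a(1) assms(2)] assoc[OF a(4) a(2) assms(2)] by simp
  finally show ?thesis .
qed

lemma zero_pls_zero:
  assumes "X \<in> Objs C" "Y \<in> Objs C"
  shows "Zero C X Y \<uplus> Zero C X Y = Zero C X Y"
  using pls_zero[OF arr_zero] assms by blast

lemma zero_object_arr:
  assumes "zero_object C Z"
  shows "arr C f W Z \<Longrightarrow> f = Zero C W Z" "arr C f Z W \<Longrightarrow> f = Zero C Z W"
  using assms id_cmp cmp_id zero_cmp cmp_zero unfolding zero_object_def by (metis arr_def)+

text \<open>\<open>exact_at W X Y Z f g\<close> is exactness of \<open>Hom(W,X) \<rightarrow> Hom(W,Y) \<rightarrow> Hom(W,Z)\<close> in the middle.\<close>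
definition exact_at :: "'o \<Rightarrow> 'o \<Rightarrow> 'o \<Rightarrow> 'o \<Rightarrow> 'm \<Rightarrow> 'm \<Rightarrow> bool" where
  "exact_at W X Y Z f g \<longleftrightarrow>
     (\<forall>h. arr C h W Y \<longrightarrow> (g \<star> h = Zero C W Z \<longleftrightarrow> (\<exists>k. arr C k W X \<and> h = f \<star> k)))"

definition inj_at :: "'o \<Rightarrow> 'o \<Rightarrow> 'o \<Rightarrow> 'm \<Rightarrow> bool" where
  "inj_at W X Y f \<longleftrightarrow> (\<forall>h. arr C h W X \<longrightarrow> f \<star> h = Zero C W Y \<longrightarrow> h = Zero C W X)"

definition surj_at :: "'o \<Rightarrow> 'o \<Rightarrow> 'o \<Rightarrow> 'm \<Rightarrow> bool" where
  "surj_at W X Y f \<longleftrightarrow> (\<forall>h. arr C h W Y \<longrightarrow> (\<exists>k. arr C k W X \<and> h = f \<star> k))"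

lemma exact_at_iff:
  assumes "W \<in> Objs C" "arr C f X Y" "arr C g Y Z"
  shows "ker_post C Y Z g W = im_post C X Y f W \<longleftrightarrow> exact_at W X Y Z f g"
proof -
  have m: "h \<in> Mor C W X \<longleftrightarrow> arr C h W X" "h \<in> Mor C W Y \<longleftrightarrow> arr C h W Y" for h
    using assms by (auto simp: arr_def)
  show ?thesis
    unfolding ker_post_def im_post_def exact_at_def Cmp set_eq_iff
    using assms arr_cmp by (simp add: m image_iff Bex_def) (metis arr_cmp)
qed

lemma inj_at_iff:
  assumes "W \<in> Objs C" "arr C f X Y"
  shows "ker_post C X Y f W = {Zero C W X} \<longleftrightarrow> inj_at W X Y f"
proof -
  have m: "h \<in> Mor C W X \<longleftrightarrow> arr C h W X" for h
    using assms by (auto simp: arr_def)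
  have "arr C (Zero C W X) W X" "f \<star> Zero C W X = Zero C W Y"
    using assms arr_zero cmp_zero by (auto simp: arr_def)
  then show ?thesis
    unfolding ker_post_def inj_at_def Cmp set_eq_iff
    by (auto simp: m)
qed

lemma surj_at_iff:
  assumes "W \<in> Objs C" "arr C f X Y"
  shows "im_post C X Y f W = Mor C W Y \<longleftrightarrow> surj_at W X Y f"
proof -
  have m: "h \<in> Mor C W X \<longleftrightarrow> arr C h W X" "h \<in> Mor C W Y \<longleftrightarrow> arr C h W Y" for h
    using assms by (auto simp: arr_def)
  show ?thesis
    unfolding im_post_def surj_at_def Cmp set_eq_iff
    using assms arr_cmp by (simp add: m image_iff Bex_def) (metis arr_cmp)
qed

text \<open>The objects \<open>W\<close> that pass one of the three tests are closed under direct sums, so it is enough to test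
  with indecomposable ones.\<close>
lemma exact_at_zero:
  assumes "zero_object C W" "arr C f X Y" "arr C g Y Z"
  shows "exact_at W X Y Z f g"
proof -
  have W: "W \<in> Objs C" using assms(1) by (simp add: zero_object_def)
  have "arr C (Zero C W X) W X" "f \<star> Zero C W X = Zero C W Y" "g \<star> Zero C W Y = Zero C W Z"
    using assms W arr_zero cmp_zero by (auto simp: arr_def)
  then show ?thesis
    unfolding exact_at_def using zero_object_arr[OF assms(1)] by metis
qed

lemma exact_at_sum:
  assumes b: "biprod W W' S i j p q" and f: "arr C f X Y" and g: "arr C g Y Z"
    and ex: "exact_at W X Y Z f g" "exact_at W' X Y Z f g"
  shows "exact_at S X Y Z f g"
  unfolding exact_at_def
proof (intro allI impI iffI)
  have a: "arr C i W S" "arr C j W' S" "arr C p S W" "arr C q S W'"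
    using b by (auto simp: biprod_def)
  fix h assume h: "arr C h S Y"
  have hi: "arr C (h \<star> i) W Y" "arr C (h \<star> j) W' Y" using a h arr_cmp by blast+
  {
    assume "g \<star> h = Zero C S Z"
    then have "g \<star> h \<star> i = Zero C W Z" "g \<star> h \<star> j = Zero C W' Z"
      using assoc[OF a(1) h g] assoc[OF a(2) h g] zero_cmp a g by (auto simp: arr_def)
    then obtain k k' where k: "arr C k W X" "h \<star> i = f \<star> k" "arr C k' W' X" "h \<star> j = f \<star> k'"
      using ex hi unfolding exact_at_def by metis
    have kk: "arr C (k \<star> p) S X" "arr C (k' \<star> q) S X" using k a arr_cmp by blast+
    have "h = (f \<star> k) \<star> p \<uplus> (f \<star> k') \<star> q"
      using biprod_split_pre[OF b h] k by simp
    also have "\<dots> = f \<star> (k \<star> p \<uplus> k' \<star> q)"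
      using assoc[OF a(3) k(1) f] assoc[OF a(4) k(3) f] cmp_pls[OF kk f] by simp
    finally show "\<exists>k. arr C k S X \<and> h = f \<star> k"
      using arr_pls[OF kk] by blast
  next
    assume "\<exists>k. arr C k S X \<and> h = f \<star> k"
    then obtain k where k: "arr C k S X" "h = f \<star> k" by blast
    have ki: "arr C (k \<star> i) W X" "arr C (k \<star> j) W' X" using k a arr_cmp by blast+
    have e: "h \<star> i = f \<star> k \<star> i" "h \<star> j = f \<star> k \<star> j"
      using assoc[OF a(1) k(1) f] assoc[OF a(2) k(1) f] k by simp_all
    have z: "g \<star> h \<star> i = Zero C W Z" "g \<star> h \<star> j = Zero C W' Z"
      using ex hi e ki unfolding exact_at_def by metis+
    have gh: "arr C (g \<star> h) S Z" using g h arr_cmp by blast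
    have "g \<star> h = ((g \<star> h) \<star> i) \<star> p \<uplus> ((g \<star> h) \<star> j) \<star> q"
      by (rule biprod_split_pre[OF b gh])
    also have "\<dots> = Zero C W Z \<star> p \<uplus> Zero C W' Z \<star> q"
      using assoc[OF a(1) h g] assoc[OF a(2) h g] z by simp
    also have "\<dots> = Zero C S Z \<uplus> Zero C S Z"
      using zero_cmp[OF a(3), of Z] zero_cmp[OF a(4), of Z] g by (simp add: arr_def)
    also have "\<dots> = Zero C S Z"
      using zero_pls_zero gh by (simp add: arr_def)
    finally show "g \<star> h = Zero C S Z" .
  }
qed

lemma inj_at_zero:
  assumes "zero_object C W" shows "inj_at W X Y f"
  unfolding inj_at_def using zero_object_arr[OF assms] by blast

lemma inj_at_sum:
  assumes b: "biprod W W' S i j p q" and f: "arr C f X Y"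
    and ex: "inj_at W X Y f" "inj_at W' X Y f"
  shows "inj_at S X Y f"
  unfolding inj_at_def
proof (intro allI impI)
  have a: "arr C i W S" "arr C j W' S" "arr C p S W" "arr C q S W'"
    using b by (auto simp: biprod_def)
  fix h assume h: "arr C h S X" and z: "f \<star> h = Zero C S Y"
  have hi: "arr C (h \<star> i) W X" "arr C (h \<star> j) W' X" using a h arr_cmp by blast+
  have "f \<star> h \<star> i = Zero C W Y" "f \<star> h \<star> j = Zero C W' Y"
    using assoc[OF a(1) h f] assoc[OF a(2) h f] zero_cmp a f z by (auto simp: arr_def)
  then have "h \<star> i = Zero C W X" "h \<star> j = Zero C W' X"
    using ex hi unfolding inj_at_def by blast+
  then have "h = Zero C W X \<star> p \<uplus> Zero C W' X \<star> q"
    using biprod_split_pre[OF b h] by simp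
  also have "\<dots> = Zero C S X"
    using zero_cmp[OF a(3), of X] zero_cmp[OF a(4), of X] zero_pls_zero h by (simp add: arr_def)
  finally show "h = Zero C S X" .
qed

lemma surj_at_zero:
  assumes "zero_object C W" "arr C f X Y" shows "surj_at W X Y f"
proof -
  have W: "W \<in> Objs C" using assms(1) by (simp add: zero_object_def)
  have "arr C (Zero C W X) W X" "f \<star> Zero C W X = Zero C W Y"
    using assms W arr_zero cmp_zero by (auto simp: arr_def)
  then show ?thesis
    unfolding surj_at_def using zero_object_arr[OF assms(1)] by metis
qed

lemma surj_at_sum:
  assumes b: "biprod W W' S i j p q" and f: "arr C f X Y"
    and ex: "surj_at W X Y f" "surj_at W' X Y f"
  shows "surj_at S X Y f"
  unfolding surj_at_def
proof (intro allI impI)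
  have a: "arr C i W S" "arr C j W' S" "arr C p S W" "arr C q S W'"
    using b by (auto simp: biprod_def)
  fix h assume h: "arr C h S Y"
  have hi: "arr C (h \<star> i) W Y" "arr C (h \<star> j) W' Y" using a h arr_cmp by blast+
  then obtain k k' where k: "arr C k W X" "h \<star> i = f \<star> k" "arr C k' W' X" "h \<star> j = f \<star> k'"
    using ex unfolding surj_at_def by metis
  have kk: "arr C (k \<star> p) S X" "arr C (k' \<star> q) S X" using k a arr_cmp by blast+
  have "h = (f \<star> k) \<star> p \<uplus> (f \<star> k') \<star> q"
    using biprod_split_pre[OF b h] k by simp
  also have "\<dots> = f \<star> (k \<star> p \<uplus> k' \<star> q)"
    using assoc[OF a(3) k(1) f] assoc[OF a(4) k(3) f] cmp_pls[OF kk f] by simp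
  finally show "\<exists>k. arr C k S X \<and> h = f \<star> k"
    using arr_pls[OF kk] by blast
qed

text \<open>\<open>h\<close> is \<open>f \<oplus> f'\<close>; passing to the opposite category permutes the four equations.\<close>
definition sum_map where
  "sum_map i j p q f f' h i' j' p' q' \<longleftrightarrow> 
     p' \<star> h = f \<star> p \<and> q' \<star> h = f' \<star> q \<and> h \<star> i = i' \<star> f \<and> h \<star> j = j' \<star> f'"

lemma sum_map_exists:
  assumes b: "biprod X X' X'' i j p q" and b': "biprod Y Y' Y'' i' j' p' q'"
    and f: "arr C f X Y" and f': "arr C f' X' Y'"
  shows "\<exists>h. arr C h X'' Y'' \<and> sum_map i j p q f f' h i' j' p' q'"
proof -
  have a: "arr C i X X''" "arr C j X' X''" "arr C p X'' X" "arr C q X'' X'"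
    and e: "p \<star> i = Idm C X" "q \<star> j = Idm C X'" "p \<star> j = Zero C X' X" "q \<star> i = Zero C X X'"
    using b by (auto simp: biprod_def)
  have a': "arr C i' Y Y''" "arr C j' Y' Y''" "arr C p' Y'' Y" "arr C q' Y'' Y'"
    and e': "p' \<star> i' = Idm C Y" "q' \<star> j' = Idm C Y'" "p' \<star> j' = Zero C Y' Y" "q' \<star> i' = Zero C Y Y'"
    using b' by (auto simp: biprod_def)
  have o: "X \<in> Objs C" "X' \<in> Objs C" "X'' \<in> Objs C" "Y \<in> Objs C" "Y' \<in> Objs C" "Y'' \<in> Objs C"
    using a a' by (auto simp: arr_def)
  let ?u = "i' \<star> f \<star> p" and ?v = "j' \<star> f' \<star> q"
  have fp: "arr C (f \<star> p) X'' Y" "arr C (f' \<star> q) X'' Y'"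
    and if': "arr C (i' \<star> f) X Y''" "arr C (j' \<star> f') X' Y''"
    using a a' f f' arr_cmp by blast+
  have uv: "arr C ?u X'' Y''" "arr C ?v X'' Y''"
    using fp a' arr_cmp by blast+
  have 1: "p' \<star> ?u = f \<star> p" "q' \<star> ?v = f' \<star> q" "p' \<star> ?v = Zero C X'' Y" "q' \<star> ?u = Zero C X'' Y'"
    using assoc[OF fp(1) a'(1) a'(3)] assoc[OF fp(2) a'(2) a'(4)] assoc[OF fp(2) a'(2) a'(3)]
      assoc[OF fp(1) a'(1) a'(4)] e' id_cmp fp zero_cmp o by auto
  have u: "?u = (i' \<star> f) \<star> p" and v: "?v = (j' \<star> f') \<star> q"
    using assoc[OF a(3) f a'(1)] assoc[OF a(4) f' a'(2)] by simp_all
  have 2: "?u \<star> i = i' \<star> f" "?v \<star> j = j' \<star> f'" "?u \<star> j = Zero C X' Y''" "?v \<star> i = Zero C X Y''"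
    unfolding u v
    using assoc[OF a(1) a(3) if'(1)] assoc[OF a(2) a(4) if'(2)] assoc[OF a(2) a(3) if'(1)]
      assoc[OF a(1) a(4) if'(2)] e cmp_id if' cmp_zero o by auto
  have "sum_map i j p q f f' (?u \<uplus> ?v) i' j' p' q'"
    unfolding sum_map_def
    using cmp_pls[OF uv a'(3)] cmp_pls[OF uv a'(4)] pls_cmp[OF a(1) uv] pls_cmp[OF a(2) uv] 1 2
      pls_zero zero_pls fp if' by auto
  then show ?thesis using arr_pls[OF uv] by blast
qed

context
  fixes X X' X'' Y Y' Y'' f f' f'' i j p q i' j' p' q'
  assumes bX: "biprod X X' X'' i j p q" and bY: "biprod Y Y' Y'' i' j' p' q'"
    and f: "arr C f X Y" "arr C f' X' Y'" "arr C f'' X'' Y''"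
    and fs: "sum_map i j p q f f' f'' i' j' p' q'"
begin

lemma surj_at_sum_seq:
  assumes "surj_at W X Y f" "surj_at W X' Y' f'"
  shows "surj_at W X'' Y'' f''"
  unfolding surj_at_def
proof (intro allI impI)
  have a: "arr C i X X''" "arr C j X' X''" using bX by (auto simp: biprod_def)
  have a': "arr C i' Y Y''" "arr C j' Y' Y''" "arr C p' Y'' Y" "arr C q' Y'' Y'"
    using bY by (auto simp: biprod_def)
  fix h assume h: "arr C h W Y''"
  have "arr C (p' \<star> h) W Y" "arr C (q' \<star> h) W Y'" using a' h arr_cmp by blast+
  then obtain k k' where k: "arr C k W X" "p' \<star> h = f \<star> k" "arr C k' W X'" "q' \<star> h = f' \<star> k'"
    using assms unfolding surj_at_def by metis
  have ik: "arr C (i \<star> k) W X''" "arr C (j \<star> k') W X''" using a k arr_cmp by blast+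
  have "h = i' \<star> f \<star> k \<uplus> j' \<star> f' \<star> k'"
    using biprod_split[OF bY h] k by simp
  also have "\<dots> = f'' \<star> i \<star> k \<uplus> f'' \<star> j \<star> k'"
    using assoc[OF k(1) f(1) a'(1)] assoc[OF k(1) a(1) f(3)]
      assoc[OF k(3) f(2) a'(2)] assoc[OF k(3) a(2) f(3)] fs
    by (simp add: sum_map_def)
  also have "\<dots> = f'' \<star> (i \<star> k \<uplus> j \<star> k')"
    using cmp_pls[OF ik f(3)] by simp
  finally show "\<exists>k. arr C k W X'' \<and> h = f'' \<star> k"
    using arr_pls[OF ik] by blast
qed

lemma inj_at_sum_seq:
  assumes "inj_at W X Y f" "inj_at W X' Y' f'"
  shows "inj_at W X'' Y'' f''"
  unfolding inj_at_def
proof (intro allI impI)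
  have a: "arr C i X X''" "arr C j X' X''" "arr C p X'' X" "arr C q X'' X'"
    using bX by (auto simp: biprod_def)
  have a': "arr C p' Y'' Y" "arr C q' Y'' Y'" using bY by (auto simp: biprod_def)
  fix h assume h: "arr C h W X''" and z: "f'' \<star> h = Zero C W Y''"
  have W: "W \<in> Objs C" using h by (simp add: arr_def)
  have "f \<star> p \<star> h = p' \<star> f'' \<star> h" "f' \<star> q \<star> h = q' \<star> f'' \<star> h"
    using fs assoc[OF h a(3) f(1)] assoc[OF h f(3) a'(1)] assoc[OF h a(4) f(2)]
      assoc[OF h f(3) a'(2)] by (simp_all add: sum_map_def)
  then have "f \<star> p \<star> h = Zero C W Y" "f' \<star> q \<star> h = Zero C W Y'"
    using z cmp_zero a' W by auto
  then have "p \<star> h = Zero C W X" "q \<star> h = Zero C W X'"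
    using assms arr_cmp h a unfolding inj_at_def by blast+
  then have "h = i \<star> Zero C W X \<uplus> j \<star> Zero C W X'"
    using biprod_split[OF bX h] by simp
  also have "\<dots> = Zero C W X''"
    using cmp_zero[OF a(1) W] cmp_zero[OF a(2) W] zero_pls_zero h by (simp add: arr_def)
  finally show "h = Zero C W X''" .
qed

lemma exact_at_sum_seq:
  assumes bZ: "biprod Z Z' Z'' i'' j'' p'' q''"
    and g: "arr C g Y Z" "arr C g' Y' Z'" "arr C g'' Y'' Z''"
    and gs: "sum_map i' j' p' q' g g' g'' i'' j'' p'' q''"
    and ex: "exact_at W X Y Z f g" "exact_at W X' Y' Z' f' g'"
  shows "exact_at W X'' Y'' Z'' f'' g''"
  unfolding exact_at_def
proof (intro allI impI iffI)
  have a: "arr C i X X''" "arr C j X' X''" "arr C p X'' X" "arr C q X'' X'"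
    using bX by (auto simp: biprod_def)
  have a': "arr C i' Y Y''" "arr C j' Y' Y''" "arr C p' Y'' Y" "arr C q' Y'' Y'"
    using bY by (auto simp: biprod_def)
  have a'': "arr C i'' Z Z''" "arr C j'' Z' Z''" "arr C p'' Z'' Z" "arr C q'' Z'' Z'"
    using bZ by (auto simp: biprod_def)
  fix h assume h: "arr C h W Y''"
  have W: "W \<in> Objs C" using h by (simp add: arr_def)
  have ph: "arr C (p' \<star> h) W Y" "arr C (q' \<star> h) W Y'" using a' h arr_cmp by blast+
  have gp: "g \<star> p' \<star> h = p'' \<star> g'' \<star> h" "g' \<star> q' \<star> h = q'' \<star> g'' \<star> h"
    using gs assoc[OF h a'(3) g(1)] assoc[OF h g(3) a''(3)] assoc[OF h a'(4) g(2)]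
      assoc[OF h g(3) a''(4)] by (simp_all add: sum_map_def)
  {
    assume "g'' \<star> h = Zero C W Z''"
    then have "g \<star> p' \<star> h = Zero C W Z" "g' \<star> q' \<star> h = Zero C W Z'"
      using gp cmp_zero a'' W by auto
    then obtain k k' where k: "arr C k W X" "p' \<star> h = f \<star> k" "arr C k' W X'" "q' \<star> h = f' \<star> k'"
      using ex ph unfolding exact_at_def by metis
    have ik: "arr C (i \<star> k) W X''" "arr C (j \<star> k') W X''" using a k arr_cmp by blast+
    have "h = i' \<star> f \<star> k \<uplus> j' \<star> f' \<star> k'"
      using biprod_split[OF bY h] k by simp
    also have "\<dots> = f'' \<star> i \<star> k \<uplus> f'' \<star> j \<star> k'"
      using assoc[OF k(1) f(1) a'(1)] assoc[OF k(1) a(1) f(3)]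
        assoc[OF k(3) f(2) a'(2)] assoc[OF k(3) a(2) f(3)] fs
      by (simp add: sum_map_def)
    also have "\<dots> = f'' \<star> (i \<star> k \<uplus> j \<star> k')"
      using cmp_pls[OF ik f(3)] by simp
    finally show "\<exists>k. arr C k W X'' \<and> h = f'' \<star> k"
      using arr_pls[OF ik] by blast
  next
    assume "\<exists>k. arr C k W X'' \<and> h = f'' \<star> k"
    then obtain k where k: "arr C k W X''" "h = f'' \<star> k" by blast
    have pk: "arr C (p \<star> k) W X" "arr C (q \<star> k) W X'" using a k arr_cmp by blast+
    have "p' \<star> h = f \<star> p \<star> k" "q' \<star> h = f' \<star> q \<star> k"
      using k fs assoc[OF k(1) a(3) f(1)] assoc[OF k(1) f(3) a'(3)] assoc[OF k(1) a(4) f(2)]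
        assoc[OF k(1) f(3) a'(4)] by (simp_all add: sum_map_def)
    then have "g \<star> p' \<star> h = Zero C W Z" "g' \<star> q' \<star> h = Zero C W Z'"
      using ex ph pk unfolding exact_at_def by metis+
    then have pz: "p'' \<star> g'' \<star> h = Zero C W Z" "q'' \<star> g'' \<star> h = Zero C W Z'"
      using gp by auto
    have gh: "arr C (g'' \<star> h) W Z''" using g h arr_cmp by blast
    have "g'' \<star> h = i'' \<star> Zero C W Z \<uplus> j'' \<star> Zero C W Z'"
      using biprod_split[OF bZ gh] pz by simp
    also have "\<dots> = Zero C W Z''"
      using cmp_zero[OF a''(1) W] cmp_zero[OF a''(2) W] zero_pls_zero gh by (simp add: arr_def)
    finally show "g'' \<star> h = Zero C W Z''" .
  }
qed

end

end

section \<open>Finite direct sums and Krull-Schmidt\<close>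

inductive_set dsums :: "('o, 'm) precat \<Rightarrow> 'o set \<Rightarrow> 'o set" for C B where
  dsums_zero: "zero_object C Z \<Longrightarrow> Z \<in> dsums C B"
| dsums_add: "X \<in> B \<Longrightarrow> Y \<in> dsums C B \<Longrightarrow> direct_sum C X Y S \<Longrightarrow> S \<in> dsums C B"

lemma dsums_Objs: "X \<in> dsums C B \<Longrightarrow> X \<in> Objs C"
  by (induction rule: dsums.induct) (auto simp: zero_object_def direct_sum_def)

lemma dsums_mono: "X \<in> dsums C B \<Longrightarrow> B \<subseteq> B' \<Longrightarrow> X \<in> dsums C B'"
  by (induction rule: dsums.induct) (auto intro: dsums.intros)

context lin_category
begin

lemma direct_sum_opp: "direct_sum (opp C) X Y S = direct_sum C X Y S"
proof -
  interpret op: lin_category "opp C" "\<lambda>g f. f \<star> g" "(\<uplus>)" by (rule lin_category_opp)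
  show ?thesis
    unfolding op.direct_sum_iff direct_sum_iff op.biprod_def biprod_def by (simp, blast)
qed

lemma biprod_opp: "biprod X Y S i j p q \<Longrightarrow> lin_category.biprod (opp C) (\<lambda>g f. f \<star> g) (\<uplus>) X Y S p q i j"
  unfolding lin_category.biprod_def[OF lin_category_opp] biprod_def by simp

lemma dsums_opp: "dsums (opp C) B = dsums C B"
proof -
  have "X \<in> dsums (opp C) B \<Longrightarrow> X \<in> dsums C B" for X
    by (induction rule: dsums.induct) (auto intro: dsums.intros simp: direct_sum_opp)
  moreover have "X \<in> dsums C B \<Longrightarrow> X \<in> dsums (opp C) B" for X
    by (induction rule: dsums.induct) (auto intro: dsums.intros simp: direct_sum_opp)
  ultimately show ?thesis by blast
qed

lemma exact_at_dsums:
  assumes "W \<in> dsums C B" and f: "arr C f X Y" and g: "arr C g Y Z"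
    and "\<And>W. W \<in> B \<Longrightarrow> exact_at W X Y Z f g"
  shows "exact_at W X Y Z f g"
  using assms(1)
proof (induction rule: dsums.induct)
  case (dsums_zero Z) then show ?case using exact_at_zero f g by blast
next
  case (dsums_add W W' S)
  then show ?case using exact_at_sum[OF _ f g] assms(4) unfolding direct_sum_iff by blast
qed

lemma inj_at_dsums:
  assumes "W \<in> dsums C B" and f: "arr C f X Y"
    and "\<And>W. W \<in> B \<Longrightarrow> inj_at W X Y f"
  shows "inj_at W X Y f"
  using assms(1)
proof (induction rule: dsums.induct)
  case (dsums_zero Z) then show ?case using inj_at_zero by blast
next
  case (dsums_add W W' S)
  then show ?case using inj_at_sum[OF _ f] assms(3) unfolding direct_sum_iff by blast
qed

lemma surj_at_dsums:
  assumes "W \<in> dsums C B" and f: "arr C f X Y"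
    and "\<And>W. W \<in> B \<Longrightarrow> surj_at W X Y f"
  shows "surj_at W X Y f"
  using assms(1)
proof (induction rule: dsums.induct)
  case (dsums_zero Z) then show ?case using surj_at_zero f by blast
next
  case (dsums_add W W' S)
  then show ?case using surj_at_sum[OF _ f] assms(3) unfolding direct_sum_iff by blast
qed

text \<open>For sequences inside a subcategory, the set-theoretic conditions in the definitions of \<open>d\<close>-exactness
  and of torsion classes become the elementwise ones, one test object at a time.\<close>
definition seq_arr :: "'o set \<Rightarrow> nat \<Rightarrow> (nat \<Rightarrow> 'o) \<Rightarrow> (nat \<Rightarrow> 'm) \<Rightarrow> bool" where
  "seq_arr M d X f \<longleftrightarrow> (\<forall>i\<le>d + 1. X i \<in> M) \<and> (\<forall>i\<le>d. arr C (f i) (X i) (X (i + 1)))"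

lemma sequence_in_iff:
  assumes "M \<subseteq> Objs C"
  shows "sequence_in C M d X f \<longleftrightarrow> seq_arr M d X f"
  using assms unfolding sequence_in_def seq_arr_def arr_def
  by (auto simp: subset_iff)

definition kernel_exact_at :: "'o \<Rightarrow> nat \<Rightarrow> (nat \<Rightarrow> 'o) \<Rightarrow> (nat \<Rightarrow> 'm) \<Rightarrow> bool" where
  "kernel_exact_at W d X f \<longleftrightarrow> inj_at W (X 0) (X 1) (f 0) \<and>
     (\<forall>i\<in>{1..d}. exact_at W (X (i - 1)) (X i) (X (i + 1)) (f (i - 1)) (f i))"

definition cokernel_exact_at :: "'o \<Rightarrow> nat \<Rightarrow> (nat \<Rightarrow> 'o) \<Rightarrow> (nat \<Rightarrow> 'm) \<Rightarrow> bool" where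
  "cokernel_exact_at W d X f \<longleftrightarrow>
     lin_category.inj_at (opp C) (\<lambda>g f. f \<star> g) W (X (d + 1)) (X d) (f d) \<and>
     (\<forall>i\<in>{1..d}. lin_category.exact_at (opp C) (\<lambda>g f. f \<star> g) W
        (X (i + 1)) (X i) (X (i - 1)) (f i) (f (i - 1)))"

definition torsion_exact_at :: "'o \<Rightarrow> nat \<Rightarrow> (nat \<Rightarrow> 'o) \<Rightarrow> (nat \<Rightarrow> 'm) \<Rightarrow> bool" where
  "torsion_exact_at W d X f \<longleftrightarrow> inj_at W (X 2) (X 3) (f 2) \<and>
     (\<forall>i\<in>{3..d}. exact_at W (X (i - 1)) (X i) (X (i + 1)) (f (i - 1)) (f i)) \<and>
     surj_at W (X d) (X (d + 1)) (f d)"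

lemma seq_arr_at:
  assumes "seq_arr M d X f" "1 \<le> i" "i \<le> d"
  shows "arr C (f (i - 1)) (X (i - 1)) (X i)" "arr C (f i) (X i) (X (i + 1))"
proof -
  have "i - 1 \<le> d" "i - 1 + 1 = i" using assms by auto
  then show "arr C (f (i - 1)) (X (i - 1)) (X i)" "arr C (f i) (X i) (X (i + 1))"
    using assms unfolding seq_arr_def by metis+
qed

lemma d_exact_iff:
  assumes M: "M \<subseteq> Objs C"
  shows "d_exact C M d X f \<longleftrightarrow> seq_arr M d X f \<and>
    (\<forall>W\<in>M. kernel_exact_at W d X f \<and> cokernel_exact_at W d X f)"
proof (cases "seq_arr M d X f")
  case True
  interpret op: lin_category "opp C" "\<lambda>g f. f \<star> g" "(\<uplus>)" by (rule lin_category_opp)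
  have "d_kernel C M d X f \<longleftrightarrow> (\<forall>W\<in>M. kernel_exact_at W d X f)"
  proof -
    have "ker_post C (X 0) (X 1) (f 0) W = {Zero C W (X 0)} \<longleftrightarrow> inj_at W (X 0) (X 1) (f 0)"
      "i \<in> {1..d} \<Longrightarrow> ker_post C (X i) (X (i + 1)) (f i) W = im_post C (X (i - 1)) (X i) (f (i - 1)) W
        \<longleftrightarrow> exact_at W (X (i - 1)) (X i) (X (i + 1)) (f (i - 1)) (f i)" if "W \<in> M" for W i
    proof -
      show "ker_post C (X 0) (X 1) (f 0) W = {Zero C W (X 0)} \<longleftrightarrow> inj_at W (X 0) (X 1) (f 0)"
        by (rule inj_at_iff) (use that M True in \<open>auto simp: seq_arr_def\<close>)
      assume i: "i \<in> {1..d}"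
      show "ker_post C (X i) (X (i + 1)) (f i) W = im_post C (X (i - 1)) (X i) (f (i - 1)) W
        \<longleftrightarrow> exact_at W (X (i - 1)) (X i) (X (i + 1)) (f (i - 1)) (f i)"
        by (rule exact_at_iff) (use that M i seq_arr_at[OF True, of i] in auto)
    qed
    then show ?thesis
      unfolding d_kernel_def sequence_in_iff[OF M] kernel_exact_at_def using True by simp
  qed
  moreover have "d_cokernel C M d X f \<longleftrightarrow> (\<forall>W\<in>M. cokernel_exact_at W d X f)"
  proof -
    have "ker_pre C (X d) (X (d + 1)) (f d) W = {Zero C (X (d + 1)) W}
        \<longleftrightarrow> op.inj_at W (X (d + 1)) (X d) (f d)"
      "i \<in> {1..d} \<Longrightarrow> ker_pre C (X (i - 1)) (X i) (f (i - 1)) W = im_pre C (X i) (X (i + 1)) (f i) W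
        \<longleftrightarrow> op.exact_at W (X (i + 1)) (X i) (X (i - 1)) (f i) (f (i - 1))" if "W \<in> M" for W i
    proof -
      show "ker_pre C (X d) (X (d + 1)) (f d) W = {Zero C (X (d + 1)) W}
        \<longleftrightarrow> op.inj_at W (X (d + 1)) (X d) (f d)"
        using op.inj_at_iff[of W "f d" "X (d + 1)" "X d"] that M True
        by (auto simp: seq_arr_def ker_im_opp)
      assume i: "i \<in> {1..d}"
      show "ker_pre C (X (i - 1)) (X i) (f (i - 1)) W = im_pre C (X i) (X (i + 1)) (f i) W
        \<longleftrightarrow> op.exact_at W (X (i + 1)) (X i) (X (i - 1)) (f i) (f (i - 1))"
        unfolding ker_im_opp
        by (rule op.exact_at_iff) (use that M i seq_arr_at[OF True, of i] in auto)
    qed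
    then show ?thesis
      unfolding d_cokernel_def sequence_in_iff[OF M] cokernel_exact_at_def using True by simp
  qed
  ultimately show ?thesis using True by (auto simp: d_exact_def)
next
  case False
  then show ?thesis by (simp add: d_exact_def d_kernel_def sequence_in_iff[OF M])
qed

definition torsion_seq :: "'o set \<Rightarrow> nat \<Rightarrow> 'o set \<Rightarrow> (nat \<Rightarrow> 'o) \<Rightarrow> (nat \<Rightarrow> 'm) \<Rightarrow> bool" where
  "torsion_seq M d U X f \<longleftrightarrow> seq_arr M d X f \<and>
     (\<forall>W\<in>M. kernel_exact_at W d X f \<and> cokernel_exact_at W d X f) \<and> X 0 \<in> U \<and>
     (\<forall>W\<in>U. torsion_exact_at W d X f)"

lemma d_torsion_class_iff:
  assumes M: "M \<subseteq> Objs C" and d: "d \<ge> 2"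
  shows "d_torsion_class C M d U \<longleftrightarrow> subcategory C U \<and> U \<subseteq> M \<and>
     (\<forall>Y\<in>M. \<exists>X f. torsion_seq M d U X f \<and> X 1 = Y)"
proof -
  have "(ker_post C (X 2) (X 3) (f 2) W = {Zero C W (X 2)} \<and>
           (\<forall>i\<in>{3..d}. ker_post C (X i) (X (i + 1)) (f i) W
                       = im_post C (X (i - 1)) (X i) (f (i - 1)) W) \<and>
           im_post C (X d) (X (d + 1)) (f d) W = Mor C W (X (d + 1))) \<longleftrightarrow> torsion_exact_at W d X f"
    if X: "seq_arr M d X f" and W: "W \<in> Objs C" for X f W
  proof -
    have "arr C (f 2) (X 2) (X 3)" "arr C (f d) (X d) (X (d + 1))"
      using seq_arr_at(2)[OF X, of 2] seq_arr_at(2)[OF X, of d] d by auto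
    moreover have "ker_post C (X i) (X (i + 1)) (f i) W = im_post C (X (i - 1)) (X i) (f (i - 1)) W
        \<longleftrightarrow> exact_at W (X (i - 1)) (X i) (X (i + 1)) (f (i - 1)) (f i)" if "i \<in> {3..d}" for i
      by (rule exact_at_iff) (use W that seq_arr_at[OF X, of i] in auto)
    ultimately show ?thesis
      unfolding torsion_exact_at_def using W inj_at_iff surj_at_iff by auto
  qed
  then show ?thesis
    unfolding d_torsion_class_def d_exact_iff[OF M] torsion_seq_def using M
    by (smt (verit, best) subset_iff)
qed

text \<open>A sum of two maps that factor through \<open>X\<close> and \<open>Y\<close> factors through \<open>X \<oplus> Y\<close>.\<close>
lemma biprod_factor:
  assumes b: "biprod X Y S i j p q"
    and f: "arr C f X V" "arr C g Y V" and f': "arr C f' W X" "arr C g' W Y"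
  shows "\<exists>h h'. arr C h S V \<and> arr C h' W S \<and> h \<star> h' = f \<star> f' \<uplus> g \<star> g'"
proof -
  have a: "arr C i X S" "arr C j Y S" "arr C p S X" "arr C q S Y"
    and e: "p \<star> i = Idm C X" "q \<star> j = Idm C Y" "p \<star> j = Zero C Y X" "q \<star> i = Zero C X Y"
    using b by (auto simp: biprod_def)
  have o: "X \<in> Objs C" "Y \<in> Objs C" using a by (auto simp: arr_def)
  have fp: "arr C (f \<star> p) S V" "arr C (g \<star> q) S V" and ig: "arr C (i \<star> f') W S" "arr C (j \<star> g') W S"
    using a f f' arr_cmp by blast+
  define h where "h = f \<star> p \<uplus> g \<star> q"
  have h: "arr C h S V" unfolding h_def using fp arr_pls by blast
  have "h \<star> i = f" "h \<star> j = g"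
    unfolding h_def pls_cmp[OF a(1) fp] pls_cmp[OF a(2) fp] assoc[OF a(1) a(3) f(1)]
      assoc[OF a(2) a(3) f(1)] assoc[OF a(1) a(4) f(2)] assoc[OF a(2) a(4) f(2)] e
      cmp_id[OF f(1)] cmp_id[OF f(2)] cmp_zero[OF f(1) o(2)] cmp_zero[OF f(2) o(1)]
    by (rule pls_zero[OF f(1)], rule zero_pls[OF f(2)])
  then have "h \<star> (i \<star> f' \<uplus> j \<star> g') = f \<star> f' \<uplus> g \<star> g'"
    using cmp_pls[OF ig h] assoc[OF f'(1) a(1) h] assoc[OF f'(2) a(2) h] by simp
  then show ?thesis using h arr_pls[OF ig] by blast
qed

text \<open>Direct sums of torsion sequences are torsion sequences, formed term by term; only the term in
  position 1 is prescribed, the others are arbitrary direct sums.\<close>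
lemma torsion_seq_sum:
  assumes sums: "\<And>X Y. X \<in> Objs C \<Longrightarrow> Y \<in> Objs C \<Longrightarrow> \<exists>S. direct_sum C X Y S"
    and M: "subcategory C M" and U: "subcategory C U" "U \<subseteq> M" and d: "d \<ge> 2"
    and X: "torsion_seq M d U X f" and X': "torsion_seq M d U X' f'"
    and S: "direct_sum C (X 1) (X' 1) S"
  shows "\<exists>X'' f''. torsion_seq M d U X'' f'' \<and> X'' 1 = S"
proof -
  interpret op: lin_category "opp C" "\<lambda>g f. f \<star> g" "(\<uplus>)" by (rule lin_category_opp)
  have MO: "M \<subseteq> Objs C" using M by (simp add: subcategory_def)
  have sX: "seq_arr M d X f" and sX': "seq_arr M d X' f'"
    using X X' by (auto simp: torsion_seq_def)
  have "\<exists>T i j p q. k \<le> d + 1 \<longrightarrow> biprod (X k) (X' k) T i j p q \<and> (k = 1 \<longrightarrow> T = S)" for k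
  proof (cases "k \<le> d + 1")
    case True
    then have "X k \<in> Objs C" "X' k \<in> Objs C"
      using sX sX' MO by (auto simp: seq_arr_def)
    then show ?thesis
      using sums S unfolding direct_sum_iff by (cases "k = 1") blast+
  qed auto
  then obtain X'' i j p q where
    b: "k \<le> d + 1 \<Longrightarrow> biprod (X k) (X' k) (X'' k) (i k) (j k) (p k) (q k)"
    and S': "k \<le> d + 1 \<Longrightarrow> k = 1 \<Longrightarrow> X'' k = S" for k
    by metis
  have "\<exists>h. k \<le> d \<longrightarrow> arr C h (X'' k) (X'' (k + 1)) \<and> sum_map (i k) (j k) (p k) (q k) (f k) (f' k) h
     (i (k + 1)) (j (k + 1)) (p (k + 1)) (q (k + 1))" for k
  proof (cases "k \<le> d")
    case True
    then show ?thesis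
      using sum_map_exists[OF b[of k] b[of "k + 1"]] sX sX' by (simp add: seq_arr_def)
  qed simp
  then obtain f'' where f'': "k \<le> d \<Longrightarrow> arr C (f'' k) (X'' k) (X'' (k + 1))"
    and fs: "k \<le> d \<Longrightarrow> sum_map (i k) (j k) (p k) (q k) (f k) (f' k) (f'' k)
       (i (k + 1)) (j (k + 1)) (p (k + 1)) (q (k + 1))" for k
    by metis
  have f: "k \<le> d \<Longrightarrow> arr C (f k) (X k) (X (k + 1))" "k \<le> d \<Longrightarrow> arr C (f' k) (X' k) (X' (k + 1))" for k
    using sX sX' by (auto simp: seq_arr_def)
  have ob: "op.biprod (X k) (X' k) (X'' k) (p k) (q k) (i k) (j k)" if "k \<le> d + 1" for k
    using biprod_opp[OF b[OF that]] .
  have os: "op.sum_map (p (k + 1)) (q (k + 1)) (i (k + 1)) (j (k + 1)) (f k) (f' k) (f'' k)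
     (p k) (q k) (i k) (j k)" if "k \<le> d" for k
    using fs[OF that] unfolding sum_map_def op.sum_map_def by simp
  have s'': "seq_arr M d X'' f''"
    unfolding seq_arr_def
  proof (intro conjI allI impI)
    fix k assume k: "k \<le> d + 1"
    then have "direct_sum C (X k) (X' k) (X'' k)" using b direct_sum_iff by blast
    then show "X'' k \<in> M"
      using M k sX sX' unfolding subcategory_def seq_arr_def by blast
  qed (rule f'')
  have ex: "exact_at W (X'' (k - 1)) (X'' k) (X'' (k + 1)) (f'' (k - 1)) (f'' k)"
    if "exact_at W (X (k - 1)) (X k) (X (k + 1)) (f (k - 1)) (f k)"
      "exact_at W (X' (k - 1)) (X' k) (X' (k + 1)) (f' (k - 1)) (f' k)" "1 \<le> k" "k \<le> d" for W k
  proof -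
    obtain l where l: "k = l + 1" using \<open>1 \<le> k\<close> by (metis le_add_diff_inverse2)
    show ?thesis
      using that exact_at_sum_seq[OF b[of l] b[of "l + 1"] f(1)[of l] f(2)[of l] f''[of l] fs[of l]
        b[of "l + 1 + 1"] f(1)[of "l + 1"] f(2)[of "l + 1"] f''[of "l + 1"] fs[of "l + 1"]] by (simp add: l)
  qed
  have oex: "op.exact_at W (X'' (k + 1)) (X'' k) (X'' (k - 1)) (f'' k) (f'' (k - 1))"
    if "op.exact_at W (X (k + 1)) (X k) (X (k - 1)) (f k) (f (k - 1))"
      "op.exact_at W (X' (k + 1)) (X' k) (X' (k - 1)) (f' k) (f' (k - 1))" "1 \<le> k" "k \<le> d" for W k
  proof -
    obtain l where l: "k = l + 1" using \<open>1 \<le> k\<close> by (metis le_add_diff_inverse2)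
    show ?thesis
      using that op.exact_at_sum_seq[OF ob[of "l + 1 + 1"] ob[of "l + 1"] _ _ _ os[of "l + 1"]
        ob[of l] _ _ _ os[of l]] f f''
      by (simp add: l)
  qed
  have "kernel_exact_at W d X'' f'' \<and> cokernel_exact_at W d X'' f''" if "W \<in> M" for W
  proof -
    have "kernel_exact_at W d X f" "kernel_exact_at W d X' f'"
      "cokernel_exact_at W d X f" "cokernel_exact_at W d X' f'"
      using X X' that by (auto simp: torsion_seq_def)
    then show ?thesis
      unfolding kernel_exact_at_def cokernel_exact_at_def
      using ex oex inj_at_sum_seq[OF b[of 0] b[of "0 + 1"] f[of 0] f''[of 0] fs[of 0]]
        op.inj_at_sum_seq[OF ob[of "d + 1"] ob[of d] _ _ _ os[of d]] f f'' by simp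
  qed
  moreover have "torsion_exact_at W d X'' f''" if "W \<in> U" for W
  proof -
    have "torsion_exact_at W d X f" "torsion_exact_at W d X' f'"
      using X X' that by (auto simp: torsion_seq_def)
    then show ?thesis
      unfolding torsion_exact_at_def
      using ex inj_at_sum_seq[OF b[of 2] b[of "2 + 1"] f[of 2] f''[of 2] fs[of 2]]
        surj_at_sum_seq[OF b[of d] b[of "d + 1"] f[of d] f''[of d] fs[of d]] d
      by (simp add: numeral_3_eq_3)
  qed
  moreover have "X'' 0 \<in> U"
  proof -
    have "direct_sum C (X 0) (X' 0) (X'' 0)" using b direct_sum_iff by blast
    then show ?thesis using U(1) X X' unfolding subcategory_def torsion_seq_def by blast
  qed
  ultimately have "torsion_seq M d U X'' f''"
    using s'' by (simp add: torsion_seq_def)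
  then show ?thesis using S' by auto
qed

end

text \<open>The hypotheses that make \<open>add B\<close> Krull-Schmidt with indecomposables \<open>B\<close>: nonzero endomorphisms are
  invertible, and retracts that lie in \<open>B\<close> have complements.\<close>
locale ks_category = lin_category +
  fixes B :: "'a set"
  assumes sums_exist: "X \<in> Objs C \<Longrightarrow> Y \<in> Objs C \<Longrightarrow> \<exists>S. direct_sum C X Y S"
    and zero_exists: "\<exists>Z. zero_object C Z"
    and B_Objs: "B \<subseteq> Objs C"
    and division: "X \<in> B \<Longrightarrow> arr C u X X \<Longrightarrow> u = Zero C X X \<or> (\<exists>v. arr C v X X \<and> v \<star> u = Idm C X)"
    and split: "X \<in> B \<Longrightarrow> arr C a X Y \<Longrightarrow> arr C b Y X \<Longrightarrow> b \<star> a = Idm C X \<Longrightarrow>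
       \<exists>Y' j q. biprod X Y' Y a j b q"
begin

text \<open>Let \<open>X\<close> be a retract of \<open>S = N \<oplus> Y\<close> with \<open>N \<in> B\<close>, and let \<open>c\<close> be the induced endomorphism
  \<open>N \<rightarrow> X \<rightarrow> N\<close>. If \<open>c\<close> is invertible, \<open>N\<close> splits off \<open>X\<close> and the complement is a retract of \<open>Y\<close>. If \<open>c = 0\<close>,
  the part \<open>u\<close> of the identity of \<open>X\<close> that passes through \<open>N\<close> has square zero, so the part through \<open>Y\<close>,
  which is \<open>1 - u\<close>, is invertible with inverse \<open>1 + u\<close>, and \<open>X\<close> itself is a retract of \<open>Y\<close>.\<close>
lemma retract_dsums:
  assumes "S \<in> dsums C B"
  shows "arr C i X S \<Longrightarrow> arr C p S X \<Longrightarrow> p \<star> i = Idm C X \<Longrightarrow> X \<in> dsums C B"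
  using assms
proof (induction S arbitrary: X i p rule: dsums.induct)
  case (dsums_zero Z)
  have X: "X \<in> Objs C" using dsums_zero by (simp add: arr_def)
  have "p = Zero C Z X" using zero_object_arr(2)[OF dsums_zero(1) dsums_zero(3)] .
  then have "Idm C X = Zero C X X"
    using dsums_zero zero_cmp[OF dsums_zero(2) X] by simp
  then show ?case using X by (auto simp: zero_object_def intro: dsums.intros)
next
  case (dsums_add N Y S)
  note i = dsums_add.prems(1) and p = dsums_add.prems(2) and pi = dsums_add.prems(3)
  obtain \<iota> j \<pi> q where b: "biprod N Y S \<iota> j \<pi> q"
    using dsums_add.hyps(3) direct_sum_iff by blast
  have a: "arr C \<iota> N S" "arr C j Y S" "arr C \<pi> S N" "arr C q S Y"
    using b by (auto simp: biprod_def)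
  have X: "X \<in> Objs C" and N: "N \<in> Objs C" and Y: "Y \<in> Objs C" using i a by (auto simp: arr_def)
  define a1 where "a1 = p \<star> \<iota>"
  define b1 where "b1 = \<pi> \<star> i"
  define r where "r = p \<star> j"
  define s where "s = q \<star> i"
  define u where "u = a1 \<star> b1"
  have ar: "arr C a1 N X" "arr C b1 X N" "arr C r Y X" "arr C s X Y"
    unfolding a1_def b1_def r_def s_def using a i p arr_cmp by blast+
  have u: "arr C u X X" and rs: "arr C (r \<star> s) X X"
    unfolding u_def using ar arr_cmp by blast+
  have sum: "u \<uplus> r \<star> s = Idm C X"
  proof -
    have "Idm C X = p \<star> (\<iota> \<star> \<pi> \<star> i \<uplus> j \<star> q \<star> i)"
      using pi biprod_split[OF b i] by simp
    also have "\<dots> = p \<star> \<iota> \<star> b1 \<uplus> p \<star> j \<star> s"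
      unfolding b1_def[symmetric] s_def[symmetric]
      by (rule cmp_pls[OF _ _ p]) (use ar a arr_cmp in blast)+
    also have "\<dots> = u \<uplus> r \<star> s"
      unfolding u_def a1_def r_def using assoc[OF ar(2) a(1) p] assoc[OF ar(4) a(2) p] by simp
    finally show ?thesis by simp
  qed
  have c: "arr C (b1 \<star> a1) N N" using ar arr_cmp by blast
  consider "b1 \<star> a1 = Zero C N N" | v where "arr C v N N" "v \<star> b1 \<star> a1 = Idm C N"
    using division[OF dsums_add.hyps(1) c] by blast
  then show ?case
  proof cases
    case 1
    have "u \<star> u = a1 \<star> (b1 \<star> a1) \<star> b1"
      unfolding u_def using assoc[OF u ar(2) ar(1)] assoc[OF ar(2) ar(1) ar(2)] u_def by simp
    also have "\<dots> = Zero C X X"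
      using 1 zero_cmp[OF ar(2) N] cmp_zero[OF ar(1) X] by simp
    finally have uu: "u \<star> u = Zero C X X" .
    have urs: "arr C (u \<star> r \<star> s) X X" using u rs arr_cmp by blast
    have "u = u \<star> (u \<uplus> r \<star> s)"
      using sum cmp_id[OF u] by simp
    also have "\<dots> = u \<star> r \<star> s"
      using cmp_pls[OF u rs u] uu zero_pls[OF urs] by simp
    finally have u': "u \<star> r \<star> s = u" by simp
    define r' where "r' = u \<star> r \<uplus> r"
    have ur: "arr C (u \<star> r) Y X" using u ar arr_cmp by blast
    have r': "arr C r' Y X" unfolding r'_def using ar ur arr_pls by blast
    have "r' \<star> s = Idm C X"
      unfolding r'_def using pls_cmp[OF ar(4) ur ar(3)] assoc[OF ar(4) ar(3) u] u' sum by simp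
    then show ?thesis using dsums_add.IH ar(4) r' by blast
  next
    case 2
    have "(v \<star> b1) \<star> a1 = Idm C N"
      using 2 assoc[OF ar(1) ar(2) 2(1)] by simp
    then obtain X' j' q' where b': "biprod N X' X a1 j' (v \<star> b1) q'"
      using split[OF dsums_add.hyps(1) ar(1)] arr_cmp[OF ar(2) 2(1)] by blast
    have a': "arr C j' X' X" "arr C q' X X'" and e': "q' \<star> j' = Idm C X'" "q' \<star> a1 = Zero C N X'"
      using b' by (auto simp: biprod_def)
    have X': "X' \<in> Objs C" using a' by (simp add: arr_def)
    have sr: "arr C (s \<star> j') X' Y" "arr C (q' \<star> r) Y X'" using ar a' arr_cmp by blast+
    have rsj: "arr C ((r \<star> s) \<star> j') X' X" "arr C (u \<star> j') X' X" "arr C (b1 \<star> j') X' N"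
      using rs u a' ar arr_cmp by blast+
    have "q' \<star> u \<star> j' = (q' \<star> a1) \<star> b1 \<star> j'"
      unfolding u_def using assoc[OF a'(1) ar(2) ar(1)] assoc[OF rsj(3) ar(1) a'(2)] by simp
    also have "\<dots> = Zero C X' X'" using e' zero_cmp[OF rsj(3) X'] by simp
    finally have z: "q' \<star> u \<star> j' = Zero C X' X'" .
    have "Idm C X' = q' \<star> (u \<uplus> r \<star> s) \<star> j'"
      using sum id_cmp[OF a'(1)] e' by simp
    also have "\<dots> = q' \<star> (r \<star> s) \<star> j'"
      using pls_cmp[OF a'(1) u rs] cmp_pls[OF rsj(2,1) a'(2)] z zero_pls[OF arr_cmp[OF rsj(1) a'(2)]]
      by simp
    also have "\<dots> = (q' \<star> r) \<star> s \<star> j'"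
      using assoc[OF a'(1) ar(4) ar(3)] assoc[OF sr(1) ar(3) a'(2)] by simp
    finally have "X' \<in> dsums C B" using dsums_add.IH[OF sr] by simp
    then show ?thesis
      using dsums.dsums_add[OF dsums_add.hyps(1)] b' direct_sum_iff by blast
  qed
qed

text \<open>In the induction step \<open>(N \<oplus> X') \<oplus> Y\<close> need not be compared with \<open>N \<oplus> (X' \<oplus> Y)\<close> by an isomorphism:
  it is enough that the former is a retract of the latter.\<close>
lemma direct_sum_dsums:
  assumes "X \<in> dsums C B" "Y \<in> dsums C B"
  shows "direct_sum C X Y S \<Longrightarrow> S \<in> dsums C B"
  using assms(1)
proof (induction X arbitrary: S rule: dsums.induct)
  case (dsums_zero Z)
  obtain i j p q where b: "biprod Z Y S i j p q" using dsums_zero direct_sum_iff by blast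
  then have a: "arr C i Z S" "arr C p S Z" "arr C j Y S" "arr C q S Y" and e: "i \<star> p \<uplus> j \<star> q = Idm C S"
    by (auto simp: biprod_def)
  have S: "S \<in> Objs C" using a by (simp add: arr_def)
  have "i \<star> p = Zero C S S"
    using zero_object_arr(2)[OF dsums_zero(1) a(1)] zero_cmp[OF a(2) S] by simp
  then have "j \<star> q = Idm C S" using e zero_pls[OF arr_cmp[OF a(4,3)]] by simp
  then show ?case using retract_dsums[OF assms(2) a(4,3)] by simp
next
  case (dsums_add N X' X)
  obtain i j p q where b: "biprod X Y S i j p q" using dsums_add direct_sum_iff by blast
  obtain i' j' p' q' where b': "biprod N X' X i' j' p' q'" using dsums_add direct_sum_iff by blast
  have a: "arr C i X S" "arr C j Y S" "arr C p S X" "arr C q S Y"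
    and e: "p \<star> i = Idm C X" "q \<star> j = Idm C Y" "p \<star> j = Zero C Y X" "q \<star> i = Zero C X Y"
       "i \<star> p \<uplus> j \<star> q = Idm C S"
    using b by (auto simp: biprod_def)
  have a': "arr C i' N X" "arr C j' X' X" "arr C p' X N" "arr C q' X X'"
    and e': "p' \<star> i' = Idm C N" "q' \<star> j' = Idm C X'" "p' \<star> j' = Zero C X' N" "q' \<star> i' = Zero C N X'"
       "i' \<star> p' \<uplus> j' \<star> q' = Idm C X"
    using b' by (auto simp: biprod_def)
  have o: "X \<in> Objs C" "X' \<in> Objs C" "Y \<in> Objs C" "N \<in> Objs C" "S \<in> Objs C"
    using a a' by (auto simp: arr_def)
  then obtain T where T: "direct_sum C X' Y T" using sums_exist by blast
  then obtain k l r s where bT: "biprod X' Y T k l r s" using direct_sum_iff by blast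
  have TD: "T \<in> dsums C B" using dsums_add.IH T by blast
  obtain R where R: "direct_sum C N T R" using sums_exist dsums_Objs[OF TD] o by blast
  then obtain k' l' r' s' where bR: "biprod N T R k' l' r' s'" using direct_sum_iff by blast
  have RD: "R \<in> dsums C B" using dsums.dsums_add[OF dsums_add.hyps(1) TD R] .
  have ii: "arr C (i \<star> i') N S" "arr C (i \<star> j') X' S" "arr C (p' \<star> p) S N" "arr C (q' \<star> p) S X'"
    using a a' arr_cmp by blast+
  obtain g g' where g: "arr C g T S" "arr C g' S T" "g \<star> g' = (i \<star> j') \<star> q' \<star> p \<uplus> j \<star> q"
    using biprod_factor[OF bT ii(2) a(2) ii(4) a(4)] by blast
  obtain h h' where h: "arr C h R S" "arr C h' S R"
    and hh: "h \<star> h' = (i \<star> i') \<star> p' \<star> p \<uplus> g \<star> g'"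
    using biprod_factor[OF bR ii(1) g(1) ii(3) g(2)] by blast
  have s: "arr C (i' \<star> p' \<star> p) S X" "arr C (j' \<star> q' \<star> p) S X" using a' ii arr_cmp by blast+
  have t: "arr C (i \<star> i' \<star> p' \<star> p) S S" "arr C (i \<star> j' \<star> q' \<star> p) S S" "arr C (j \<star> q) S S"
    using s a arr_cmp by blast+
  have "h \<star> h' = i \<star> i' \<star> p' \<star> p \<uplus> (i \<star> j' \<star> q' \<star> p \<uplus> j \<star> q)"
    using hh g(3) assoc[OF ii(3) a'(1) a(1)] assoc[OF ii(4) a'(2) a(1)] by simp
  also have "\<dots> = i \<star> (i' \<star> p' \<star> p \<uplus> j' \<star> q' \<star> p) \<uplus> j \<star> q"
    using pls_assoc[OF t] cmp_pls[OF s a(1)] by simp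
  also have "\<dots> = Idm C S" using biprod_split[OF b' a(3)] e by simp
  finally show ?case using retract_dsums[OF RD h(2) h(1)] by blast
qed

lemma subcategory_dsums: "subcategory C (dsums C B)"
  unfolding subcategory_def
proof (intro conjI ballI allI impI)
  show "dsums C B \<subseteq> Objs C" by (rule subsetI) (rule dsums_Objs)
next
  fix X Y assume "X \<in> dsums C B" "Y \<in> Objs C" "isomorphic C X Y"
  then show "Y \<in> dsums C B"
    unfolding isomorphic_def Cmp using retract_dsums[of X _ Y] dsums_Objs[of X] by (auto simp: arr_def)
next
  fix X Y S assume "S \<in> dsums C B" "direct_sum C X Y S"
  then show "X \<in> dsums C B" "Y \<in> dsums C B"
    unfolding direct_sum_iff biprod_def using retract_dsums by blast+
next
  fix Z assume "zero_object C Z" then show "Z \<in> dsums C B" by (rule dsums_zero)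
next
  fix X Y S assume "X \<in> dsums C B" "Y \<in> dsums C B" "direct_sum C X Y S"
  then show "S \<in> dsums C B" by (rule direct_sum_dsums)
qed

lemma B_dsums: "B \<subseteq> dsums C B"
proof
  fix X assume X: "X \<in> B"
  then have XO: "X \<in> Objs C" using B_Objs by blast
  obtain Z where Z: "zero_object C Z" using zero_exists by blast
  then have ZO: "Z \<in> Objs C" "Idm C Z = Zero C Z Z" by (auto simp: zero_object_def)
  note zs = arr_zero[OF XO ZO(1)] arr_zero[OF ZO(1) XO]
  have "biprod X Z X (Idm C X) (Zero C Z X) (Idm C X) (Zero C X Z)"
    unfolding biprod_def
    using XO ZO zs arr_id[OF XO] id_cmp[OF arr_id[OF XO]] cmp_zero[OF zs(1) ZO(1)]
      id_cmp[OF zs(2)] cmp_id[OF zs(1)] cmp_zero[OF zs(2) XO] pls_zero[OF arr_id[OF XO]] by simp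
  then show "X \<in> dsums C B"
    using X Z direct_sum_iff by (blast intro: dsums.intros)
qed

theorem add_closure_eq_dsums: "add_closure C B = dsums C B"
proof
  show "add_closure C B \<subseteq> dsums C B"
    unfolding add_closure_def using subcategory_dsums B_dsums by blast
next
  have "X \<in> U" if "X \<in> dsums C B" "subcategory C U" "B \<subseteq> U" for X U
    using that
  proof (induction rule: dsums.induct)
    case (dsums_zero Z) then show ?case unfolding subcategory_def by blast
  next
    case (dsums_add X Y S) then show ?case unfolding subcategory_def by blast
  qed
  then show "dsums C B \<subseteq> add_closure C B" unfolding add_closure_def by blast
qed

end

section \<open>Families of objects with at most one map up to scalars\<close>

text \<open>The situation of one-dimensional or zero \<open>Hom\<close>-spaces, without mentioning scalars: if \<open>x \<leadsto> y \<leadsto> z\<close> and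
  \<open>x \<leadsto> z\<close>, composition with either of the basis maps is bijective.\<close>
locale hom_family = lin_category C cmp pls
  for C :: "('o, 'm) precat" and cmp (infixr "\<star>" 70) and pls (infixl "\<uplus>" 65) +
  fixes J :: "'i set" and Mo :: "'i \<Rightarrow> 'o" and R :: "'i \<Rightarrow> 'i \<Rightarrow> bool" and b :: "'i \<Rightarrow> 'i \<Rightarrow> 'm"
  assumes Mo_Objs: "x \<in> J \<Longrightarrow> Mo x \<in> Objs C"
    and hom_zero: "x \<in> J \<Longrightarrow> y \<in> J \<Longrightarrow> \<not> R x y \<Longrightarrow> arr C h (Mo x) (Mo y) \<Longrightarrow> h = Zero C (Mo x) (Mo y)"
    and arr_b: "x \<in> J \<Longrightarrow> y \<in> J \<Longrightarrow> R x y \<Longrightarrow> arr C (b x y) (Mo x) (Mo y)"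
    and b_nonzero: "x \<in> J \<Longrightarrow> y \<in> J \<Longrightarrow> R x y \<Longrightarrow> b x y \<noteq> Zero C (Mo x) (Mo y)"
    and post_surj: "x \<in> J \<Longrightarrow> y \<in> J \<Longrightarrow> z \<in> J \<Longrightarrow> R x y \<Longrightarrow> R y z \<Longrightarrow> R x z \<Longrightarrow>
      arr C h (Mo x) (Mo z) \<Longrightarrow> \<exists>k. arr C k (Mo x) (Mo y) \<and> h = b y z \<star> k"
    and post_inj: "x \<in> J \<Longrightarrow> y \<in> J \<Longrightarrow> z \<in> J \<Longrightarrow> R x y \<Longrightarrow> R y z \<Longrightarrow> R x z \<Longrightarrow>
      arr C k (Mo x) (Mo y) \<Longrightarrow> arr C k' (Mo x) (Mo y) \<Longrightarrow> b y z \<star> k = b y z \<star> k' \<Longrightarrow> k = k'"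
    and pre_surj: "x \<in> J \<Longrightarrow> y \<in> J \<Longrightarrow> z \<in> J \<Longrightarrow> R x y \<Longrightarrow> R y z \<Longrightarrow> R x z \<Longrightarrow>
      arr C h (Mo x) (Mo z) \<Longrightarrow> \<exists>k. arr C k (Mo y) (Mo z) \<and> h = k \<star> b x y"
    and pre_inj: "x \<in> J \<Longrightarrow> y \<in> J \<Longrightarrow> z \<in> J \<Longrightarrow> R x y \<Longrightarrow> R y z \<Longrightarrow> R x z \<Longrightarrow>
      arr C k (Mo y) (Mo z) \<Longrightarrow> arr C k' (Mo y) (Mo z) \<Longrightarrow> k \<star> b x y = k' \<star> b x y \<Longrightarrow> k = k'"
begin

lemma hom_family_opp:
  "hom_family (opp C) (\<lambda>g f. f \<star> g) (\<uplus>) J Mo (\<lambda>x y. R y x) (\<lambda>x y. b y x)"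
proof -
  interpret op: lin_category "opp C" "\<lambda>g f. f \<star> g" "(\<uplus>)" by (rule lin_category_opp)
  show ?thesis
    by unfold_locales
      (simp_all add: Mo_Objs hom_zero arr_b b_nonzero pre_surj pre_inj post_surj post_inj)
qed

text \<open>Zero terms of a sequence are indexed by \<open>None\<close>.\<close>
lemma hom_family_option:
  assumes Z: "zero_object C Z"
  shows "hom_family C (\<star>) (\<uplus>) (insert None (Some ` J)) (case_option Z Mo)
     (\<lambda>x y. x \<noteq> None \<and> y \<noteq> None \<and> R (the x) (the y)) (\<lambda>x y. b (the x) (the y))"
proof unfold_locales
  have ZO: "Z \<in> Objs C" using Z by (simp add: zero_object_def)
  show "case_option Z Mo x \<in> Objs C" if "x \<in> insert None (Some ` J)" for x
    using that ZO Mo_Objs by (cases x) auto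
  show "h = Zero C (case_option Z Mo x) (case_option Z Mo y)"
    if "x \<in> insert None (Some ` J)" "y \<in> insert None (Some ` J)"
      "\<not> (x \<noteq> None \<and> y \<noteq> None \<and> R (the x) (the y))"
      "arr C h (case_option Z Mo x) (case_option Z Mo y)" for x y h
    using that zero_object_arr[OF Z] hom_zero by (cases x; cases y) auto
next
  let ?J = "insert None (Some ` J)" and ?M = "case_option Z Mo"
    and ?R = "\<lambda>x y. x \<noteq> None \<and> y \<noteq> None \<and> R (the x) (the y)"
  have S: "the x \<in> J" "?M x = Mo (the x)" if "x \<in> ?J" "x \<noteq> None" for x
    using that by auto
  fix x y z assume x: "x \<in> ?J" and y: "y \<in> ?J" and xy: "?R x y"
  note Sx = S[OF x] and Sy = S[OF y]
  show "arr C (b (the x) (the y)) (?M x) (?M y)"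
    using arr_b Sx Sy xy by simp
  show "b (the x) (the y) \<noteq> Zero C (?M x) (?M y)"
    using b_nonzero Sx Sy xy by simp
  assume z: "z \<in> ?J" and yz: "?R y z" and xz: "?R x z"
  note Sz = S[OF z]
  show "\<exists>k. arr C k (?M x) (?M y) \<and> h = b (the y) (the z) \<star> k" if "arr C h (?M x) (?M z)" for h
    using post_surj[of "the x" "the y" "the z" h] that Sx Sy Sz xy yz xz by simp
  show "k = k'" if "arr C k (?M x) (?M y)" "arr C k' (?M x) (?M y)"
    "b (the y) (the z) \<star> k = b (the y) (the z) \<star> k'" for k k'
    using post_inj[of "the x" "the y" "the z" k k'] that Sx Sy Sz xy yz xz by simp
  show "\<exists>k. arr C k (?M y) (?M z) \<and> h = k \<star> b (the x) (the y)" if "arr C h (?M x) (?M z)" for h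
    using pre_surj[of "the x" "the y" "the z" h] that Sx Sy Sz xy yz xz by simp
  show "k = k'" if "arr C k (?M y) (?M z)" "arr C k' (?M y) (?M z)"
    "k \<star> b (the x) (the y) = k' \<star> b (the x) (the y)" for k k'
    using pre_inj[of "the x" "the y" "the z" k k'] that Sx Sy Sz xy yz xz by simp
qed

definition step :: "'i \<Rightarrow> 'i \<Rightarrow> 'm" where
  "step x y = (if R x y then b x y else Zero C (Mo x) (Mo y))"

lemma arr_step: "x \<in> J \<Longrightarrow> y \<in> J \<Longrightarrow> arr C (step x y) (Mo x) (Mo y)"
  by (simp add: step_def arr_b arr_zero Mo_Objs)

lemma inj_at_step:
  assumes "w \<in> J" "x \<in> J" "y \<in> J" and R: "R w x \<Longrightarrow> R w y \<and> R x y"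
  shows "inj_at (Mo w) (Mo x) (Mo y) (step x y)"
  unfolding inj_at_def
proof (intro allI impI)
  fix h assume h: "arr C h (Mo w) (Mo x)" and z: "step x y \<star> h = Zero C (Mo w) (Mo y)"
  show "h = Zero C (Mo w) (Mo x)"
  proof (cases "R w x")
    case True
    have "b x y \<star> h = b x y \<star> Zero C (Mo w) (Mo x)"
      using z R[OF True] cmp_zero[OF arr_b] assms by (simp add: step_def Mo_Objs)
    then show ?thesis
      using post_inj[of w x y h] assms True R h arr_zero Mo_Objs by blast
  qed (use hom_zero assms h in blast)
qed

lemma surj_at_step:
  assumes "w \<in> J" "x \<in> J" "y \<in> J" and R: "R w y \<Longrightarrow> R w x \<and> R x y"
  shows "surj_at (Mo w) (Mo x) (Mo y) (step x y)"
  unfolding surj_at_def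
proof (intro allI impI)
  fix h assume h: "arr C h (Mo w) (Mo y)"
  show "\<exists>k. arr C k (Mo w) (Mo x) \<and> h = step x y \<star> k"
  proof (cases "R w y")
    case True
    then show ?thesis
      using post_surj[of w x y h] assms R h by (auto simp: step_def)
  next
    case False
    then have "h = step x y \<star> Zero C (Mo w) (Mo x)"
      using hom_zero h assms cmp_zero[OF arr_step] Mo_Objs by metis
    then show ?thesis using arr_zero Mo_Objs assms by blast
  qed
qed

text \<open>If \<open>Hom(w,y)\<close> is nonzero, exactness means that exactly one of the two maps at it is bijective.\<close>
lemma exact_at_step:
  assumes J: "w \<in> J" "x \<in> J" "y \<in> J" "z \<in> J"
    and R: "R w y \<Longrightarrow> (R w x \<and> R x y \<and> \<not> R w z) \<or> (\<not> R w x \<and> R w z \<and> R y z)"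
  shows "exact_at (Mo w) (Mo x) (Mo y) (Mo z) (step x y) (step y z)"
  unfolding exact_at_def
proof (intro allI impI)
  fix h assume h: "arr C h (Mo w) (Mo y)"
  have gh: "arr C (step y z \<star> h) (Mo w) (Mo z)" using h arr_step J arr_cmp by blast
  have zx: "arr C (Zero C (Mo w) (Mo x)) (Mo w) (Mo x)" using J Mo_Objs arr_zero by blast
  have z0: "step x y \<star> Zero C (Mo w) (Mo x) = Zero C (Mo w) (Mo y)"
    "step y z \<star> Zero C (Mo w) (Mo y) = Zero C (Mo w) (Mo z)"
    using cmp_zero[OF arr_step] J Mo_Objs by auto
  show "step y z \<star> h = Zero C (Mo w) (Mo z) \<longleftrightarrow> (\<exists>k. arr C k (Mo w) (Mo x) \<and> h = step x y \<star> k)"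
  proof (cases "R w y")
    case False
    then have "h = Zero C (Mo w) (Mo y)" using hom_zero h J by blast
    then show ?thesis using z0 zx by metis
  next
    case True
    then consider "R w x" "R x y" "\<not> R w z" | "\<not> R w x" "R w z" "R y z" using R by blast
    then show ?thesis
    proof cases
      case 1
      then show ?thesis
        using surj_at_step[of w x y] J h hom_zero[OF _ _ _ gh] unfolding surj_at_def by auto
    next
      case 2
      have "k = Zero C (Mo w) (Mo x)" if "arr C k (Mo w) (Mo x)" for k
        using hom_zero J 2 that by blast
      moreover have "step y z \<star> h = Zero C (Mo w) (Mo z) \<Longrightarrow> h = Zero C (Mo w) (Mo y)"
        using inj_at_step[of w y z] J 2 h unfolding inj_at_def by blast
      ultimately show ?thesis using z0 zx by metis
    qed
  qed
qed

text \<open>The conditions \<open>post\<close> and \<open>pre\<close> say that nonzero \<open>Hom\<close>-spaces between the terms of the sequence and \<open>w\<close> come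
  in adjacent pairs; a single one may only occur at the end where exactness is not required.\<close>
lemma step_seq_exact:
  assumes E: "\<And>k. k \<le> d + 1 \<Longrightarrow> E k \<in> J" and K: "K \<subseteq> J" and M: "M = dsums C (Mo ` K)"
    and EM: "\<And>k. k \<le> d + 1 \<Longrightarrow> Mo (E k) \<in> M"
    and post_0: "\<And>w. w \<in> K \<Longrightarrow> R w (E 0) \<Longrightarrow> R w (E 1) \<and> R (E 0) (E 1)"
    and post: "\<And>w i. w \<in> K \<Longrightarrow> 1 \<le> i \<Longrightarrow> i \<le> d \<Longrightarrow> R w (E i) \<Longrightarrow>
       (R w (E (i - 1)) \<and> R (E (i - 1)) (E i) \<and> \<not> R w (E (i + 1))) \<or>
       (\<not> R w (E (i - 1)) \<and> R w (E (i + 1)) \<and> R (E i) (E (i + 1)))"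
    and pre_d: "\<And>w. w \<in> K \<Longrightarrow> R (E (d + 1)) w \<Longrightarrow> R (E d) w \<and> R (E d) (E (d + 1))"
    and pre: "\<And>w i. w \<in> K \<Longrightarrow> 1 \<le> i \<Longrightarrow> i \<le> d \<Longrightarrow> R (E i) w \<Longrightarrow>
       (R (E (i + 1)) w \<and> R (E i) (E (i + 1)) \<and> \<not> R (E (i - 1)) w) \<or>
       (\<not> R (E (i + 1)) w \<and> R (E (i - 1)) w \<and> R (E (i - 1)) (E i))"
    and X: "X = (\<lambda>k. Mo (E k))" and f: "f = (\<lambda>k. step (E k) (E (k + 1)))"
  shows "seq_arr M d X f" "\<forall>W\<in>M. kernel_exact_at W d X f \<and> cokernel_exact_at W d X f"
proof -
  interpret op: hom_family "opp C" "\<lambda>g f. f \<star> g" "(\<uplus>)" J Mo "\<lambda>x y. R y x" "\<lambda>x y. b y x"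
    by (rule hom_family_opp)
  have ops: "op.step y x = step x y" for x y by (simp add: op.step_def step_def)
  show s: "seq_arr M d X f"
    unfolding seq_arr_def X f using arr_step E EM by auto
  show "\<forall>W\<in>M. kernel_exact_at W d X f \<and> cokernel_exact_at W d X f"
    unfolding kernel_exact_at_def cokernel_exact_at_def
  proof (intro ballI conjI)
    fix W assume W: "W \<in> M"
    have f0: "arr C (f 0) (X 0) (X 1)" "arr C (f d) (X d) (X (d + 1))"
      using s unfolding seq_arr_def by auto
    show "inj_at W (X 0) (X 1) (f 0)"
      using W unfolding M
    proof (rule inj_at_dsums[OF _ f0(1)])
      fix V assume "V \<in> Mo ` K"
      then show "inj_at V (X 0) (X 1) (f 0)"
        unfolding X f using inj_at_step[of _ "E 0" "E 1"] E K post_0 by auto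
    qed
    show "op.inj_at W (X (d + 1)) (X d) (f d)"
      using W unfolding M dsums_opp[symmetric]
    proof (rule op.inj_at_dsums)
      fix V assume "V \<in> Mo ` K"
      then show "op.inj_at V (X (d + 1)) (X d) (f d)"
        unfolding X f ops[symmetric]
        using op.inj_at_step[of _ "E (d + 1)" "E d"] E K pre_d by auto
    qed (use f0 in simp)
    fix i assume i: "i \<in> {1..d}"
    then obtain j where j: "i = j + 1" by (metis atLeastAtMost_iff le_add_diff_inverse2)
    note fi = seq_arr_at[OF s, of i]
    show "exact_at W (X (i - 1)) (X i) (X (i + 1)) (f (i - 1)) (f i)"
      using W unfolding M
    proof (rule exact_at_dsums)
      fix V assume "V \<in> Mo ` K"
      then show "exact_at V (X (i - 1)) (X i) (X (i + 1)) (f (i - 1)) (f i)"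
        unfolding X f using exact_at_step[of _ "E j" "E (j + 1)" "E (j + 2)"] E K post[of _ i] i j by auto
    qed (use fi i in auto)
    show "op.exact_at W (X (i + 1)) (X i) (X (i - 1)) (f i) (f (i - 1))"
      using W unfolding M dsums_opp[symmetric]
    proof (rule op.exact_at_dsums)
      fix V assume "V \<in> Mo ` K"
      then show "op.exact_at V (X (i + 1)) (X i) (X (i - 1)) (f i) (f (i - 1))"
        unfolding X f ops[symmetric]
        using op.exact_at_step[of _ "E (j + 2)" "E (j + 1)" "E j"] E K pre[of _ i] i j by auto
    qed (use fi i in auto)
  qed
qed

lemma step_seq_torsion:
  assumes ex: "seq_arr M d X f" "\<forall>W\<in>M. kernel_exact_at W d X f \<and> cokernel_exact_at W d X f"
    and E: "\<And>k. k \<le> d + 1 \<Longrightarrow> E k \<in> J" and I: "I \<subseteq> J" and U: "U = dsums C (Mo ` I)" "U \<subseteq> M"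
    and X: "X = (\<lambda>k. Mo (E k))" and f: "f = (\<lambda>k. step (E k) (E (k + 1)))"
    and d: "d \<ge> 2" and E0: "Mo (E 0) \<in> U"
    and post_2: "\<And>w. w \<in> I \<Longrightarrow> R w (E 2) \<Longrightarrow> R w (E 3) \<and> R (E 2) (E 3)"
    and post_d: "\<And>w. w \<in> I \<Longrightarrow> R w (E (d + 1)) \<Longrightarrow> R w (E d) \<and> R (E d) (E (d + 1))"
  shows "torsion_seq M d U X f"
  unfolding torsion_seq_def
proof (intro conjI ex ballI)
  show "X 0 \<in> U" using E0 X by simp
  fix W assume W: "W \<in> U"
  then have "kernel_exact_at W d X f" using ex U by blast
  moreover have "inj_at W (X 2) (X 3) (f 2)"
    using W unfolding U
  proof (rule inj_at_dsums)
    show "arr C (f 2) (X 2) (X 3)" using seq_arr_at(2)[OF ex(1), of 2] d by auto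
    fix V assume "V \<in> Mo ` I"
    then show "inj_at V (X 2) (X 3) (f 2)"
      unfolding X f using inj_at_step[of _ "E 2" "E 3"] E I post_2 d by auto
  qed
  moreover have "surj_at W (X d) (X (d + 1)) (f d)"
    using W unfolding U
  proof (rule surj_at_dsums)
    show "arr C (f d) (X d) (X (d + 1))" using ex(1) unfolding seq_arr_def by auto
    fix V assume "V \<in> Mo ` I"
    then show "surj_at V (X d) (X (d + 1)) (f d)"
      unfolding X f using surj_at_step[of _ "E d" "E (d + 1)"] E I post_d by auto
  qed
  ultimately show "torsion_exact_at W d X f"
    unfolding torsion_exact_at_def kernel_exact_at_def by auto
qed

text \<open>Contrapositive form of: if a monomorphism \<open>U \<rightarrow> z\<close> carries a nonzero map from \<open>x\<close>, then some summand
  \<open>u\<close> of \<open>U\<close> satisfies \<open>x \<leadsto> u \<leadsto> z\<close> and is a subobject of \<open>z\<close>. The latter is expressed by maps from the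
  family: \<open>w \<leadsto> u\<close> implies \<open>w \<leadsto> z\<close>.\<close>
lemma composite_zero:
  assumes "U \<in> dsums C (Mo ` I)" "I \<subseteq> J" "x \<in> J" "z \<in> J"
    and I: "\<And>u. u \<in> I \<Longrightarrow> R x u \<Longrightarrow> R u z \<Longrightarrow> (\<And>w. w \<in> J \<Longrightarrow> R w u \<Longrightarrow> R w z) \<Longrightarrow> False"
  shows "arr C t U (Mo z) \<Longrightarrow> (\<And>w. w \<in> J \<Longrightarrow> inj_at (Mo w) U (Mo z) t) \<Longrightarrow> arr C g (Mo x) U \<Longrightarrow>
     t \<star> g = Zero C (Mo x) (Mo z)"
  using assms(1)
proof (induction U arbitrary: t g rule: dsums.induct)
  case (dsums_zero Z)
  then have "g = Zero C (Mo x) Z" using zero_object_arr by blast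
  then show ?case using dsums_zero cmp_zero Mo_Objs assms by auto
next
  case (dsums_add N Y S)
  note t = dsums_add.prems(1) and g = dsums_add.prems(3) and mono = dsums_add.prems(2)
  obtain u where u: "u \<in> I" "N = Mo u" using dsums_add by blast
  obtain i j p q where bp: "biprod N Y S i j p q" using dsums_add direct_sum_iff by blast
  then have a: "arr C i N S" "arr C j Y S" "arr C p S N" "arr C q S Y"
    and e: "p \<star> i = Idm C N" "q \<star> j = Idm C Y" by (auto simp: biprod_def)
  have uJ: "u \<in> J" using u assms by blast
  have pg: "arr C (p \<star> g) (Mo x) N" "arr C (q \<star> g) (Mo x) Y" and ti: "arr C (t \<star> i) N (Mo z)" "arr C (t \<star> j) Y (Mo z)"
    using a g t arr_cmp by blast+
  have sub: "inj_at (Mo w) V (Mo z) (t \<star> k)"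
    if w: "w \<in> J" and k: "arr C k V S" "arr C k' S V" "k' \<star> k = Idm C V" for w V k k'
    unfolding inj_at_def
  proof (intro allI impI)
    fix h assume h: "arr C h (Mo w) V" and z: "(t \<star> k) \<star> h = Zero C (Mo w) (Mo z)"
    have "k \<star> h = Zero C (Mo w) S"
      using mono[OF w] z arr_cmp[OF h k(1)] assoc[OF h k(1) t] unfolding inj_at_def by auto
    then show "h = Zero C (Mo w) V"
      using assoc[OF h k(1,2)] k(3) id_cmp[OF h] cmp_zero[OF k(2)] w Mo_Objs by auto
  qed
  have 1: "(t \<star> i) \<star> p \<star> g = Zero C (Mo x) (Mo z)"
  proof (rule ccontr)
    assume n: "(t \<star> i) \<star> p \<star> g \<noteq> Zero C (Mo x) (Mo z)"
    then have "t \<star> i \<noteq> Zero C N (Mo z)" "p \<star> g \<noteq> Zero C (Mo x) N"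
      using zero_cmp[OF pg(1)] cmp_zero[OF ti(1)] Mo_Objs assms by auto
    then have R: "R x u" "R u z" using hom_zero pg ti u uJ assms by blast+
    have "R w z" if w: "w \<in> J" "R w u" for w
    proof (rule ccontr)
      assume "\<not> R w z"
      moreover have bw: "arr C (b w u) (Mo w) N" using arr_b w uJ u by simp
      ultimately have "(t \<star> i) \<star> b w u = Zero C (Mo w) (Mo z)"
        using hom_zero w assms ti arr_cmp by blast
      then have "b w u = Zero C (Mo w) N"
        using sub[OF w(1) a(1,3) e(1)] bw unfolding inj_at_def by blast
      then show False using b_nonzero w uJ u by blast
    qed
    then show False using I u R by blast
  qed
  have 2: "(t \<star> j) \<star> q \<star> g = Zero C (Mo x) (Mo z)"
    by (rule dsums_add.IH[OF ti(2) _ pg(2)]) (rule sub[OF _ a(2,4) e(2)])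
  have ig: "arr C (i \<star> p \<star> g) (Mo x) S" "arr C (j \<star> q \<star> g) (Mo x) S" using a pg arr_cmp by blast+
  have "t \<star> g = t \<star> (i \<star> p \<star> g \<uplus> j \<star> q \<star> g)" using biprod_split[OF bp g] by simp
  also have "\<dots> = (t \<star> i) \<star> p \<star> g \<uplus> (t \<star> j) \<star> q \<star> g"
    using cmp_pls[OF ig t] assoc[OF pg(1) a(1) t] assoc[OF pg(2) a(2) t] by simp
  also have "\<dots> = Zero C (Mo x) (Mo z)"
    using 1 2 zero_pls_zero Mo_Objs assms by simp
  finally show ?case .
qed

end

context lin_category
begin

text \<open>The torsion subobject is a coreflection: \<open>Hom(W, V\<^sub>1) \<rightarrow> Hom(W, V\<^sub>2)\<close> is injective, so every map from
  \<open>W\<close> to the middle term vanishes in \<open>V\<^sub>1\<close> and lifts.\<close>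
lemma torsion_seq_factor:
  assumes T: "torsion_seq M d U X f" and d: "d \<ge> 2" and UM: "U \<subseteq> M" "M \<subseteq> Objs C"
    and W: "W \<in> U" and m: "arr C m W (X 1)"
  shows "f 1 \<star> m = Zero C W (X 2)" "\<exists>g. arr C g W (X 0) \<and> m = f 0 \<star> g"
proof -
  have s: "seq_arr M d X f" and k: "kernel_exact_at W d X f" and t: "torsion_exact_at W d X f"
    using T W UM unfolding torsion_seq_def by auto
  have f1: "arr C (f 1) (X 1) (X 2)"
    using seq_arr_at(2)[OF s, of 1] d by (simp add: numeral_2_eq_2)
  have fm: "arr C (f 1 \<star> m) W (X 2)" using f1 m arr_cmp by blast
  have "exact_at W (X 1) (X 2) (X 3) (f 1) (f 2)" "exact_at W (X 0) (X 1) (X 2) (f 0) (f 1)"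
    using k d unfolding kernel_exact_at_def by (force dest: bspec[where x = 2], force dest: bspec[where x = 1] simp: numeral_2_eq_2)
  then have "f 2 \<star> f 1 \<star> m = Zero C W (X 3)" and e: "f 1 \<star> m = Zero C W (X 2) \<longleftrightarrow> (\<exists>g. arr C g W (X 0) \<and> m = f 0 \<star> g)"
    using fm m unfolding exact_at_def by blast+
  then show "f 1 \<star> m = Zero C W (X 2)"
    using t fm unfolding torsion_exact_at_def inj_at_def by blast
  with e show "\<exists>g. arr C g W (X 0) \<and> m = f 0 \<star> g" by blast
qed

lemma cokernel_factor:
  assumes "cokernel_exact_at W d X f" "1 \<le> i" "i \<le> d" "arr C h (X i) W"
    "h \<star> f (i - 1) = Zero C (X (i - 1)) W"
  shows "\<exists>k. arr C k (X (i + 1)) W \<and> h = k \<star> f i"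
proof -
  interpret op: lin_category "opp C" "\<lambda>g f. f \<star> g" "(\<uplus>)" by (rule lin_category_opp)
  have "op.exact_at W (X (i + 1)) (X i) (X (i - 1)) (f i) (f (i - 1))"
    using assms unfolding cokernel_exact_at_def by auto
  then show ?thesis using assms(4,5) unfolding op.exact_at_def by simp
qed

lemma kernel_seq_complex:
  assumes s: "seq_arr M d X f" and "M \<subseteq> Objs C" and k: "\<forall>W\<in>M. kernel_exact_at W d X f"
    and i: "1 \<le> i" "i \<le> d"
  shows "f i \<star> f (i - 1) = Zero C (X (i - 1)) (X (i + 1))"
proof -
  have "X (i - 1) \<in> M" using s i by (simp add: seq_arr_def)
  then have "exact_at (X (i - 1)) (X (i - 1)) (X i) (X (i + 1)) (f (i - 1)) (f i)"
    using k i unfolding kernel_exact_at_def by auto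
  moreover note a = seq_arr_at[OF s i]
  moreover have "f (i - 1) = f (i - 1) \<star> Idm C (X (i - 1))" "arr C (Idm C (X (i - 1))) (X (i - 1)) (X (i - 1))"
    using cmp_id[OF a(1)] a arr_id by (auto simp: arr_def)
  ultimately show ?thesis unfolding exact_at_def by blast
qed

end

context hom_family
begin

lemma torsion_class_summand:
  assumes T: "torsion_seq M d U X f" "X 1 = Mo z" and d: "d \<ge> 2"
    and M: "M = dsums C (Mo ` J)" and U: "U = dsums C (Mo ` I)" "U \<subseteq> M" and MoM: "\<And>w. w \<in> J \<Longrightarrow> Mo w \<in> M"
    and I: "I \<subseteq> J" "x \<in> I" "Mo x \<in> U" and z: "z \<in> J" "R x z"
  shows "\<exists>u\<in>I. R x u \<and> R u z \<and> (\<forall>w\<in>J. R w u \<longrightarrow> R w z)"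
proof (rule ccontr)
  assume n: "\<not> ?thesis"
  have MO: "M \<subseteq> Objs C" unfolding M by (rule subsetI) (rule dsums_Objs)
  have b: "arr C (b x z) (Mo x) (X 1)" using arr_b I z T by auto
  obtain g where g: "arr C g (Mo x) (X 0)" "b x z = f 0 \<star> g"
    using torsion_seq_factor(2)[OF T(1) d U(2) MO I(3) b] by blast
  have "f 0 \<star> g = Zero C (Mo x) (Mo z)"
  proof (rule composite_zero[of "X 0" I])
    show "X 0 \<in> dsums C (Mo ` I)" using T U by (simp add: torsion_seq_def)
    show "arr C (f 0) (X 0) (Mo z)" using T by (auto simp: torsion_seq_def seq_arr_def)
    show "inj_at (Mo w) (X 0) (Mo z) (f 0)" if "w \<in> J" for w
      using T MoM[OF that] by (auto simp: torsion_seq_def kernel_exact_at_def)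
  qed (use I z g n in auto)
  then show False using b_nonzero[of x z] I z g by auto
qed

text \<open>A torsion sequence \<open>X\<close> and a \<open>d\<close>-exact sequence of \<open>E\<close>s with the same term in position 1, for which
  \<open>E 0\<close> lies in the class and all maps from the class to \<open>E 1\<close> vanish in \<open>E 2\<close>, admit maps
  \<open>\<alpha>\<close> and \<open>\<beta>\<close> to and fro that extend the identity. In general \<open>\<beta> \<star> \<alpha>\<close> is only homotopic to the identity, but
  the terms of \<open>E\<close> have scalar endomorphisms and nonzero maps between them, so that here it equals the
  identity. Surjectivity at the last term then passes from \<open>X\<close> to \<open>E\<close>.\<close>
lemma torsion_class_compare:
  assumes T: "torsion_seq M d U X f" "X 1 = Mo (E 1)" and d: "d \<ge> 2"
    and M: "M \<subseteq> Objs C" and U: "U = dsums C (Mo ` I)" "U \<subseteq> M" and I: "I \<subseteq> J" "Mo ` I \<subseteq> U"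
    and E: "\<And>k. k \<le> d + 1 \<Longrightarrow> E k \<in> J" and refl: "\<And>k. k \<le> d + 1 \<Longrightarrow> R (E k) (E k)"
    and RE: "\<And>k. k \<le> d \<Longrightarrow> R (E k) (E (k + 1))"
    and ex: "seq_arr M d (\<lambda>k. Mo (E k)) (\<lambda>k. step (E k) (E (k + 1)))"
      "\<forall>W\<in>M. kernel_exact_at W d (\<lambda>k. Mo (E k)) (\<lambda>k. step (E k) (E (k + 1))) \<and>
        cokernel_exact_at W d (\<lambda>k. Mo (E k)) (\<lambda>k. step (E k) (E (k + 1)))"
    and E0: "E 0 \<in> I" and U2: "\<And>w. w \<in> I \<Longrightarrow> R w (E 1) \<Longrightarrow> \<not> R w (E 2)"
    and z: "z \<in> I" "R z (E (d + 1))"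
  shows "R z (E d)"
proof (rule ccontr)
  assume n: "\<not> R z (E d)"
  let ?Y = "\<lambda>k. Mo (E k)"
  define e where "e k = step (E k) (E (k + 1))" for k
  have sX: "seq_arr M d X f" and kX: "\<forall>W\<in>M. kernel_exact_at W d X f"
    and cX: "\<forall>W\<in>M. cokernel_exact_at W d X f" and X0: "X 0 \<in> U"
    and tX: "\<forall>W\<in>U. torsion_exact_at W d X f"
    using T(1) by (auto simp: torsion_seq_def)
  have sE: "seq_arr M d ?Y e" and kE: "\<forall>W\<in>M. kernel_exact_at W d ?Y e"
    and cE: "\<forall>W\<in>M. cokernel_exact_at W d ?Y e"
    using ex unfolding e_def by auto
  have eb: "e k = b (E k) (E (k + 1))" if "k \<le> d" for k
    using RE[OF that] by (simp add: e_def step_def)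
  have ae: "arr C (e k) (?Y k) (?Y (k + 1))" if "k \<le> d" for k
    using sE that by (simp add: seq_arr_def)
  have af: "arr C (f k) (X k) (X (k + 1))" if "k \<le> d" for k
    using sX that by (simp add: seq_arr_def)
  have XM: "X k \<in> M" if "k \<le> d + 1" for k using sX that by (simp add: seq_arr_def)
  have YM: "?Y k \<in> M" if "k \<le> d + 1" for k using sE that by (simp add: seq_arr_def)
  \<comment> \<open>The two vanishing conditions are what the extension to the next term requires; the square at the
    last term is recorded separately, for the conclusion.\<close>
  have "\<exists>\<alpha> \<beta>. arr C \<alpha> (?Y k) (X k) \<and> arr C \<beta> (X k) (?Y k) \<and> \<beta> \<star> \<alpha> = Idm C (?Y k) \<and>
     (k \<le> d \<longrightarrow> (f k \<star> \<alpha>) \<star> e (k - 1) = Zero C (?Y (k - 1)) (X (k + 1)) \<and>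
       (e k \<star> \<beta>) \<star> f (k - 1) = Zero C (X (k - 1)) (?Y (k + 1))) \<and>
     (k = d + 1 \<longrightarrow> (\<exists>\<gamma>. arr C \<gamma> (X d) (?Y d) \<and> \<beta> \<star> f d = e d \<star> \<gamma>))" if "1 \<le> k" "k \<le> d + 1" for k
    using that
  proof (induction k rule: dec_induct)
    case base
    have Y1: "?Y 1 \<in> Objs C" using YM M by auto
    have "f 1 \<star> e 0 = Zero C (?Y 0) (X 2)"
      using torsion_seq_factor(1)[OF T(1) d U(2) M, of "?Y 0" "e 0"] E0 I ae[of 0] T(2) by auto
    moreover have "e 1 \<star> f 0 = Zero C (X 0) (?Y 2)"
    proof -
      have e1: "arr C (e 1) (?Y 1) (?Y 2)" using ae[of 1] d by (simp add: numeral_2_eq_2)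
      have "exact_at (X 0) (?Y 1) (?Y 1) (?Y 2) (Idm C (?Y 1)) (e 1)"
        using X0 unfolding U(1)
      proof (rule exact_at_dsums[OF _ arr_id[OF Y1] e1])
        fix V assume "V \<in> Mo ` I"
        then obtain w where w: "w \<in> I" "w \<in> J" "V = Mo w" using I by blast
        have "e 1 \<star> h = Zero C V (?Y 2)" if h: "arr C h V (?Y 1)" for h
        proof (cases "R w (E 1)")
          case True
          then show ?thesis
            using hom_zero[of w "E 2"] U2[OF w(1)] arr_cmp[OF h e1] w E d by simp
        next
          case False
          then show ?thesis
            using hom_zero[of w "E 1" h] h w E cmp_zero[OF e1] Mo_Objs by simp
        qed
        then show "exact_at V (?Y 1) (?Y 1) (?Y 2) (Idm C (?Y 1)) (e 1)"
          unfolding exact_at_def using id_cmp by metis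
      qed
      moreover have f0: "arr C (f 0) (X 0) (?Y 1)" using af[of 0] T(2) by simp
      ultimately show ?thesis unfolding exact_at_def using id_cmp[OF f0] by metis
    qed
    ultimately show ?case
      using Y1 arr_id[OF Y1] id_cmp[OF arr_id[OF Y1]] cmp_id[OF af[of 1]] cmp_id[OF ae[of 1]] T(2) d
      by (intro exI[of _ "Idm C (?Y 1)"]) (simp add: numeral_2_eq_2)
  next
    case (step k)
    then obtain \<alpha> \<beta> where \<alpha>: "arr C \<alpha> (?Y k) (X k)" and \<beta>: "arr C \<beta> (X k) (?Y k)"
      and ba: "\<beta> \<star> \<alpha> = Idm C (?Y k)"
      and za: "(f k \<star> \<alpha>) \<star> e (k - 1) = Zero C (?Y (k - 1)) (X (k + 1))"
      and zb: "(e k \<star> \<beta>) \<star> f (k - 1) = Zero C (X (k - 1)) (?Y (k + 1))"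
      by auto
    have k: "1 \<le> k" "k \<le> d" using step by auto
    have fa: "arr C (f k \<star> \<alpha>) (?Y k) (X (k + 1))" "arr C (e k \<star> \<beta>) (X k) (?Y (k + 1))"
      using \<alpha> \<beta> ae[OF k(2)] af[OF k(2)] arr_cmp by blast+
    obtain \<alpha>' where \<alpha>': "arr C \<alpha>' (?Y (k + 1)) (X (k + 1))" "f k \<star> \<alpha> = \<alpha>' \<star> e k"
      using cokernel_factor[OF bspec[OF cE XM] k fa(1) za] k by auto
    obtain \<beta>' where \<beta>': "arr C \<beta>' (X (k + 1)) (?Y (k + 1))" "e k \<star> \<beta> = \<beta>' \<star> f k"
      using cokernel_factor[OF bspec[OF cX YM] k fa(2) zb] k by auto
    have ba': "arr C (\<beta>' \<star> \<alpha>') (?Y (k + 1)) (?Y (k + 1))" using \<alpha>' \<beta>' arr_cmp by blast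
    have Yk: "?Y (k + 1) \<in> Objs C" using YM k M by auto
    have "(\<beta>' \<star> \<alpha>') \<star> e k = (e k \<star> \<beta>) \<star> \<alpha>"
      using assoc[OF ae[OF k(2)] \<alpha>'(1) \<beta>'(1)] assoc[OF \<alpha> af[OF k(2)] \<beta>'(1)] \<alpha>'(2) \<beta>'(2) by simp
    also have "\<dots> = Idm C (?Y (k + 1)) \<star> e k"
      using assoc[OF \<alpha> \<beta> ae[OF k(2)]] ba cmp_id[OF ae[OF k(2)]] id_cmp[OF ae[OF k(2)]] by simp
    finally have "\<beta>' \<star> \<alpha>' = Idm C (?Y (k + 1))"
      using pre_inj[of "E k" "E (k + 1)" "E (k + 1)"] E RE refl k ba' arr_id[OF Yk] eb[OF k(2)] by simp
    moreover have "(f (k + 1) \<star> \<alpha>') \<star> e k = Zero C (?Y k) (X (k + 2))" if "k + 1 \<le> d"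
    proof -
      have "(f (k + 1) \<star> \<alpha>') \<star> e k = (f (k + 1) \<star> f k) \<star> \<alpha>"
        using assoc[OF ae[OF k(2)] \<alpha>'(1) af[OF that]] assoc[OF \<alpha> af[OF k(2)] af[OF that]] \<alpha>' by simp
      also have "\<dots> = Zero C (?Y k) (X (k + 2))"
        using kernel_seq_complex[OF sX M kX, of "k + 1"] that zero_cmp[OF \<alpha>] XM[of "k + 2"] M by auto
      finally show ?thesis .
    qed
    moreover have "(e (k + 1) \<star> \<beta>') \<star> f k = Zero C (X k) (?Y (k + 2))" if "k + 1 \<le> d"
    proof -
      have "(e (k + 1) \<star> \<beta>') \<star> f k = (e (k + 1) \<star> e k) \<star> \<beta>"
        using assoc[OF af[OF k(2)] \<beta>'(1) ae[OF that]] assoc[OF \<beta> ae[OF k(2)] ae[OF that]] \<beta>' by simp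
      also have "\<dots> = Zero C (X k) (?Y (k + 2))"
        using kernel_seq_complex[OF sE M kE, of "k + 1"] that zero_cmp[OF \<beta>] YM[of "k + 2"] M by auto
      finally show ?thesis .
    qed
    ultimately show ?case using \<alpha>' \<beta>' \<beta> by (intro exI[of _ \<alpha>'] exI[of _ \<beta>']) auto
  qed
  from this[of "d + 1"] obtain \<alpha> \<beta> \<gamma> where \<alpha>: "arr C \<alpha> (?Y (d + 1)) (X (d + 1))"
    and \<beta>: "arr C \<beta> (X (d + 1)) (?Y (d + 1))" and ba: "\<beta> \<star> \<alpha> = Idm C (?Y (d + 1))"
    and \<gamma>: "arr C \<gamma> (X d) (?Y d)" "\<beta> \<star> f d = e d \<star> \<gamma>"
    by auto
  define h where "h = b z (E (d + 1))"
  have zJ: "z \<in> J" and zU: "Mo z \<in> U" using z I by auto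
  have h: "arr C h (Mo z) (?Y (d + 1))" unfolding h_def using arr_b zJ z E by simp
  have "surj_at (Mo z) (X d) (X (d + 1)) (f d)"
    using tX zU by (simp add: torsion_exact_at_def)
  then obtain g where g: "arr C g (Mo z) (X d)" "\<alpha> \<star> h = f d \<star> g"
    using arr_cmp[OF h \<alpha>] unfolding surj_at_def by blast
  have "\<gamma> \<star> g = Zero C (Mo z) (?Y d)"
    using hom_zero[OF zJ E n arr_cmp[OF g(1) \<gamma>(1)]] by simp
  then have "e d \<star> \<gamma> \<star> g = Zero C (Mo z) (?Y (d + 1))"
    using cmp_zero[OF ae] Mo_Objs zJ by simp
  moreover have "h = e d \<star> \<gamma> \<star> g"
  proof -
    have "h = \<beta> \<star> \<alpha> \<star> h" using assoc[OF h \<alpha> \<beta>] ba id_cmp[OF h] by simp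
    also have "\<dots> = (\<beta> \<star> f d) \<star> g" using g assoc[OF g(1) af \<beta>] by simp
    also have "\<dots> = e d \<star> \<gamma> \<star> g" using \<gamma>(2) assoc[OF g(1) \<gamma>(1) ae] by simp
    finally show ?thesis .
  qed
  ultimately show False using b_nonzero[of z "E (d + 1)"] zJ z E by (simp add: h_def)
qed

end

section \<open>Module categories\<close>

lemma tuple_le_iff: "tuple_le x y \<longleftrightarrow> length x = length y \<and> (\<forall>i<length x. x ! i \<le> y ! i)"
  by (simp add: tuple_le_def list_all2_conv_all_nth)

lemma tuple_le_trans: "tuple_le x y \<Longrightarrow> tuple_le y z \<Longrightarrow> tuple_le x z"
  unfolding tuple_le_iff by (metis order_trans)

lemma mat_dim_simps:
  fixes M :: "'k::field mat"
  shows "dim_row M = m \<Longrightarrow> 1\<^sub>m m * M = M" "dim_col M = n \<Longrightarrow> M * 1\<^sub>m n = M"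
    "dim_row M = m \<Longrightarrow> 0\<^sub>m l m * M = 0\<^sub>m l (dim_col M)" "dim_col M = n \<Longrightarrow> M * 0\<^sub>m n l = 0\<^sub>m (dim_row M) l"
    "dim_row M = m \<Longrightarrow> dim_col M = n \<Longrightarrow> M + 0\<^sub>m m n = M"
    "dim_row M = m \<Longrightarrow> dim_col M = n \<Longrightarrow> 0\<^sub>m m n + M = M"
  by (metis carrier_matI left_mult_one_mat, metis carrier_matI right_mult_one_mat,
      metis carrier_matI left_mult_zero_mat, metis carrier_matI right_mult_zero_mat,
      metis carrier_matI right_add_zero_mat, metis carrier_matI left_add_zero_mat)

lemma arr_mod_cat:
  "arr (mod_cat A) \<phi> V W \<longleftrightarrow> is_module A V \<and> is_module A W \<and> \<phi> \<in> rep_hom A V W"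
  by (simp add: arr_def mod_cat_def)

lemma mod_cat_simps [simp]:
  "Objs (mod_cat A) = {V. is_module A V}"
  "Cmp (mod_cat A) U V W \<psi> \<phi> = (\<lambda>x\<in>Vert A. \<psi> x * \<phi> x)"
  "Idm (mod_cat A) V = (\<lambda>x\<in>Vert A. 1\<^sub>m (dimv V x))"
  "Zero (mod_cat A) V W = (\<lambda>x\<in>Vert A. 0\<^sub>m (dimv W x) (dimv V x))"
  "Plus (mod_cat A) V W \<phi> \<psi> = (\<lambda>x\<in>Vert A. \<phi> x + \<psi> x)"
  by (simp_all add: mod_cat_def)

lemma act_carrier:
  "is_module A V \<Longrightarrow> x \<in> Vert A \<Longrightarrow> y \<in> Vert A \<Longrightarrow> tuple_le x y \<Longrightarrow>
     act V x y \<in> carrier_mat (dimv V x) (dimv V y)"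
  by (simp add: is_module_def)

lemma arr_carrier:
  "arr (mod_cat A) \<phi> V W \<Longrightarrow> x \<in> Vert A \<Longrightarrow> \<phi> x \<in> carrier_mat (dimv W x) (dimv V x)"
  by (auto simp: arr_mod_cat rep_hom_def)

lemma arr_natural:
  "arr (mod_cat A) \<phi> V W \<Longrightarrow> x \<in> Vert A \<Longrightarrow> y \<in> Vert A \<Longrightarrow> tuple_le x y \<Longrightarrow>
     \<phi> x * act V x y = act W x y * \<phi> y"
  by (auto simp: arr_mod_cat rep_hom_def)

lemma arr_extensional: "arr (mod_cat A) \<phi> V W \<Longrightarrow> \<phi> \<in> extensional (Vert A)"
  by (auto simp: arr_mod_cat rep_hom_def PiE_def)

lemma arr_mod_catI:
  assumes "is_module A V" "is_module A W"
    and "\<And>x. x \<in> Vert A \<Longrightarrow> \<phi> x \<in> carrier_mat (dimv W x) (dimv V x)"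
    and "\<And>x y. x \<in> Vert A \<Longrightarrow> y \<in> Vert A \<Longrightarrow> tuple_le x y \<Longrightarrow> \<phi> x * act V x y = act W x y * \<phi> y"
  shows "arr (mod_cat A) (\<lambda>x\<in>Vert A. \<phi> x) V W"
  using assms by (auto simp: arr_mod_cat rep_hom_def)

lemma arr_eqI:
  assumes "arr (mod_cat A) \<phi> V W" "\<And>x. x \<in> Vert A \<Longrightarrow> \<psi> x = \<phi> x"
  shows "(\<lambda>x\<in>Vert A. \<psi> x) = \<phi>"
  using arr_extensional[OF assms(1)] assms(2) by (auto simp: extensional_def fun_eq_iff)

abbreviation mod_cmp :: "'k::field bound_cat \<Rightarrow> (nat list \<Rightarrow> 'k mat) \<Rightarrow> _" where
  "mod_cmp A \<equiv> \<lambda>\<psi> \<phi>. \<lambda>x\<in>Vert A. \<psi> x * \<phi> x"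

abbreviation mod_pls :: "'k::field bound_cat \<Rightarrow> (nat list \<Rightarrow> 'k mat) \<Rightarrow> _" where
  "mod_pls A \<equiv> \<lambda>\<phi> \<psi>. \<lambda>x\<in>Vert A. \<phi> x + \<psi> x"

lemma lin_category_mod_cat: "lin_category (mod_cat A) (mod_cmp A) (mod_pls A)"
proof unfold_locales
  fix X Y :: "'a rep"
  assume X: "X \<in> Objs (mod_cat A)"
  show "arr (mod_cat A) (Idm (mod_cat A) X) X X"
    unfolding mod_cat_simps
  proof (rule arr_mod_catI)
    fix x y assume "x \<in> Vert A" "y \<in> Vert A" "tuple_le x y"
    then have "act X x y \<in> carrier_mat (dimv X x) (dimv X y)" using X act_carrier by auto
    then show "1\<^sub>m (dimv X x) * act X x y = act X x y * 1\<^sub>m (dimv X y)" by simp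
  qed (use X in auto)
  assume Y: "Y \<in> Objs (mod_cat A)"
  show "arr (mod_cat A) (Zero (mod_cat A) X Y) X Y"
    unfolding mod_cat_simps
  proof (rule arr_mod_catI)
    fix x y assume "x \<in> Vert A" "y \<in> Vert A" "tuple_le x y"
    then have "act X x y \<in> carrier_mat (dimv X x) (dimv X y)"
      "act Y x y \<in> carrier_mat (dimv Y x) (dimv Y y)" using X Y act_carrier by auto
    then show "0\<^sub>m (dimv Y x) (dimv X x) * act X x y = act Y x y * 0\<^sub>m (dimv Y y) (dimv X y)" by simp
  qed (use X Y in auto)
next
  fix f g X Y Z
  assume f: "arr (mod_cat A) f X Y" and g: "arr (mod_cat A) g Y Z"
  have m: "is_module A X" "is_module A Y" "is_module A Z" using f g by (auto simp: arr_mod_cat)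
  show "arr (mod_cat A) (mod_cmp A g f) X Z"
  proof (intro arr_mod_catI m)
    fix x y assume x: "x \<in> Vert A" and y: "y \<in> Vert A" and xy: "tuple_le x y"
    note c = arr_carrier[OF f x] arr_carrier[OF g x] arr_carrier[OF f y] arr_carrier[OF g y]
      act_carrier[OF m(1) x y xy] act_carrier[OF m(2) x y xy] act_carrier[OF m(3) x y xy]
    show "(g x * f x) * act X x y = act Z x y * (g y * f y)"
      using assoc_mult_mat[OF c(2,1,5)] arr_natural[OF f x y xy] assoc_mult_mat[OF c(2,6,3)]
        arr_natural[OF g x y xy] assoc_mult_mat[OF c(7,4,3)] by simp
  qed (use arr_carrier[OF f] arr_carrier[OF g] in \<open>auto intro: mult_carrier_mat\<close>)
next
  fix f g X Y
  assume f: "arr (mod_cat A) f X Y" and g: "arr (mod_cat A) g X Y"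
  have m: "is_module A X" "is_module A Y" using f g by (auto simp: arr_mod_cat)
  show "arr (mod_cat A) (mod_pls A f g) X Y"
  proof (intro arr_mod_catI m)
    fix x y assume x: "x \<in> Vert A" and y: "y \<in> Vert A" and xy: "tuple_le x y"
    note c = arr_carrier[OF f x] arr_carrier[OF g x] arr_carrier[OF f y] arr_carrier[OF g y]
      act_carrier[OF m(1) x y xy] act_carrier[OF m(2) x y xy]
    show "(f x + g x) * act X x y = act Y x y * (f y + g y)"
      using add_mult_distrib_mat[OF c(1,2,5)] mult_add_distrib_mat[OF c(6,3,4)]
        arr_natural[OF f x y xy] arr_natural[OF g x y xy] by simp
  qed (use arr_carrier[OF f] arr_carrier[OF g] in auto)
next
  fix f g h W X Y Z
  assume f: "arr (mod_cat A) f W X" and g: "arr (mod_cat A) g X Y" and h: "arr (mod_cat A) h Y Z"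
  show "mod_cmp A (mod_cmp A h g) f = mod_cmp A h (mod_cmp A g f)"
    using assoc_mult_mat[OF arr_carrier[OF h] arr_carrier[OF g] arr_carrier[OF f]]
    by (intro restrict_ext) simp
next
  fix f X Y assume f: "arr (mod_cat A) f X Y"
  show "mod_cmp A (Idm (mod_cat A) Y) f = f" "mod_cmp A f (Idm (mod_cat A) X) = f"
    "mod_pls A f (Zero (mod_cat A) X Y) = f" "mod_pls A (Zero (mod_cat A) X Y) f = f"
    using carrier_matD[OF arr_carrier[OF f]] by (auto intro!: arr_eqI[OF f] simp: mat_dim_simps)
  fix Z :: "'a rep"
  show "mod_cmp A (Zero (mod_cat A) Y Z) f = Zero (mod_cat A) X Z"
    "mod_cmp A f (Zero (mod_cat A) Z X) = Zero (mod_cat A) Z Y"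
    using carrier_matD[OF arr_carrier[OF f]] by (auto intro!: restrict_ext simp: mat_dim_simps)
next
  fix f g h X Y
  assume f: "arr (mod_cat A) f X Y" and g: "arr (mod_cat A) g X Y" and h: "arr (mod_cat A) h X Y"
  show "mod_pls A (mod_pls A f g) h = mod_pls A f (mod_pls A g h)"
    using assoc_add_mat[OF arr_carrier[OF f] arr_carrier[OF g] arr_carrier[OF h]]
    by (intro restrict_ext) simp
next
  fix f g h X Y Z
  assume f: "arr (mod_cat A) f X Y" and g: "arr (mod_cat A) g Y Z" and h: "arr (mod_cat A) h Y Z"
  show "mod_cmp A (mod_pls A g h) f = mod_pls A (mod_cmp A g f) (mod_cmp A h f)"
    using add_mult_distrib_mat[OF arr_carrier[OF g] arr_carrier[OF h] arr_carrier[OF f]]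
    by (intro restrict_ext) simp
next
  fix f g h X Y Z
  assume f: "arr (mod_cat A) f X Y" and g: "arr (mod_cat A) g X Y" and h: "arr (mod_cat A) h Y Z"
  show "mod_cmp A h (mod_pls A f g) = mod_pls A (mod_cmp A h f) (mod_cmp A h g)"
    using mult_add_distrib_mat[OF arr_carrier[OF h] arr_carrier[OF f] arr_carrier[OF g]]
    by (intro restrict_ext) simp
qed simp_all

lemma zero_module_exists: "\<exists>Z. zero_object (mod_cat A) Z"
proof -
  have "zero_object (mod_cat A) \<lparr>dimv = \<lambda>_. 0, act = \<lambda>_ _. 0\<^sub>m 0 0\<rparr>"
    unfolding zero_object_def by (auto simp: is_module_def intro!: restrict_ext eq_matI)
  then show ?thesis by blast
qed

lemma mat_biprod_exists:
  "\<exists>i j p q. i \<in> carrier_mat (m + n) m \<and> j \<in> carrier_mat (m + n) n \<and> p \<in> carrier_mat m (m + n) \<and>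
     q \<in> carrier_mat n (m + n) \<and> p * i = 1\<^sub>m m \<and> q * j = 1\<^sub>m n \<and> p * j = 0\<^sub>m m n \<and> q * i = 0\<^sub>m n m \<and>
     i * p + j * q = (1\<^sub>m (m + n) :: 'k::field mat)"
proof -
  let ?i = "mat (m + n) m (\<lambda>(r, c). if r = c then 1 else 0) :: 'k mat"
  let ?j = "mat (m + n) n (\<lambda>(r, c). if r = m + c then 1 else 0) :: 'k mat"
  let ?p = "mat m (m + n) (\<lambda>(r, c). if r = c then 1 else 0) :: 'k mat"
  let ?q = "mat n (m + n) (\<lambda>(r, c). if m + r = c then 1 else 0) :: 'k mat"
  have s1: "(\<Sum>k<l. (if a = k then 1 else 0) * g k) = (if a < l then g a else 0)" for a l and g :: "nat \<Rightarrow> 'k"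
  proof -
    have "(\<Sum>k<l. (if a = k then 1 else 0) * g k) = (\<Sum>k<l. if a = k then g k else 0)"
      by (rule sum.cong) auto
    then show ?thesis by simp
  qed
  have s2: "(\<Sum>k<l. (if a = m + k then 1 else 0) * g k) = (if m \<le> a \<and> a < m + l then g (a - m) else 0)"
    for a l and g :: "nat \<Rightarrow> 'k"
  proof -
    have "(\<Sum>k<l. (if a = m + k then 1 else 0) * g k) = (\<Sum>k<l. if k = a - m then (if m \<le> a then g k else 0) else 0)"
      by (rule sum.cong) auto
    then show ?thesis by auto
  qed
  have "?p * ?i = 1\<^sub>m m" "?q * ?j = 1\<^sub>m n" "?p * ?j = 0\<^sub>m m n" "?q * ?i = 0\<^sub>m n m"
     "?i * ?p + ?j * ?q = 1\<^sub>m (m + n)"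
    by (rule eq_matI, auto simp: scalar_prod_def s1 s2 atLeast0LessThan)+
  then show ?thesis
    by (intro exI[of _ ?i] exI[of _ ?j] exI[of _ ?p] exI[of _ ?q]) simp
qed

lemma mod_sums_exist:
  assumes X: "is_module A X" and Y: "is_module A Y"
  shows "\<exists>S. direct_sum (mod_cat A) X Y S"
proof -
  interpret lin_category "mod_cat A" "mod_cmp A" "mod_pls A" by (rule lin_category_mod_cat)
  let ?m = "dimv X" and ?n = "dimv Y"
  have "\<forall>x. \<exists>i j p q. i \<in> carrier_mat (?m x + ?n x) (?m x) \<and> j \<in> carrier_mat (?m x + ?n x) (?n x) \<and>
     p \<in> carrier_mat (?m x) (?m x + ?n x) \<and> q \<in> carrier_mat (?n x) (?m x + ?n x) \<and>
     p * i = 1\<^sub>m (?m x) \<and> q * j = 1\<^sub>m (?n x) \<and> p * j = 0\<^sub>m (?m x) (?n x) \<and> q * i = 0\<^sub>m (?n x) (?m x) \<and>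
     i * p + j * q = (1\<^sub>m (?m x + ?n x) :: 'a mat)"
    using mat_biprod_exists by blast
  then obtain i j p q :: "nat list \<Rightarrow> 'a mat" where
    c: "\<And>x. i x \<in> carrier_mat (?m x + ?n x) (?m x)" "\<And>x. j x \<in> carrier_mat (?m x + ?n x) (?n x)"
      "\<And>x. p x \<in> carrier_mat (?m x) (?m x + ?n x)" "\<And>x. q x \<in> carrier_mat (?n x) (?m x + ?n x)"
    and e: "\<And>x. p x * i x = 1\<^sub>m (?m x)" "\<And>x. q x * j x = 1\<^sub>m (?n x)"
      "\<And>x. p x * j x = 0\<^sub>m (?m x) (?n x)" "\<And>x. q x * i x = 0\<^sub>m (?n x) (?m x)"
      "\<And>x. i x * p x + j x * q x = 1\<^sub>m (?m x + ?n x)"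
    unfolding choice_iff by blast
  define S where "S = \<lparr>dimv = \<lambda>x. ?m x + ?n x,
     act = \<lambda>x y. i x * (act X x y * p y) + j x * (act Y x y * q y)\<rparr>"
  have SS: "dimv S x = ?m x + ?n x" "act S x y = i x * (act X x y * p y) + j x * (act Y x y * q y)" for x y
    by (simp_all add: S_def)
  have aX: "act X x y \<in> carrier_mat (?m x) (?m y)" and aY: "act Y x y \<in> carrier_mat (?n x) (?n y)"
    if "x \<in> Vert A" "y \<in> Vert A" "tuple_le x y" for x y
    using that X Y act_carrier by auto
  have pS: "p x * act S x y = act X x y * p y" and qS: "q x * act S x y = act Y x y * q y"
    and Si: "act S x y * i y = i x * act X x y" and Sj: "act S x y * j y = j x * act Y x y"
    and cS: "act S x y \<in> carrier_mat (?m x + ?n x) (?m y + ?n y)"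
    if xy: "x \<in> Vert A" "y \<in> Vert A" "tuple_le x y" for x y
  proof -
    note ap = mult_carrier_mat[OF aX[OF xy] c(3)] and aq = mult_carrier_mat[OF aY[OF xy] c(4)]
    note iap = mult_carrier_mat[OF c(1) ap] and jaq = mult_carrier_mat[OF c(2) aq]
    show "act S x y \<in> carrier_mat (?m x + ?n x) (?m y + ?n y)"
      unfolding SS using iap jaq by simp
    show "p x * act S x y = act X x y * p y"
      unfolding SS mult_add_distrib_mat[OF c(3) iap jaq]
        assoc_mult_mat[OF c(3) c(1) ap, symmetric] assoc_mult_mat[OF c(3) c(2) aq, symmetric] e
      using carrier_matD[OF ap] carrier_matD[OF aq] by (simp add: mat_dim_simps)
    show "q x * act S x y = act Y x y * q y"
      unfolding SS mult_add_distrib_mat[OF c(4) iap jaq]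
        assoc_mult_mat[OF c(4) c(1) ap, symmetric] assoc_mult_mat[OF c(4) c(2) aq, symmetric] e
      using carrier_matD[OF ap] carrier_matD[OF aq] by (simp add: mat_dim_simps)
    show "act S x y * i y = i x * act X x y"
      unfolding SS add_mult_distrib_mat[OF iap jaq c(1)] assoc_mult_mat[OF c(1) ap c(1)]
        assoc_mult_mat[OF c(2) aq c(1)] assoc_mult_mat[OF aX[OF xy] c(3) c(1)]
        assoc_mult_mat[OF aY[OF xy] c(4) c(1)] e
      using carrier_matD[OF c(1)[of x]] carrier_matD[OF c(2)[of x]]
        carrier_matD[OF aX[OF xy]] carrier_matD[OF aY[OF xy]] by (simp add: mat_dim_simps)
    show "act S x y * j y = j x * act Y x y"
      unfolding SS add_mult_distrib_mat[OF iap jaq c(2)] assoc_mult_mat[OF c(1) ap c(2)]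
        assoc_mult_mat[OF c(2) aq c(2)] assoc_mult_mat[OF aX[OF xy] c(3) c(2)]
        assoc_mult_mat[OF aY[OF xy] c(4) c(2)] e
      using carrier_matD[OF c(1)[of x]] carrier_matD[OF c(2)[of x]]
        carrier_matD[OF aX[OF xy]] carrier_matD[OF aY[OF xy]] by (simp add: mat_dim_simps)
  qed
  have "is_module A S"
    unfolding is_module_def SS(1)
  proof (intro conjI ballI impI cS; (elim conjE)?)
    fix x assume x: "x \<in> Vert A"
    have "act X x x = 1\<^sub>m (?m x)" "act Y x x = 1\<^sub>m (?n x)"
      using X Y x by (auto simp: is_module_def)
    then show "act S x x = 1\<^sub>m (?m x + ?n x)"
      unfolding SS using e(5)[of x] carrier_matD[OF c(3)[of x]] carrier_matD[OF c(4)[of x]]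
      by (simp add: mat_dim_simps)
    fix y assume y: "y \<in> Vert A"
    {
      fix z assume z: "z \<in> Vert A" and xy: "tuple_le x y" and yz: "tuple_le y z"
      have xz: "tuple_le x z" using tuple_le_trans xy yz by blast
      have XX: "act X x z = act X x y * act X y z" "act Y x z = act Y x y * act Y y z"
        using X Y x y z xy yz by (auto simp: is_module_def)
      note aXs = aX[OF x y xy] aX[OF y z yz] and aYs = aY[OF x y xy] aY[OF y z yz]
      note ap = mult_carrier_mat[OF aXs(1) c(3)] and aq = mult_carrier_mat[OF aYs(1) c(4)]
      note iap = mult_carrier_mat[OF c(1) ap] and jaq = mult_carrier_mat[OF c(2) aq]
      have "act S x y * act S y z = i x * (act X x y * p y) * act S y z + j x * (act Y x y * q y) * act S y z"
        unfolding SS(2)[of x y] by (rule add_mult_distrib_mat[OF iap jaq cS[OF y z yz]])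
      also have "\<dots> = i x * (act X x y * (p y * act S y z)) + j x * (act Y x y * (q y * act S y z))"
        using assoc_mult_mat[OF c(1) ap cS[OF y z yz]] assoc_mult_mat[OF aXs(1) c(3) cS[OF y z yz]]
          assoc_mult_mat[OF c(2) aq cS[OF y z yz]] assoc_mult_mat[OF aYs(1) c(4) cS[OF y z yz]] by simp
      also have "\<dots> = act S x z"
        unfolding pS[OF y z yz] qS[OF y z yz] SS(2)[of x z] XX
        using assoc_mult_mat[OF aXs c(3)] assoc_mult_mat[OF aYs c(4)] by simp
      finally show "act S x z = act S x y * act S y z" by simp
    }
    fix k assume xy: "tuple_le x y" and k: "k \<in> Null A x y"
    have z: "k \<cdot>\<^sub>m act X x y = 0\<^sub>m (?m x) (?m y)" "k \<cdot>\<^sub>m act Y x y = 0\<^sub>m (?n x) (?n y)"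
      using X Y x y xy k by (auto simp: is_module_def)
    note axy = aX[OF x y xy] aY[OF x y xy]
    note ap = mult_carrier_mat[OF axy(1) c(3)] and aq = mult_carrier_mat[OF axy(2) c(4)]
    note iap = mult_carrier_mat[OF c(1) ap] and jaq = mult_carrier_mat[OF c(2) aq]
    have "k \<cdot>\<^sub>m act S x y = i x * ((k \<cdot>\<^sub>m act X x y) * p y) + j x * ((k \<cdot>\<^sub>m act Y x y) * q y)"
      unfolding SS add_smult_distrib_left_mat[OF iap jaq] using mult_smult_distrib[OF c(1) ap]
        mult_smult_distrib[OF c(2) aq] mult_smult_assoc_mat[OF axy(1) c(3)]
        mult_smult_assoc_mat[OF axy(2) c(4)] by simp
    also have "\<dots> = 0\<^sub>m (?m x + ?n x) (?m y + ?n y)"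
      unfolding z using carrier_matD[OF c(1)[of x]] carrier_matD[OF c(2)[of x]]
        carrier_matD[OF c(3)[of y]] carrier_matD[OF c(4)[of y]] by (simp add: mat_dim_simps)
    finally show "k \<cdot>\<^sub>m act S x y = 0\<^sub>m (?m x + ?n x) (?m y + ?n y)" .
  qed
  note S = this
  have "biprod X Y S (restrict i (Vert A)) (restrict j (Vert A)) (restrict p (Vert A)) (restrict q (Vert A))"
    unfolding biprod_def
    by (intro conjI arr_mod_catI X Y S)
      (use c e pS qS Si Sj in \<open>auto simp: SS(1) intro!: restrict_ext\<close>)
  then show ?thesis unfolding direct_sum_iff by blast
qed

text \<open>An explicit complement of a summand of dimension one, where \<open>a\<close> is a vector and \<open>b\<close> a functional with
  \<open>b a = 1\<close>. Choose \<open>t\<close> with \<open>a\<^sub>t \<noteq> 0\<close>. The projection \<open>v \<mapsto> (v\<^sub>c - a\<^sub>c v\<^sub>t / a\<^sub>t)\<close>, \<open>c \<noteq> t\<close>, has kernel spanned by \<open>a\<close>,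
  and \<open>e\<^sub>c \<mapsto> e\<^sub>c - b\<^sub>c a\<close> maps into the kernel of \<open>b\<close> and is a section of it.\<close>
lemma mat_split:
  fixes a b :: "'k::field mat"
  assumes a: "a \<in> carrier_mat m k" and b: "b \<in> carrier_mat k m" and ba: "b * a = 1\<^sub>m k" and k: "k \<le> 1"
  shows "\<exists>m' j q. j \<in> carrier_mat m m' \<and> q \<in> carrier_mat m' m \<and> q * j = 1\<^sub>m m' \<and>
     b * j = 0\<^sub>m k m' \<and> q * a = 0\<^sub>m m' k \<and> a * b + j * q = 1\<^sub>m m"
proof (cases "k = 0")
  case True
  have "a * b = 0\<^sub>m m m" using a b True by (auto intro!: eq_matI simp: scalar_prod_def)
  then show ?thesis
    using a b True by (intro exI[of _ m] exI[of _ "1\<^sub>m m"]) (auto intro!: eq_matI)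
next
  case False
  then have k1: "k = 1" using k by simp
  define \<alpha> where "\<alpha> r = a $$ (r, 0)" for r
  define \<beta> where "\<beta> r = b $$ (0, r)" for r
  have sum1: "(\<Sum>r<m. \<beta> r * \<alpha> r) = 1"
  proof -
    have "(b * a) $$ (0, 0) = (\<Sum>r<m. \<beta> r * \<alpha> r)"
      using a b k1 by (simp add: \<alpha>_def \<beta>_def scalar_prod_def atLeast0LessThan)
    then show ?thesis using ba k1 by simp
  qed
  have "\<exists>t<m. \<alpha> t \<noteq> 0"
  proof (rule ccontr)
    assume "\<not> (\<exists>t<m. \<alpha> t \<noteq> 0)"
    then have "(\<Sum>r<m. \<beta> r * \<alpha> r) = 0" by (intro sum.neutral) auto
    then show False using sum1 by simp
  qed
  then obtain t where t: "t < m" "\<alpha> t \<noteq> 0" by blast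
  \<comment> \<open>\<open>s\<close> enumerates the indices different from \<open>t\<close>.\<close>
  define s where "s c = (if c < t then c else Suc c)" for c
  define m' where "m' = m - 1"
  have s: "s c < m" "s c \<noteq> t" if "c < m'" for c using that t by (auto simp: s_def m'_def)
  have s_eq: "s c = s c' \<longleftrightarrow> c = c'" for c c' by (auto simp: s_def)
  have bij: "bij_betw s {..<m'} ({..<m} - {t})"
  proof (rule bij_betwI[where g = "\<lambda>u. if u < t then u else u - 1"])
    show "s \<in> {..<m'} \<rightarrow> {..<m} - {t}" using s by auto
  qed (use t in \<open>auto simp: s_def m'_def split: if_splits\<close>)
  define J where "J = mat m m' (\<lambda>(r, c). (if r = s c then 1 else 0) - \<beta> (s c) * \<alpha> r)"
  define Q where "Q = mat m' m (\<lambda>(c, r). (if s c = r then 1 else 0) - (if t = r then \<alpha> (s c) / \<alpha> t else 0))"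
  have Jc: "J \<in> carrier_mat m m'" and Qc: "Q \<in> carrier_mat m' m" by (auto simp: J_def Q_def)
  have QF: "(\<Sum>r<m. ((if s c = r then 1 else 0) - (if t = r then \<alpha> (s c) / \<alpha> t else 0)) * F r)
     = F (s c) - \<alpha> (s c) / \<alpha> t * F t" if c: "c < m'" for c F
  proof -
    have "(\<Sum>r<m. ((if s c = r then 1 else 0) - (if t = r then \<alpha> (s c) / \<alpha> t else 0)) * F r)
      = (\<Sum>r<m. (if s c = r then F r else 0) - (if t = r then \<alpha> (s c) / \<alpha> t * F r else 0))"
      by (rule sum.cong) auto
    also have "\<dots> = F (s c) - \<alpha> (s c) / \<alpha> t * F t"
      using s[OF c] t by (simp add: sum_subtractf)
    finally show ?thesis .
  qed
  have "Q * J = 1\<^sub>m m'"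
  proof (rule eq_matI)
    fix c c' assume c: "c < dim_row (1\<^sub>m m')" "c' < dim_col (1\<^sub>m m')"
    then have "(Q * J) $$ (c, c') = (\<Sum>r<m. ((if s c = r then 1 else 0) - (if t = r then \<alpha> (s c) / \<alpha> t else 0)) *
        ((if r = s c' then 1 else 0) - \<beta> (s c') * \<alpha> r))"
      by (simp add: Q_def J_def scalar_prod_def atLeast0LessThan)
    also have "\<dots> = 1\<^sub>m m' $$ (c, c')"
      using QF[of c "\<lambda>r. (if r = s c' then 1 else 0) - \<beta> (s c') * \<alpha> r"] s[of c'] c t s_eq by auto
    finally show "(Q * J) $$ (c, c') = 1\<^sub>m m' $$ (c, c')" .
  qed (auto simp: Q_def J_def)
  moreover have "b * J = 0\<^sub>m k m'"
  proof (rule eq_matI)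
    fix r c assume c: "r < dim_row (0\<^sub>m k m')" "c < dim_col (0\<^sub>m k m')"
    then have "(b * J) $$ (r, c) = (\<Sum>u<m. \<beta> u * ((if u = s c then 1 else 0) - \<beta> (s c) * \<alpha> u))"
      using b k1 by (simp add: J_def scalar_prod_def atLeast0LessThan \<beta>_def)
    also have "\<dots> = (\<Sum>u<m. (if u = s c then \<beta> u else 0) - \<beta> (s c) * (\<beta> u * \<alpha> u))"
      by (rule sum.cong) (auto simp: algebra_simps)
    also have "\<dots> = 0" using s[of c] c sum1 by (simp add: sum_subtractf sum_distrib_left[symmetric])
    finally show "(b * J) $$ (r, c) = 0\<^sub>m k m' $$ (r, c)" using c by simp
  qed (use b in \<open>auto simp: J_def\<close>)
  moreover have "Q * a = 0\<^sub>m m' k"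
  proof (rule eq_matI)
    fix r c assume c: "r < dim_row (0\<^sub>m m' k)" "c < dim_col (0\<^sub>m m' k)"
    then have "(Q * a) $$ (r, c) = (\<Sum>u<m. ((if s r = u then 1 else 0) - (if t = u then \<alpha> (s r) / \<alpha> t else 0)) * \<alpha> u)"
      using a k1 by (simp add: Q_def scalar_prod_def atLeast0LessThan \<alpha>_def)
    also have "\<dots> = 0" using QF[of r \<alpha>] c t by simp
    finally show "(Q * a) $$ (r, c) = 0\<^sub>m m' k $$ (r, c)" using c by simp
  qed (use a in \<open>auto simp: Q_def\<close>)
  moreover have "a * b + J * Q = 1\<^sub>m m"
  proof (rule eq_matI)
    fix r r' assume r: "r < dim_row (1\<^sub>m m)" "r' < dim_col (1\<^sub>m m)"
    define F where "F u = ((if r = u then 1 else 0) - \<beta> u * \<alpha> r) *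
      ((if u = r' then 1 else 0) - (if t = r' then \<alpha> u / \<alpha> t else 0))" for u
    have "(a * b) $$ (r, r') = \<alpha> r * \<beta> r'"
      using a b k1 r by (simp add: \<alpha>_def \<beta>_def scalar_prod_def)
    moreover have "(J * Q) $$ (r, r') = (\<Sum>c<m'. F (s c))"
      using r by (simp add: Q_def J_def scalar_prod_def atLeast0LessThan F_def)
    moreover have "(\<Sum>c<m'. F (s c)) = (\<Sum>u\<in>{..<m} - {t}. F u)"
      by (rule sum.reindex_bij_betw[OF bij])
    moreover have "(\<Sum>u<m. F u) = F t + (\<Sum>u\<in>{..<m} - {t}. F u)"
      using t by (intro sum.remove) auto
    moreover have "F t = 0" using t by (auto simp: F_def)
    moreover have "(\<Sum>u<m. F u) = (\<Sum>u<m. (if r = u then (if u = r' then 1 else 0) - (if t = r' then \<alpha> u / \<alpha> t else 0) else 0)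
        - (if u = r' then \<beta> u * \<alpha> r else 0) + (if t = r' then \<alpha> r / \<alpha> t * (\<beta> u * \<alpha> u) else 0))"
      by (rule sum.cong) (auto simp: F_def algebra_simps)
    moreover have "(\<Sum>u<m. \<alpha> r * (\<beta> u * \<alpha> u) / \<alpha> t) = \<alpha> r / \<alpha> t"
      by (simp add: sum_divide_distrib[symmetric] sum_distrib_left[symmetric] sum1)
    then have "(\<Sum>u<m. (if r = u then (if u = r' then 1 else 0) - (if t = r' then \<alpha> u / \<alpha> t else 0) else 0)
        - (if u = r' then \<beta> u * \<alpha> r else 0) + (if t = r' then \<alpha> r / \<alpha> t * (\<beta> u * \<alpha> u) else 0))
        = (if r = r' then 1 else 0) - \<beta> r' * \<alpha> r"
      using r t sum1 by (auto simp: sum.distrib sum_subtractf sum_distrib_left[symmetric])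
    ultimately show "(a * b + J * Q) $$ (r, r') = 1\<^sub>m m $$ (r, r')"
      using a b r Jc Qc by (simp add: algebra_simps)
  qed (use Jc Qc in auto)
  ultimately show ?thesis using Jc Qc by blast
qed

text \<open>Complements are chosen vertex by vertex, and the structure maps are transported along inclusion and
  projection. This is functorial because the summand \<open>N\<close> is a submodule and a quotient.\<close>
lemma mod_split:
  assumes a: "arr (mod_cat A) a N X" and b: "arr (mod_cat A) b X N"
    and ba: "mod_cmp A b a = Idm (mod_cat A) N" and N1: "\<And>x. x \<in> Vert A \<Longrightarrow> dimv N x \<le> 1"
  shows "\<exists>Y j q. lin_category.biprod (mod_cat A) (mod_cmp A) (mod_pls A) N Y X a j b q"
proof -
  interpret lin_category "mod_cat A" "mod_cmp A" "mod_pls A" by (rule lin_category_mod_cat)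
  let ?k = "dimv N" and ?m = "dimv X"
  have N: "is_module A N" and X: "is_module A X" using a by (auto simp: arr_mod_cat)
  have ba': "b x * a x = 1\<^sub>m (?k x)" if "x \<in> Vert A" for x
    using fun_cong[OF ba, of x] that by simp
  have "\<forall>x. \<exists>m' j q. x \<in> Vert A \<longrightarrow> j \<in> carrier_mat (?m x) m' \<and> q \<in> carrier_mat m' (?m x) \<and> q * j = 1\<^sub>m m' \<and>
     b x * j = 0\<^sub>m (?k x) m' \<and> q * a x = 0\<^sub>m m' (?k x) \<and> a x * b x + j * q = 1\<^sub>m (?m x)"
    using mat_split[OF arr_carrier[OF a] arr_carrier[OF b] ba' N1] by blast
  then obtain m' j q where
    c: "\<And>x. x \<in> Vert A \<Longrightarrow> j x \<in> carrier_mat (?m x) (m' x)" "\<And>x. x \<in> Vert A \<Longrightarrow> q x \<in> carrier_mat (m' x) (?m x)"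
    and e: "\<And>x. x \<in> Vert A \<Longrightarrow> q x * j x = 1\<^sub>m (m' x)" "\<And>x. x \<in> Vert A \<Longrightarrow> b x * j x = 0\<^sub>m (?k x) (m' x)"
      "\<And>x. x \<in> Vert A \<Longrightarrow> q x * a x = 0\<^sub>m (m' x) (?k x)"
      "\<And>x. x \<in> Vert A \<Longrightarrow> a x * b x + j x * q x = 1\<^sub>m (?m x)"
    unfolding choice_iff by blast
  define Y where "Y = \<lparr>dimv = m', act = \<lambda>x y. q x * (act X x y * j y)\<rparr>"
  have YY: "dimv Y x = m' x" "act Y x y = q x * (act X x y * j y)" for x y
    by (simp_all add: Y_def)
  note ca = arr_carrier[OF a] and cb = arr_carrier[OF b]
  have jq: "j x * (q x * M) = M" if x: "x \<in> Vert A" and M: "M \<in> carrier_mat (?m x) l" and bM: "b x * M = 0\<^sub>m (?k x) l" for x M l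
  proof -
    have "M = (a x * b x + j x * q x) * M" using e(4)[OF x] M by simp
    also have "\<dots> = a x * (b x * M) + j x * (q x * M)"
      using add_mult_distrib_mat[OF mult_carrier_mat[OF ca[OF x] cb[OF x]] mult_carrier_mat[OF c(1)[OF x] c(2)[OF x]] M]
        assoc_mult_mat[OF ca[OF x] cb[OF x] M] assoc_mult_mat[OF c(1)[OF x] c(2)[OF x] M] by simp
    also have "\<dots> = j x * (q x * M)"
      unfolding bM using ca[OF x] mult_carrier_mat[OF c(1)[OF x] mult_carrier_mat[OF c(2)[OF x] M]] by simp
    finally show ?thesis by simp
  qed
  have qj: "(M * j x) * q x = M" if x: "x \<in> Vert A" and M: "M \<in> carrier_mat l (?m x)" and bM: "M * a x = 0\<^sub>m l (?k x)" for x M l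
  proof -
    have "M = M * (a x * b x + j x * q x)" using e(4)[OF x] M by simp
    also have "\<dots> = (M * a x) * b x + (M * j x) * q x"
      using mult_add_distrib_mat[OF M mult_carrier_mat[OF ca[OF x] cb[OF x]] mult_carrier_mat[OF c(1)[OF x] c(2)[OF x]]]
        assoc_mult_mat[OF M ca[OF x] cb[OF x]] assoc_mult_mat[OF M c(1)[OF x] c(2)[OF x]] by simp
    also have "\<dots> = (M * j x) * q x"
      unfolding bM using cb[OF x] mult_carrier_mat[OF mult_carrier_mat[OF M c(1)[OF x]] c(2)[OF x]] by simp
    finally show ?thesis by simp
  qed
  have aX: "act X x y \<in> carrier_mat (?m x) (?m y)" and aN: "act N x y \<in> carrier_mat (?k x) (?k y)"
    if "x \<in> Vert A" "y \<in> Vert A" "tuple_le x y" for x y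
    using that X N act_carrier by auto
  have cY: "act Y x y \<in> carrier_mat (m' x) (m' y)" and jY: "j x * act Y x y = act X x y * j y"
    and Yq: "act Y x y * q y = q x * act X x y"
    if xy: "x \<in> Vert A" "y \<in> Vert A" "tuple_le x y" for x y
  proof -
    note cX = aX[OF xy] and cN = aN[OF xy]
    note cx = c(1)[OF xy(1)] c(2)[OF xy(1)] and cy = c(1)[OF xy(2)] c(2)[OF xy(2)]
    note Xj = mult_carrier_mat[OF cX cy(1)] and qX = mult_carrier_mat[OF cx(2) cX]
    show "act Y x y \<in> carrier_mat (m' x) (m' y)"
      unfolding YY using mult_carrier_mat[OF cx(2) Xj] .
    have "b x * (act X x y * j y) = act N x y * (b y * j y)"
      using assoc_mult_mat[OF cb[OF xy(1)] cX cy(1)] arr_natural[OF b xy] assoc_mult_mat[OF cN cb[OF xy(2)] cy(1)] by simp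
    also have "\<dots> = 0\<^sub>m (?k x) (m' y)" unfolding e(2)[OF xy(2)] using cN by simp
    finally show "j x * act Y x y = act X x y * j y" unfolding YY by (rule jq[OF xy(1) Xj])
    have "(q x * act X x y) * a y = (q x * a x) * act N x y"
      using assoc_mult_mat[OF cx(2) cX ca[OF xy(2)]] arr_natural[OF a xy] assoc_mult_mat[OF cx(2) ca[OF xy(1)] cN] by simp
    also have "\<dots> = 0\<^sub>m (m' x) (?k y)" unfolding e(3)[OF xy(1)] using cN by simp
    finally show "act Y x y * q y = q x * act X x y"
      unfolding YY assoc_mult_mat[OF cx(2) cX cy(1), symmetric] by (rule qj[OF xy(2) qX])
  qed
  have Y: "is_module A Y"
    unfolding is_module_def YY(1)
  proof (intro conjI ballI impI cY; (elim conjE)?)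
    fix x assume x: "x \<in> Vert A"
    have "act X x x = 1\<^sub>m (?m x)" using X x by (auto simp: is_module_def)
    then show "act Y x x = 1\<^sub>m (m' x)" unfolding YY using e(1)[OF x] c(1)[OF x] by simp
    fix y assume y: "y \<in> Vert A"
    {
      fix z assume z: "z \<in> Vert A" and xy: "tuple_le x y" and yz: "tuple_le y z"
      have "act X x z = act X x y * act X y z" using X x y z xy yz by (auto simp: is_module_def)
      then have "act Y x z = (q x * act X x y) * (act X y z * j z)"
        unfolding YY
        using assoc_mult_mat[OF aX[OF x y xy] aX[OF y z yz] c(1)[OF z]]
          assoc_mult_mat[OF c(2)[OF x] aX[OF x y xy] mult_carrier_mat[OF aX[OF y z yz] c(1)[OF z]]] by simp
      also have "\<dots> = act Y x y * act Y y z"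
        unfolding Yq[OF x y xy, symmetric] YY(2)[of y z]
        by (rule assoc_mult_mat[OF cY[OF x y xy] c(2)[OF y] mult_carrier_mat[OF aX[OF y z yz] c(1)[OF z]]])
      finally show "act Y x z = act Y x y * act Y y z" .
    }
    fix r assume xy: "tuple_le x y" and r: "r \<in> Null A x y"
    have z: "r \<cdot>\<^sub>m act X x y = 0\<^sub>m (?m x) (?m y)" using X x y xy r by (auto simp: is_module_def)
    have "r \<cdot>\<^sub>m act Y x y = q x * ((r \<cdot>\<^sub>m act X x y) * j y)"
      unfolding YY using mult_smult_distrib[OF c(2)[OF x] mult_carrier_mat[OF aX[OF x y xy] c(1)[OF y]]]
        mult_smult_assoc_mat[OF aX[OF x y xy] c(1)[OF y]] by simp
    also have "\<dots> = 0\<^sub>m (m' x) (m' y)" unfolding z using c(1)[OF y] c(2)[OF x] by simp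
    finally show "r \<cdot>\<^sub>m act Y x y = 0\<^sub>m (m' x) (m' y)" .
  qed
  have "biprod N Y X a (restrict j (Vert A)) b (restrict q (Vert A))"
    unfolding biprod_def
    by (intro conjI arr_mod_catI a b ba X Y)
      (use c e cY jY Yq in \<open>auto simp: YY(1) intro!: restrict_ext\<close>)
  then show ?thesis by blast
qed

section \<open>Homomorphisms between interval modules\<close>

definition interlace :: "nat \<Rightarrow> nat list \<Rightarrow> nat list \<Rightarrow> bool" where
  "interlace d x y \<longleftrightarrow> (\<forall>i\<le>d. x ! i \<le> y ! i) \<and> (\<forall>i<d. y ! i \<le> x ! (i + 1))"

lemma os_iff: "x \<in> os n m \<longleftrightarrow> length x = m \<and> (\<forall>i<m. x ! i < n) \<and> (\<forall>i. i + 1 < m \<longrightarrow> x ! i \<le> x ! (i + 1))"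
  by (auto simp: os_def grid_def sorted_iff_nth_Suc in_set_conv_nth subset_iff)

lemma os_nth_mono: "x \<in> os n m \<Longrightarrow> i \<le> j \<Longrightarrow> j < m \<Longrightarrow> x ! i \<le> x ! j"
  by (auto simp: os_def grid_def sorted_nth_mono)

lemma interlace_refl: "x \<in> os n (d + 1) \<Longrightarrow> interlace d x x"
  by (auto simp: interlace_def os_iff)

lemma M_support_iff:
  "y \<in> M_support n d x \<longleftrightarrow> y \<in> os n d \<and> (\<forall>i<d. x ! i \<le> y ! i \<and> y ! i \<le> x ! (i + 1))"
  by (simp add: M_support_def)

lemma dimv_M_int: "dimv (M_int n d x) y = (if y \<in> M_support n d x then 1 else 0)"
  by (simp add: M_int_def Let_def)

lemma act_M_int: "act (M_int n d x) y z = mat (if y \<in> M_support n d x then 1 else 0)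
  (if z \<in> M_support n d x then 1 else 0) (\<lambda>_. 1)"
  by (simp add: M_int_def Let_def)

lemma top_M_support: "x \<in> os n (d + 1) \<Longrightarrow> tl x \<in> M_support n d x"
  by (auto simp: M_support_iff os_iff nth_tl)

lemma bottom_M_support: "x \<in> os n (d + 1) \<Longrightarrow> butlast x \<in> M_support n d x"
  by (auto simp: M_support_iff os_iff nth_butlast)

text \<open>The support is a product of intervals with \<open>x\<^sub>i \<le> y\<^sub>i \<le> x\<^sub>i\<^sub>+\<^sub>1 \<le> y\<^sub>i\<^sub>+\<^sub>1\<close>, so tuples in between are automatically
  non-decreasing.\<close>
lemma M_support_between:
  assumes "y \<in> M_support n d x" "y' \<in> M_support n d x" "tuple_le y z" "tuple_le z y'"
  shows "z \<in> M_support n d x"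
proof -
  have y: "length y = d" "length y' = d" "\<And>i. i < d \<Longrightarrow> x ! i \<le> y ! i" "\<And>i. i < d \<Longrightarrow> y' ! i \<le> x ! (i + 1)"
    "\<And>i. i < d \<Longrightarrow> y' ! i < n"
    using assms by (auto simp: M_support_iff os_iff)
  have z: "length z = d" "\<And>i. i < d \<Longrightarrow> y ! i \<le> z ! i" "\<And>i. i < d \<Longrightarrow> z ! i \<le> y' ! i"
    using assms y by (auto simp: tuple_le_iff)
  have b: "x ! i \<le> z ! i" "z ! i \<le> x ! (i + 1)" "z ! i < n" if "i < d" for i
    using y(3-5)[OF that] z(2,3)[OF that] by linarith+
  have "z ! i \<le> z ! (i + 1)" if "i + 1 < d" for i
    using b(2)[of i] b(1)[of "i + 1"] that by linarith
  then show ?thesis using b z(1) by (auto simp: M_support_iff os_iff)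
qed

lemma mat_const_mult:
  "mat a b (\<lambda>_. c) * mat b e (\<lambda>_. c') = mat a e (\<lambda>_. of_nat b * (c * c') :: 'k::field)"
  by (rule eq_matI) (auto simp: scalar_prod_def)

lemma is_module_M_int:
  assumes V: "Vert A = grid n d"
    and Null: "\<And>y z c. y \<in> M_support n d x \<Longrightarrow> z \<in> M_support n d x \<Longrightarrow> tuple_le y z \<Longrightarrow> c \<in> Null A y z \<Longrightarrow> c = 0"
  shows "is_module A (M_int n d x)"
  unfolding is_module_def
proof (intro conjI ballI impI; (elim conjE)?)
  fix y z u assume "tuple_le y z" "tuple_le z u"
  then show "act (M_int n d x) y u = act (M_int n d x) y z * act (M_int n d x) z u"
    using M_support_between[of y n d x u z]
    by (auto simp: act_M_int mat_const_mult dimv_M_int intro!: eq_matI)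
next
  fix y z c assume "tuple_le y z" "c \<in> Null A y z"
  then show "c \<cdot>\<^sub>m act (M_int n d x) y z = 0\<^sub>m (dimv (M_int n d x) y) (dimv (M_int n d x) z)"
    using Null[of y z c] by (auto simp: act_M_int dimv_M_int intro!: eq_matI)
qed (auto simp: act_M_int dimv_M_int intro!: eq_matI)

locale interval_modules =
  fixes A :: "'k::field bound_cat" and n d :: nat and J :: "nat list set"
  assumes V: "Vert A = grid n d" and J: "J \<subseteq> os n (d + 1)" and d: "d \<ge> 1"
    and modules: "x \<in> J \<Longrightarrow> is_module A (M_int n d x)"
begin

sublocale lin_category "mod_cat A" "mod_cmp A" "mod_pls A"
  by (rule lin_category_mod_cat)

abbreviation M :: "nat list \<Rightarrow> 'k rep" where "M \<equiv> M_int n d"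
abbreviation supp :: "nat list \<Rightarrow> nat list set" where "supp \<equiv> M_support n d"
abbreviation \<delta> :: "nat list \<Rightarrow> nat list \<Rightarrow> nat" where "\<delta> x u \<equiv> (if u \<in> supp x then 1 else 0)"

definition scalar_map :: "'k \<Rightarrow> nat list \<Rightarrow> nat list \<Rightarrow> nat list \<Rightarrow> 'k mat" where
  "scalar_map c x y = (\<lambda>u\<in>Vert A. mat (\<delta> y u) (\<delta> x u) (\<lambda>_. c))"

lemma supp_Vert: "supp x \<subseteq> Vert A"
  by (auto simp: V M_support_iff os_def)

lemma J_len: "x \<in> J \<Longrightarrow> length x = d + 1"
  using J by (auto simp: os_iff)

lemma scalar_map_zero: "scalar_map 0 x y = Zero (mod_cat A) (M x) (M y)"
  unfolding scalar_map_def mod_cat_simps by (intro restrict_ext) (auto simp: dimv_M_int)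

lemma scalar_map_id: "scalar_map 1 x x = Idm (mod_cat A) (M x)"
  unfolding scalar_map_def mod_cat_simps by (intro restrict_ext) (auto simp: dimv_M_int intro!: eq_matI)

lemma bottom_common:
  assumes "x \<in> J" "y \<in> J" "interlace d x y"
  shows "butlast y \<in> supp x \<inter> supp y"
proof -
  have "butlast y \<in> supp y" using bottom_M_support assms J by blast
  then show ?thesis using assms J_len by (auto simp: M_support_iff interlace_def nth_butlast)
qed

lemma scalar_map_inj:
  assumes "x \<in> J" "y \<in> J" "interlace d x y" "scalar_map c x y = scalar_map c' x y"
  shows "c = c'"
proof -
  let ?u = "butlast y"
  have u: "?u \<in> supp x" "?u \<in> supp y" using bottom_common assms by auto
  then have "?u \<in> Vert A" using supp_Vert by blast
  then show ?thesis
    using arg_cong[OF fun_cong[OF assms(4), of ?u], of "\<lambda>m. m $$ (0, 0)"] u by (simp add: scalar_map_def)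
qed

lemma arr_scalar_map:
  assumes "x \<in> J" "y \<in> J" "interlace d x y"
  shows "arr (mod_cat A) (scalar_map c x y) (M x) (M y)"
  unfolding scalar_map_def
proof (rule arr_mod_catI)
  fix u v assume uv: "tuple_le u v"
  have "u \<in> supp y \<Longrightarrow> v \<in> supp x \<Longrightarrow> u \<in> supp x \<and> v \<in> supp y"
    using uv assms(3) unfolding M_support_iff tuple_le_iff interlace_def os_iff
    by (smt (verit, ccfv_threshold) Suc_eq_plus1 Suc_leI less_imp_le order_trans)
  then show "mat (\<delta> y u) (\<delta> x u) (\<lambda>_. c) * act (M x) u v = act (M y) u v * mat (\<delta> y v) (\<delta> x v) (\<lambda>_. c)"
    by (auto simp: act_M_int mat_const_mult dimv_M_int intro!: eq_matI)
qed (use modules assms in \<open>auto simp: dimv_M_int\<close>)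

lemma scalar_map_comp:
  assumes "interlace d x y" "interlace d y z"
  shows "mod_cmp A (scalar_map c y z) (scalar_map c' x y) = scalar_map (c * c') x z"
  unfolding scalar_map_def
proof (intro restrict_ext)
  fix u assume u: "u \<in> Vert A"
  have "u \<in> supp x \<Longrightarrow> u \<in> supp z \<Longrightarrow> u \<in> supp y"
    using assms unfolding M_support_iff interlace_def
    by (smt (verit) Suc_eq_plus1 Suc_leI less_imp_le order_trans)
  then show "(\<lambda>u\<in>Vert A. mat (\<delta> z u) (\<delta> y u) (\<lambda>_. c)) u * (\<lambda>u\<in>Vert A. mat (\<delta> y u) (\<delta> x u) (\<lambda>_. c')) u =
      mat (\<delta> z u) (\<delta> x u) (\<lambda>_. c * c')"
    using u by (auto simp: mat_const_mult dimv_M_int intro!: eq_matI)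
qed

text \<open>Naturality along \<open>u \<le> top x\<close> and \<open>bottom y \<le> u\<close> shows that the scalar of \<open>h\<close> at \<open>u\<close> is the one at the top
  of \<open>x\<close> and the one at the bottom of \<open>y\<close>, and is zero unless both lie in the common support, which
  means that \<open>x\<close> and \<open>y\<close> are interlaced.\<close>
lemma arr_scalar:
  assumes x: "x \<in> J" and y: "y \<in> J" and h: "arr (mod_cat A) h (M x) (M y)"
  shows "\<exists>c. h = scalar_map c x y \<and> (interlace d x y \<or> c = 0)"
proof -
  define s where "s u = h u $$ (0, 0)" for u
  have nat: "(if u \<in> supp x then s u else 0) = (if v \<in> supp y then s v else 0)"
    if "u \<in> supp y" "v \<in> supp x" "tuple_le u v" for u v
  proof -
    have uv: "u \<in> Vert A" "v \<in> Vert A" using that supp_Vert by auto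
    have c: "h u \<in> carrier_mat 1 (\<delta> x u)" "h v \<in> carrier_mat (\<delta> y v) 1"
      using arr_carrier[OF h uv(1)] arr_carrier[OF h uv(2)] that by (auto simp: dimv_M_int)
    have "(h u * act (M x) u v) $$ (0, 0) = (act (M y) u v * h v) $$ (0, 0)"
      using arr_natural[OF h uv that(3)] by simp
    then show ?thesis
      using c that by (auto simp: act_M_int dimv_M_int scalar_prod_def s_def split: if_splits)
  qed
  have top: "tl x \<in> supp x" and bot: "butlast y \<in> supp y"
    using top_M_support bottom_M_support x y J by auto
  define c where "c = (if tl x \<in> supp y then s (tl x) else 0)"
  have sc: "s u = c" "s u = (if butlast y \<in> supp x then s (butlast y) else 0)"
    if u: "u \<in> supp x" "u \<in> supp y" for u
  proof -
    have "tuple_le u (tl x)"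
      using u(1) J_len[OF x] by (auto simp: tuple_le_iff M_support_iff os_iff nth_tl)
    then show "s u = c" using nat[of u "tl x"] u top by (simp add: c_def)
    have "tuple_le (butlast y) u"
      using u(2) J_len[OF y] by (auto simp: tuple_le_iff M_support_iff os_iff nth_butlast)
    then show "s u = (if butlast y \<in> supp x then s (butlast y) else 0)"
      using nat[of "butlast y" u] u bot by simp
  qed
  have hs: "h = scalar_map c x y"
    unfolding scalar_map_def
  proof (rule arr_eqI[OF h, symmetric])
    fix u assume u: "u \<in> Vert A"
    show "mat (\<delta> y u) (\<delta> x u) (\<lambda>_. c) = h u"
      using arr_carrier[OF h u] sc(1)[of u] by (auto simp: dimv_M_int s_def intro!: eq_matI split: if_splits)
  qed
  show ?thesis
  proof (cases "interlace d x y")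
    case False
    have "h = scalar_map 0 x y"
      unfolding scalar_map_def
    proof (rule arr_eqI[OF h, symmetric])
      fix u assume u: "u \<in> Vert A"
      have "s u = 0" if us: "u \<in> supp x" "u \<in> supp y"
      proof (rule ccontr)
        assume n: "s u \<noteq> 0"
        then have t: "tl x \<in> supp y" and b: "butlast y \<in> supp x"
          using sc[OF us] by (auto simp: c_def split: if_splits)
        have "x ! i \<le> y ! i" "y ! i \<le> x ! (i + 1)" if "i < d" for i
          using b J_len[OF y] that by (auto simp: M_support_iff nth_butlast)
        moreover have "x ! d \<le> y ! d"
          using t d J_len[OF x] by (auto simp: M_support_iff nth_tl dest!: spec[of _ "d - 1"])
        ultimately have "interlace d x y" unfolding interlace_def by (metis le_neq_implies_less)
        then show False using False by simp
      qed
      then show "mat (\<delta> y u) (\<delta> x u) (\<lambda>_. 0) = h u"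
        using arr_carrier[OF h u] by (auto simp: dimv_M_int s_def intro!: eq_matI split: if_splits)
    qed
    then show ?thesis by blast
  qed (use hs in blast)
qed

lemma hom_family_M:
  "hom_family (mod_cat A) (mod_cmp A) (mod_pls A) J M (interlace d) (scalar_map 1)"
proof unfold_locales
  show "M x \<in> Objs (mod_cat A)" if "x \<in> J" for x using modules that by simp
  show "h = Zero (mod_cat A) (M x) (M y)"
    if "x \<in> J" "y \<in> J" "\<not> interlace d x y" "arr (mod_cat A) h (M x) (M y)" for x y h
    using arr_scalar[OF that(1,2,4)] that(3) scalar_map_zero by metis
  show "arr (mod_cat A) (scalar_map 1 x y) (M x) (M y)" if "x \<in> J" "y \<in> J" "interlace d x y" for x y
    using arr_scalar_map that by blast
  show "scalar_map 1 x y \<noteq> Zero (mod_cat A) (M x) (M y)" if "x \<in> J" "y \<in> J" "interlace d x y" for x y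
    using scalar_map_inj[OF that, of 1 0] unfolding scalar_map_zero by auto
  fix x y z assume x: "x \<in> J" and y: "y \<in> J" and z: "z \<in> J" and xy: "interlace d x y" and yz: "interlace d y z"
    and xz: "interlace d x z"
  note cmp = scalar_map_comp[OF xy yz]
  show "\<exists>k. arr (mod_cat A) k (M x) (M y) \<and> h = mod_cmp A (scalar_map 1 y z) k"
    and "\<exists>k. arr (mod_cat A) k (M y) (M z) \<and> h = mod_cmp A k (scalar_map 1 x y)"
    if h: "arr (mod_cat A) h (M x) (M z)" for h
  proof -
    obtain c where c: "h = scalar_map c x z" using arr_scalar[OF x z h] by blast
    show "\<exists>k. arr (mod_cat A) k (M x) (M y) \<and> h = mod_cmp A (scalar_map 1 y z) k"
      using arr_scalar_map[OF x y xy, of c] cmp[of 1 c] c by auto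
    show "\<exists>k. arr (mod_cat A) k (M y) (M z) \<and> h = mod_cmp A k (scalar_map 1 x y)"
      using arr_scalar_map[OF y z yz, of c] cmp[of c 1] c by auto
  qed
  show "k = k'" if k: "arr (mod_cat A) k (M x) (M y)" "arr (mod_cat A) k' (M x) (M y)"
    "mod_cmp A (scalar_map 1 y z) k = mod_cmp A (scalar_map 1 y z) k'" for k k'
  proof -
    obtain c c' where c: "k = scalar_map c x y" "k' = scalar_map c' x y"
      using arr_scalar[OF x y k(1)] arr_scalar[OF x y k(2)] by blast
    then show ?thesis using k(3) cmp scalar_map_inj[OF x z xz] by auto
  qed
  show "k = k'" if k: "arr (mod_cat A) k (M y) (M z)" "arr (mod_cat A) k' (M y) (M z)"
    "mod_cmp A k (scalar_map 1 x y) = mod_cmp A k' (scalar_map 1 x y)" for k k'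
  proof -
    obtain c c' where c: "k = scalar_map c y z" "k' = scalar_map c' y z"
      using arr_scalar[OF y z k(1)] arr_scalar[OF y z k(2)] by blast
    then show ?thesis using k(3) cmp scalar_map_inj[OF x z xz] by auto
  qed
qed

lemma ks_category_M:
  assumes "I \<subseteq> J"
  shows "ks_category (mod_cat A) (mod_cmp A) (mod_pls A) (M ` I)"
proof unfold_locales
  show "\<exists>S. direct_sum (mod_cat A) X Y S" if "X \<in> Objs (mod_cat A)" "Y \<in> Objs (mod_cat A)" for X Y
    using mod_sums_exist that by auto
  show "\<exists>Z. zero_object (mod_cat A) Z" by (rule zero_module_exists)
  show "M ` I \<subseteq> Objs (mod_cat A)" using modules assms by auto
next
  fix X u assume X: "X \<in> M ` I" and u: "arr (mod_cat A) u X X"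
  then obtain x where x: "x \<in> J" "X = M x" using assms by blast
  have xx: "interlace d x x" using interlace_refl x J by blast
  obtain c where c: "u = scalar_map c x x" using arr_scalar[of x x u] u x by blast
  show "u = Zero (mod_cat A) X X \<or> (\<exists>v. arr (mod_cat A) v X X \<and> mod_cmp A v u = Idm (mod_cat A) X)"
  proof (cases "c = 0")
    case True then show ?thesis using c x scalar_map_zero by blast
  next
    case False
    then have "mod_cmp A (scalar_map (1 / c) x x) u = Idm (mod_cat A) X"
      unfolding c scalar_map_comp[OF xx xx] x(2) scalar_map_id[symmetric] by simp
    then show ?thesis using arr_scalar_map[OF x(1) x(1) xx] x by blast
  qed
next
  fix X Y a b assume "X \<in> M ` I" "arr (mod_cat A) a X Y" "arr (mod_cat A) b Y X"
    "mod_cmp A b a = Idm (mod_cat A) X"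
  then show "\<exists>Y' j q. biprod X Y' Y a j b q"
    using mod_split[of A a X Y b] by (auto simp: dimv_M_int)
qed

end

section \<open>Modules over higher Nakayama algebras\<close>

lemma Vert_idem_quotient [simp]: "Vert (idem_quotient A S) = Vert A"
  by (simp add: idem_quotient_def)

lemma ideal_gen_lin_hom:
  assumes "\<And>x y. Null A x y \<subseteq> lin_hom x y" "ideal_gen A S x y c"
  shows "c \<in> lin_hom x y"
  using assms(2)
proof (induction rule: ideal_gen.induct)
  case (base x y c) then show ?case using assms(1) by blast
next
  case (idem z) then show ?case by (simp add: lin_hom_def tuple_le_iff)
next
  case (sum x y a b) then show ?case by (auto simp: lin_hom_def split: if_splits)
next
  case (comp x y a w z b c)
  show ?case
  proof (cases "tuple_le w x \<and> tuple_le x y \<and> tuple_le y z")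
    case True
    then have "tuple_le w z" using tuple_le_trans by blast
    then show ?thesis by (simp add: lin_hom_def)
  next
    case False
    then have "c * a * b = 0" using comp by (auto simp: lin_hom_def)
    then show ?thesis by (simp add: lin_hom_def)
  qed
qed

lemma smult_smult_mat: "(a * b) \<cdot>\<^sub>m X = a \<cdot>\<^sub>m (b \<cdot>\<^sub>m (X :: 'k::field mat))"
  by (rule eq_matI) (simp_all add: mult.assoc)

lemma one_mat_eq_zero: "1\<^sub>m k = (0\<^sub>m k k :: 'k::field mat) \<Longrightarrow> k = 0"
proof (rule ccontr)
  assume e: "1\<^sub>m k = (0\<^sub>m k k :: 'k mat)" and k: "k \<noteq> 0"
  show False using k arg_cong[OF e, of "\<lambda>m. m $$ (0, 0)"] by simp
qed

text \<open>A generator of the ideal factors through a vertex at which the module vanishes.\<close>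
lemma ideal_gen_annihilates:
  assumes Null: "\<And>x y. Null A x y \<subseteq> lin_hom x y" and V: "is_module A V"
    and S: "\<And>z. z \<in> Vert A \<Longrightarrow> z \<in> S \<Longrightarrow> dimv V z = 0" and "ideal_gen A S x y c"
  shows "x \<in> Vert A \<and> y \<in> Vert A \<and> (tuple_le x y \<longrightarrow> c \<cdot>\<^sub>m act V x y = 0\<^sub>m (dimv V x) (dimv V y))"
  using assms(4)
proof (induction rule: ideal_gen.induct)
  case (base x y c) then show ?case using V by (auto simp: is_module_def)
next
  case (idem z)
  then show ?case using act_carrier[OF V, of z z] S[of z] by (auto intro!: eq_matI)
next
  case (sum x y a b)
  then show ?case using act_carrier[OF V, of x y] add_smult_distrib_right_mat[of "act V x y"] by auto
next
  case (comp x y a w z b c)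
  show ?case
  proof (intro conjI impI)
    assume wz: "tuple_le w z"
    show "c * a * b \<cdot>\<^sub>m act V w z = 0\<^sub>m (dimv V w) (dimv V z)"
    proof (cases "c * a * b = 0")
      case True
      then show ?thesis using act_carrier[OF V comp(2,3) wz] by (auto intro!: eq_matI)
    next
      case False
      then have "tuple_le w x" "tuple_le y z" "tuple_le x y"
        using comp ideal_gen_lin_hom[OF Null comp(1)] by (auto simp: lin_hom_def split: if_splits)
      note le = this
      have xy: "x \<in> Vert A" "y \<in> Vert A" "a \<cdot>\<^sub>m act V x y = 0\<^sub>m (dimv V x) (dimv V y)"
        using comp.IH le by auto
      note cc = act_carrier[OF V comp(2) xy(1) le(1)] act_carrier[OF V xy(1,2) le(3)] act_carrier[OF V xy(2) comp(3) le(2)]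
      have "act V w z = act V w x * act V x z" "act V x z = act V x y * act V y z"
        using V comp(2,3) xy(1,2) le tuple_le_trans[OF le(3,2)] unfolding is_module_def by blast+
      then have "c * a * b \<cdot>\<^sub>m act V w z = (c * b * a) \<cdot>\<^sub>m (act V w x * (act V x y * act V y z))"
        by (simp add: ac_simps)
      also have "\<dots> = (c * b) \<cdot>\<^sub>m (act V w x * ((a \<cdot>\<^sub>m act V x y) * act V y z))"
        using mult_smult_distrib[OF cc(1) mult_carrier_mat[OF cc(2,3)]] mult_smult_assoc_mat[OF cc(2,3)]
        by (simp add: smult_smult_mat)
      also have "\<dots> = 0\<^sub>m (dimv V w) (dimv V z)"
        unfolding xy(3) using cc(1,3) by (auto intro!: eq_matI)
      finally show ?thesis .
    qed
  qed (use comp in auto)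
qed

lemma is_module_idem_quotient:
  assumes Null: "\<And>x y. Null A x y \<subseteq> lin_hom x y"
  shows "is_module (idem_quotient A S) V \<longleftrightarrow> is_module A V \<and> (\<forall>z\<in>Vert A \<inter> S. dimv V z = 0)"
proof
  assume V: "is_module (idem_quotient A S) V"
  have N: "c \<cdot>\<^sub>m act V x y = 0\<^sub>m (dimv V x) (dimv V y)"
    if "x \<in> Vert A" "y \<in> Vert A" "tuple_le x y" "ideal_gen A S x y c" for x y c
    using V that by (auto simp: is_module_def idem_quotient_def)
  have "is_module A V"
    unfolding is_module_def
  proof (intro conjI)
    show "\<forall>x\<in>Vert A. \<forall>y\<in>Vert A. tuple_le x y \<longrightarrow>
        (\<forall>c\<in>Null A x y. c \<cdot>\<^sub>m act V x y = 0\<^sub>m (dimv V x) (dimv V y))"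
      using N ideal_gen.base[of _ A] by blast
  qed (use V[unfolded is_module_def Vert_idem_quotient] in blast)+
  moreover have "dimv V z = 0" if z: "z \<in> Vert A \<inter> S" for z
  proof -
    have "act V z z = 1\<^sub>m (dimv V z)" using V z by (auto simp: is_module_def)
    moreover have "1 \<cdot>\<^sub>m act V z z = 0\<^sub>m (dimv V z) (dimv V z)"
      using N[of z z 1] z ideal_gen.idem[of z A S] by (auto simp: tuple_le_iff)
    moreover have "1 \<cdot>\<^sub>m 1\<^sub>m (dimv V z) = (1\<^sub>m (dimv V z) :: 'a mat)" by (auto intro!: eq_matI)
    ultimately show ?thesis using one_mat_eq_zero by metis
  qed
  ultimately show "is_module A V \<and> (\<forall>z\<in>Vert A \<inter> S. dimv V z = 0)" by blast
next
  assume V: "is_module A V \<and> (\<forall>z\<in>Vert A \<inter> S. dimv V z = 0)"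
  then have V': "is_module A V" "\<And>z. z \<in> Vert A \<Longrightarrow> z \<in> S \<Longrightarrow> dimv V z = 0" by auto
  show "is_module (idem_quotient A S) V"
    unfolding is_module_def Vert_idem_quotient
  proof (intro conjI)
    show "\<forall>x\<in>Vert A. \<forall>y\<in>Vert A. tuple_le x y \<longrightarrow>
        (\<forall>c\<in>Null (idem_quotient A S) x y. c \<cdot>\<^sub>m act V x y = 0\<^sub>m (dimv V x) (dimv V y))"
      using ideal_gen_annihilates[OF Null V'] by (simp add: idem_quotient_def)
  qed (use V'(1)[unfolded is_module_def] in blast)+
qed

lemma Null_idem_quotient:
  "(\<And>x y. Null A x y \<subseteq> lin_hom x y) \<Longrightarrow> Null (idem_quotient A S) x y \<subseteq> lin_hom x y"
  using ideal_gen_lin_hom[of A S] by (auto simp: idem_quotient_def)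

lemma Vert_algebras [simp]:
  "Vert (auslander_alg n d) = grid n d" "Vert (nakayama_alg \<ll> d) = grid (length \<ll>) d"
  by (simp_all add: auslander_alg_def nakayama_alg_def grid_cat_def)

lemma Null_grid: "Null (grid_cat n d) x y \<subseteq> lin_hom x y"
  by (simp add: grid_cat_def lin_hom_def)

lemma is_module_auslander:
  fixes V :: "'k::field rep"
  shows "is_module (auslander_alg n d) V \<longleftrightarrow> is_module (grid_cat n d) V \<and> (\<forall>z\<in>grid n d - os n d. dimv V z = 0)"
proof -
  have "Vert (grid_cat n d :: 'k bound_cat) \<inter> (grid n d - os n d) = grid n d - os n d" by (auto simp: grid_cat_def)
  then show ?thesis
    unfolding auslander_alg_def is_module_idem_quotient[OF Null_grid] by simp
qed

lemma is_module_nakayama: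
  fixes V :: "'k::field rep"
  shows "is_module (nakayama_alg \<ll> d) V \<longleftrightarrow> is_module (auslander_alg (length \<ll>) d) V \<and>
     (\<forall>z\<in>os (length \<ll>) d - os_kup \<ll> d. dimv V z = 0)"
proof -
  have "Null (auslander_alg n d :: 'k bound_cat) x y \<subseteq> lin_hom x y" for n d x y
    unfolding auslander_alg_def using Null_idem_quotient[OF Null_grid] .
  moreover have "Vert (auslander_alg (length \<ll>) d :: 'k bound_cat) \<inter> (os (length \<ll>) d - os_kup \<ll> d) = os (length \<ll>) d - os_kup \<ll> d"
    by (auto simp: os_def)
  ultimately show ?thesis
    unfolding nakayama_alg_def by (subst is_module_idem_quotient) auto
qed

lemma is_module_auslander_M_int: "is_module (auslander_alg n d) (M_int n d x)"
proof -
  have "is_module (grid_cat n d) (M_int n d x)"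
    by (rule is_module_M_int) (auto simp: grid_cat_def)
  then show ?thesis
    by (auto simp: is_module_auslander dimv_M_int M_support_iff)
qed

lemma is_module_nakayama_M_int:
  "is_module (nakayama_alg \<ll> d) (M_int (length \<ll>) d x) \<longleftrightarrow> M_support (length \<ll>) d x \<subseteq> os_kup \<ll> d"
proof -
  have "M_support (length \<ll>) d x \<subseteq> os (length \<ll>) d" by (auto simp: M_support_iff)
  then show ?thesis
    by (auto simp: is_module_nakayama is_module_auslander_M_int dimv_M_int)
qed

lemma retract_dimv:
  assumes "arr (mod_cat A) i X S" "arr (mod_cat A) p S X" "mod_cmp A p i = Idm (mod_cat A) X"
    and z: "z \<in> Vert A" "dimv S z = 0"
  shows "dimv X z = 0"
proof -
  have "p z * i z = 1\<^sub>m (dimv X z)" using fun_cong[OF assms(3), of z] z by simp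
  moreover have "p z * i z = 0\<^sub>m (dimv X z) (dimv X z)"
    using arr_carrier[OF assms(1) z(1)] arr_carrier[OF assms(2) z(1)] z(2)
    by (auto intro!: eq_matI simp: scalar_prod_def)
  ultimately have "1\<^sub>m (dimv X z) = (0\<^sub>m (dimv X z) (dimv X z) :: 'a mat)" by simp
  then show ?thesis by (rule one_mat_eq_zero)
qed

text \<open>The bound \<open>\<ll>\<^sub>i \<le> \<ll>\<^sub>i\<^sub>-\<^sub>1 + 1\<close> says that \<open>i - \<ll>\<^sub>i\<close> is non-decreasing. It follows that membership in \<open>J\<close> depends on
  the two ends of a non-decreasing tuple only and is preserved when they move towards each other.\<close>
locale kupisch_series =
  fixes n d :: nat and \<ll> :: "nat list"
  assumes kup: "kupisch n \<ll>" and d2: "d \<ge> 2"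
begin

lemma len: "length \<ll> = n" using kup by (simp add: kupisch_def)

abbreviation J :: "nat list set" where "J \<equiv> os_kup \<ll> (Suc d)"

lemma kup_mono: "i \<le> j \<Longrightarrow> j < n \<Longrightarrow> \<ll> ! j + i \<le> \<ll> ! i + j"
proof (induction j rule: dec_induct)
  case (step j)
  have "\<ll> ! (Suc j) \<le> \<ll> ! j + 1" using kup step by (auto simp: kupisch_def)
  then show ?case using step by simp
qed simp

lemma os_kup_iff:
  assumes "m \<ge> 1"
  shows "x \<in> os_kup \<ll> m \<longleftrightarrow> x \<in> os n m \<and> x ! (m - 1) + 1 \<le> \<ll> ! (x ! (m - 1)) + x ! 0"
proof -
  have "x \<in> os n m \<Longrightarrow> x ! 0 \<le> x ! (m - 1)" using assms os_nth_mono[of x n m 0 "m - 1"] by simp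
  then show ?thesis by (auto simp: os_kup_def len)
qed

lemma J_iff:
  "x \<in> J \<longleftrightarrow> length x = d + 1 \<and> x ! d < n \<and> (\<forall>i<d. x ! i \<le> x ! (i + 1)) \<and> x ! d + 1 \<le> \<ll> ! (x ! d) + x ! 0"
proof -
  have "x ! i < n" if "\<forall>i<d. x ! i \<le> x ! (i + 1)" "x ! d < n" "i < d + 1" for i
  proof -
    have "i \<le> d" using that by simp
    then show ?thesis
    proof (induction i rule: inc_induct)
      case (step m) then show ?case using that(1)[rule_format, of m] by auto
    qed (use that in simp)
  qed
  then show ?thesis using os_kup_iff[of "d + 1" x] by (auto simp: os_iff)
qed

lemma J_len: "x \<in> J \<Longrightarrow> length x = d + 1" by (simp add: J_iff)

lemma J_step: "x \<in> J \<Longrightarrow> i < d \<Longrightarrow> x ! i \<le> x ! (i + 1)" by (simp add: J_iff)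

lemma J_os: "J \<subseteq> os n (d + 1)" using os_kup_iff[of "d + 1"] by auto

lemma J_shrink:
  assumes x: "x \<in> J" and y: "length y = d + 1" "\<And>i. i < d \<Longrightarrow> y ! i \<le> y ! (i + 1)"
    and "x ! 0 \<le> y ! 0" "y ! d \<le> x ! d"
  shows "y \<in> J"
proof -
  have "\<ll> ! (x ! d) + y ! d \<le> \<ll> ! (y ! d) + x ! d" using kup_mono assms by (simp add: J_iff)
  then show ?thesis using assms by (auto simp: J_iff)
qed

text \<open>The worst tuple in the support has ends \<open>x\<^sub>0\<close> and \<open>x\<^sub>d\<close>; since \<open>d \<ge> 2\<close>, these can be attained simultaneously.\<close>
lemma supp_kup_iff:
  assumes x: "x \<in> os n (d + 1)"
  shows "M_support n d x \<subseteq> os_kup \<ll> d \<longleftrightarrow> x \<in> J"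
proof
  have xs: "length x = d + 1" "\<And>i. i < d \<Longrightarrow> x ! i \<le> x ! (i + 1)" "\<And>i. i \<le> d \<Longrightarrow> x ! i < n"
    using x by (auto simp: os_iff)
  assume s: "M_support n d x \<subseteq> os_kup \<ll> d"
  \<comment> \<open>The largest tuple of the support, with its first entry lowered.\<close>
  define y where "y = x ! 0 # drop 2 x"
  have y: "y ! 0 = x ! 0" "\<And>i. 1 \<le> i \<Longrightarrow> i < d \<Longrightarrow> y ! i = x ! (i + 1)" "length y = d"
    using xs d2 by (auto simp: y_def nth_Cons')
  have "y \<in> M_support n d x"
    unfolding M_support_iff os_iff
  proof (intro conjI allI impI y(3))
    fix i assume i: "i < d"
    show "x ! i \<le> y ! i" "y ! i \<le> x ! (i + 1)" "y ! i < n"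
      using y i xs(2)[of i] xs(3)[of i] xs(3)[of "i + 1"] by (cases "i = 0"; simp)+
  next
    fix i assume i: "i + 1 < d"
    show "y ! i \<le> y ! (i + 1)"
      using y i xs(2)[of i] xs(2)[of "i + 1"] by (cases "i = 0") auto
  qed
  then have "y \<in> os_kup \<ll> d" using s by blast
  then have "x ! d + 1 \<le> \<ll> ! (x ! d) + x ! 0"
    using os_kup_iff[of d y] y(1) y(2)[of "d - 1"] d2 by simp
  then show "x \<in> J" using x os_kup_iff[of "d + 1" x] by simp
next
  assume xJ: "x \<in> J"
  show "M_support n d x \<subseteq> os_kup \<ll> d"
  proof
    fix y assume y: "y \<in> M_support n d x"
    have b: "x ! 0 \<le> y ! 0" "y ! (d - 1) \<le> x ! d"
      using y d2 by (auto simp: M_support_iff dest!: spec[of _ "d - 1"])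
    have "x ! d < n" using xJ by (simp add: J_iff)
    then have "\<ll> ! (x ! d) + y ! (d - 1) \<le> \<ll> ! (y ! (d - 1)) + x ! d" using kup_mono b by simp
    then have "y ! (d - 1) + 1 \<le> \<ll> ! (y ! (d - 1)) + y ! 0" using xJ b by (simp add: J_iff)
    then show "y \<in> os_kup \<ll> d"
      using xJ y b d2 os_kup_iff[of d y] by (auto simp: J_iff M_support_iff)
  qed
qed

lemma interval_modules_nakayama: "interval_modules (nakayama_alg \<ll> d) n d J"
proof
  show "is_module (nakayama_alg \<ll> d) (M_int n d x)" if "x \<in> J" for x
    using that J_os supp_kup_iff[of x] is_module_nakayama_M_int[of \<ll> d x, unfolded len] by auto
qed (use J_os d2 in \<open>auto simp: len\<close>)

lemma interval_modules_auslander: "interval_modules (auslander_alg n d) n d (os n (d + 1))"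
  by unfold_locales (use d2 is_module_auslander_M_int in auto)

text \<open>An \<open>A\<^sub>n\<^sup>d\<close>-module in the subcategory is a direct sum of interval modules by Krull-Schmidt, and it is a
  module over the quotient if and only if all its summands are.\<close>
lemma nakayama_M_eq:
  "nakayama_M \<ll> d = (dsums (mod_cat (nakayama_alg \<ll> d)) (M_int n d ` J) :: 'k::field rep set)"
proof -
  let ?A = "auslander_alg n d :: 'k bound_cat" and ?N = "nakayama_alg \<ll> d :: 'k bound_cat"
  interpret aus: interval_modules ?A n d "os n (d + 1)" by (rule interval_modules_auslander)
  interpret ks: ks_category "mod_cat ?A" "mod_cmp ?A" "mod_pls ?A" "M_int n d ` os n (d + 1)"
    by (rule aus.ks_category_M) simp
  have VN: "Vert ?N = Vert ?A" by (simp add: len)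
  have sum: "direct_sum (mod_cat ?N) X Y S \<longleftrightarrow> direct_sum (mod_cat ?A) X Y S \<and>
     is_module ?N X \<and> is_module ?N Y \<and> is_module ?N S" for X Y S
    unfolding direct_sum_def mod_cat_def rep_hom_def VN by (auto simp: is_module_nakayama len)
  have zero: "zero_object (mod_cat ?N) X \<longleftrightarrow> zero_object (mod_cat ?A) X \<and> is_module ?N X" for X
    unfolding zero_object_def mod_cat_simps VN by (auto simp: is_module_nakayama len)
  have aM: "auslander_M (length \<ll>) d = dsums (mod_cat ?A) (M_int n d ` os n (d + 1))"
    unfolding auslander_M_def len by (rule ks.add_closure_eq_dsums)
  \<comment> \<open>A summand vanishes wherever the whole module does, so the decomposition stays over the quotient.\<close>
  have 1: "is_module ?N X \<Longrightarrow> X \<in> dsums (mod_cat ?N) (M_int n d ` J)"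
    if "X \<in> dsums (mod_cat ?A) (M_int n d ` os n (d + 1))" for X
    using that
  proof (induction rule: dsums.induct)
    case (dsums_zero Z) then show ?case using zero by (auto intro: dsums.dsums_zero)
  next
    case (dsums_add X Y S)
    obtain i j p q where b: "aus.biprod X Y S i j p q" using dsums_add(3) aus.direct_sum_iff by blast
    have XY: "dimv X z = 0" "dimv Y z = 0" if "z \<in> os n d - os_kup \<ll> d" for z
    proof -
      have "z \<in> Vert ?A" "dimv S z = 0"
        using that dsums_add.prems by (auto simp: is_module_nakayama len os_def)
      then show "dimv X z = 0" "dimv Y z = 0"
        using b[unfolded aus.biprod_def] retract_dimv by blast+
    qed
    have "is_module ?N X" "is_module ?N Y"
      using b XY unfolding aus.biprod_def arr_def is_module_nakayama len by auto
    moreover obtain x where x: "x \<in> os n (d + 1)" "X = M_int n d x" using dsums_add by blast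
    ultimately have "x \<in> J" using supp_kup_iff is_module_nakayama_M_int len by metis
    then have "X \<in> M_int n d ` J" using x by blast
    moreover have "direct_sum (mod_cat ?N) X Y S"
      using sum dsums_add.hyps(3) dsums_add.prems \<open>is_module ?N X\<close> \<open>is_module ?N Y\<close> by blast
    ultimately show ?case using dsums_add.IH[OF \<open>is_module ?N Y\<close>] by (blast intro: dsums.dsums_add)
  qed
  have 2: "X \<in> dsums (mod_cat ?A) (M_int n d ` os n (d + 1)) \<and> is_module ?N X"
    if "X \<in> dsums (mod_cat ?N) (M_int n d ` J)" for X
    using that
  proof (induction rule: dsums.induct)
    case (dsums_zero Z) then show ?case using zero by (auto intro: dsums.dsums_zero)
  next
    case (dsums_add X Y S)
    then have "X \<in> M_int n d ` os n (d + 1)" using J_os by blast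
    then show ?case using dsums_add sum by (blast intro: dsums.dsums_add)
  qed
  show ?thesis unfolding nakayama_M_def aM using 1 2 by auto
qed

end

section \<open>An explicit sequence\<close>

context kupisch_series
begin

text \<open>The first \<open>k\<close> coordinates of \<open>x\<close> followed by the last ones of \<open>z = (x\<^sub>1 + 1, \<dots>, x\<^sub>d + 1, t)\<close>. Among all tuples
  with entries in \<open>{x\<^sub>i, z\<^sub>i}\<close> these are the non-decreasing ones, because \<open>z\<^sub>i > x\<^sub>i\<^sub>+\<^sub>1\<close>.\<close>
definition stair :: "nat list \<Rightarrow> nat \<Rightarrow> nat \<Rightarrow> nat list" where
  "stair x t k = take k x @ drop k (map Suc (tl x) @ [t])"

lemma length_stair: "length x = d + 1 \<Longrightarrow> k \<le> d + 1 \<Longrightarrow> length (stair x t k) = d + 1"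
  by (simp add: stair_def)

lemma nth_stair:
  assumes "length x = d + 1" "k \<le> d + 1" "i \<le> d"
  shows "stair x t k ! i = (if i < k then x ! i else if i < d then Suc (x ! (i + 1)) else t)"
  using assms by (auto simp: stair_def nth_append nth_tl)

lemma stair_Suc_d: "length x = d + 1 \<Longrightarrow> stair x t (d + 1) = x"
  by (simp add: stair_def)

lemma stair_d: "length x = d + 1 \<Longrightarrow> stair x t d = butlast x @ [t]"
  by (simp add: stair_def butlast_conv_take)

lemma stair_J:
  assumes x: "x \<in> J" and t: "x ! d < t" and xt: "butlast x @ [t] \<in> J" and k: "k \<le> d + 1"
  shows "stair x t k \<in> J"
proof (cases "k = d + 1")
  case True then show ?thesis using x stair_Suc_d J_len by simp
next
  case False
  have len: "length x = d + 1" and d: "stair x t d \<in> J" using J_len[OF x] xt stair_d by auto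
  note n = nth_stair[OF len]
  show ?thesis
  proof (rule J_shrink[OF d])
    show "length (stair x t k) = d + 1" using length_stair len k by simp
    show "stair x t d ! 0 \<le> stair x t k ! 0" "stair x t k ! d \<le> stair x t d ! d"
      using n[of d 0] n[of k 0] n[of d d] n[of k d] False k d2 J_step[OF x, of 0] by (auto split: if_splits)
    show "stair x t k ! i \<le> stair x t k ! (i + 1)" if i: "i < d" for i
      using n[OF k, of i] n[OF k, of "i + 1"] i False k t J_step[OF x i] J_step[OF x, of "i + 1"]
      by (cases "Suc i = d") (auto split: if_splits)
  qed
qed

lemma interlace_stair_step:
  assumes x: "x \<in> J" and t: "x ! d < t" and k: "k \<le> d"
  shows "interlace d (stair x t (k + 1)) (stair x t k)"
  unfolding interlace_def
proof (intro conjI allI impI)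
  have len: "length x = d + 1" using J_len[OF x] .
  note n = nth_stair[OF len]
  fix i
  show "stair x t (k + 1) ! i \<le> stair x t k ! i" if i: "i \<le> d"
    using n[of "k + 1" i] n[of k i] i k t J_step[OF x, of i] by (cases "i = d") auto
  show "stair x t k ! i \<le> stair x t (k + 1) ! (i + 1)" if i: "i < d"
    using n[of k i] n[of "k + 1" "i + 1"] i k t J_step[OF x, of i] J_step[OF x, of "i + 1"]
    by (cases "i + 1 = d") auto
qed

text \<open>Neighbours of the \<open>k\<close>-th tuple differ from it in one coordinate each, and the two conditions that decide
  are \<open>w\<^sub>k \<le> x\<^sub>k\<close> and \<open>x\<^sub>k + 1 \<le> w\<^sub>k\<close>, which are complementary.\<close>
lemma interlace_to_stair:
  assumes x: "x \<in> J" and t: "x ! d < t" and k: "1 \<le> k" "k \<le> d" and w: "interlace d w (stair x t k)"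
  shows "interlace d w (stair x t (k + 1)) \<longleftrightarrow> \<not> interlace d w (stair x t (k - 1))"
proof -
  have len: "length x = d + 1" using J_len[OF x] .
  note n = nth_stair[OF len]
  have kd: "k - 1 < d" "Suc (k - 1) = k" using k by auto
  have w1: "w ! i \<le> stair x t k ! i" if "i \<le> d" for i using w that by (simp add: interlace_def)
  have w2: "stair x t k ! i \<le> w ! (i + 1)" if "i < d" for i using w that by (simp add: interlace_def)
  have up: "stair x t (k + 1) ! i = (if i = k then x ! k else stair x t k ! i)" if "i \<le> d" for i
    using n[of "k + 1" i] n[of k i] that k by auto
  have down: "stair x t (k - 1) ! i = (if i = k - 1 then Suc (x ! k) else stair x t k ! i)" if "i \<le> d" for i
    using n[of "k - 1" i] n[of k i] that k by auto
  show ?thesis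
  proof (cases "w ! k \<le> x ! k")
    case True
    have "x ! k \<le> stair x t k ! k" using n[of k k] k t J_step[OF x, of k] by auto
    then have "interlace d w (stair x t (k + 1))"
      unfolding interlace_def using up w1 w2 True k by (auto split: if_splits intro: order_trans)
    moreover have "\<not> interlace d w (stair x t (k - 1))"
      unfolding interlace_def using down[of "k - 1"] True k by (auto dest!: spec[of _ "k - 1"])
    ultimately show ?thesis by blast
  next
    case False
    have "w ! (k - 1) \<le> x ! (k - 1)" using w1[of "k - 1"] n[of k "k - 1"] k by auto
    then have "w ! (k - 1) \<le> Suc (x ! k)" using J_step[OF x, of "k - 1"] k kd by auto
    then have "interlace d w (stair x t (k - 1))"
      unfolding interlace_def using down w1 w2 False k by (auto split: if_splits)
    moreover have "\<not> interlace d w (stair x t (k + 1))"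
      unfolding interlace_def using up[of k] False k by auto
    ultimately show ?thesis by blast
  qed
qed

lemma interlace_to_stair_top:
  assumes x: "x \<in> J" and t: "x ! d < t" and w: "interlace d w (stair x t (d + 1))"
  shows "interlace d w (stair x t d)"
proof -
  have len: "length x = d + 1" using J_len[OF x] .
  have "stair x t (d + 1) ! i = (if i = d then x ! d else stair x t d ! i)" if "i \<le> d" for i
    using nth_stair[OF len, of d i] nth_stair[OF len, of "d + 1" i] that by auto
  moreover have "stair x t d ! d = t" using nth_stair[OF len, of d d] by simp
  ultimately show ?thesis
    using w t unfolding interlace_def by (metis le_neq_implies_less less_imp_le nat_less_le order_trans)
qed

text \<open>Here the complementary conditions are \<open>w\<^sub>k\<^sub>-\<^sub>1 \<le> x\<^sub>k\<close> and \<open>x\<^sub>k + 1 \<le> w\<^sub>k\<^sub>-\<^sub>1\<close>.\<close>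
lemma interlace_from_stair:
  assumes x: "x \<in> J" and t: "x ! d < t" and k: "1 \<le> k" "k \<le> d" and w: "interlace d (stair x t k) w"
  shows "interlace d (stair x t (k - 1)) w \<longleftrightarrow> \<not> interlace d (stair x t (k + 1)) w"
proof -
  have len: "length x = d + 1" using J_len[OF x] .
  note n = nth_stair[OF len]
  have kd: "k - 1 < d" "Suc (k - 1) = k" using k by auto
  have w1: "stair x t k ! i \<le> w ! i" if "i \<le> d" for i using w that by (simp add: interlace_def)
  have w2: "w ! i \<le> stair x t k ! (i + 1)" if "i < d" for i using w that by (simp add: interlace_def)
  have up: "stair x t (k + 1) ! i = (if i = k then x ! k else stair x t k ! i)" if "i \<le> d" for i
    using n[of "k + 1" i] n[of k i] that k by auto
  have down: "stair x t (k - 1) ! i = (if i = k - 1 then Suc (x ! k) else stair x t k ! i)" if "i \<le> d" for i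
    using n[of "k - 1" i] n[of k i] that k by auto
  show ?thesis
  proof (cases "w ! (k - 1) \<le> x ! k")
    case True
    have "x ! k \<le> stair x t k ! k" using n[of k k] k t J_step[OF x, of k] by auto
    then have "x ! k \<le> w ! k" using w1[of k] k by simp
    then have "interlace d (stair x t (k + 1)) w"
      unfolding interlace_def using up w1 w2 True k by (auto split: if_splits)
    moreover have "\<not> interlace d (stair x t (k - 1)) w"
      unfolding interlace_def using down[of "k - 1"] True kd by (auto intro!: exI[of _ "k - 1"])
    ultimately show ?thesis by blast
  next
    case False
    have "x ! (k - 1) \<le> x ! k" using J_step[OF x kd(1)] kd(2) by simp
    moreover have "w ! i \<le> x ! (k - 1)" if "i + 1 = k - 1" for i
      using w2[of i] n[of k "k - 1"] that k kd by simp
    ultimately have "w ! i \<le> Suc (x ! k)" if "i + 1 = k - 1" for i using that le_SucI order_trans by metis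
    then have "interlace d (stair x t (k - 1)) w"
      unfolding interlace_def using down w1 w2 False k by (auto split: if_splits)
    moreover have "\<not> interlace d (stair x t (k + 1)) w"
      unfolding interlace_def using up[of k] False k by (auto dest!: spec[of _ "k - 1"])
    ultimately show ?thesis by blast
  qed
qed

lemma interlace_from_stair_bottom:
  assumes x: "x \<in> J" and w: "interlace d (stair x t 0) w"
  shows "interlace d (stair x t 1) w"
proof -
  have len: "length x = d + 1" using J_len[OF x] .
  have e: "stair x t 1 ! i = (if i = 0 then x ! 0 else stair x t 0 ! i)" if "i \<le> d" for i
    using nth_stair[OF len, of 0 i] nth_stair[OF len, of 1 i] that d2 by auto
  have "x ! 0 \<le> stair x t 0 ! 0" using nth_stair[OF len, of 0 0] d2 J_step[OF x, of 0] by auto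
  moreover have "stair x t 0 ! 0 \<le> w ! 0" using w by (simp add: interlace_def)
  ultimately show ?thesis using w e unfolding interlace_def by auto
qed

end

section \<open>Torsion classes\<close>

locale index_set = kupisch_series +
  fixes I :: "nat list set"
  assumes IJ: "I \<subseteq> J"
begin

definition upper_closed :: bool where
  "upper_closed \<longleftrightarrow> (\<forall>x\<in>J. \<forall>z\<in>J. tuple_le x z \<and> x ! d = z ! d \<longrightarrow> x \<in> I \<longrightarrow> z \<in> I)"

text \<open>The relation \<open>x \<leadsto> \<tau>\<^sub>d(z)\<close>, for tuples of natural numbers.\<close>
definition strictly_interlaced :: "nat list \<Rightarrow> nat list \<Rightarrow> bool" where
  "strictly_interlaced x z \<longleftrightarrow> (\<forall>i\<le>d. x ! i < z ! i) \<and> (\<forall>i<d. z ! i \<le> Suc (x ! (i + 1)))"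

definition mixing_closed :: bool where
  "mixing_closed \<longleftrightarrow> (\<forall>x\<in>I. \<forall>z\<in>I. strictly_interlaced x z \<longrightarrow>
     (\<forall>y\<in>J. (\<forall>i\<le>d. y ! i \<in> {x ! i, z ! i}) \<longrightarrow> y \<in> I))"

lemma squig_tau_iff:
  assumes "length x = d + 1" "length z = d + 1"
  shows "squig (map int x) (tau (map int z)) \<longleftrightarrow> strictly_interlaced x z"
proof -
  have "squig (map int x) (tau (map int z)) \<longleftrightarrow>
     (\<forall>i\<le>d. int (x ! i) \<le> int (z ! i) - 1) \<and> (\<forall>i<d. int (z ! i) - 1 \<le> int (x ! (i + 1)))"
    using assms by (auto simp: squig_def tau_def less_Suc_eq_le)
  also have "\<dots> \<longleftrightarrow> strictly_interlaced x z"
    unfolding strictly_interlaced_def by (intro conj_cong all_cong1 imp_cong refl) linarith+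
  finally show ?thesis .
qed

text \<open>The maximum of \<open>reach y\<close> is the last coordinate of the torsion subobject of \<open>M\<^sub>y\<close>, which has the other
  coordinates in common with \<open>y\<close>.\<close>
definition reach :: "nat list \<Rightarrow> nat set" where
  "reach y = {u ! d | u. u \<in> I \<and> interlace d u y}"

lemma finite_reach: "finite (reach y)"
  by (rule finite_subset[of _ "{..y ! d}"]) (auto simp: reach_def interlace_def)

lemma butlast_append_J:
  assumes y: "y \<in> J" and c: "y ! (d - 1) \<le> c" "c \<le> y ! d"
  shows "butlast y @ [c] \<in> J"
proof (rule J_shrink[OF y])
  have len: "length y = d + 1" using J_len[OF y] .
  show "length (butlast y @ [c]) = d + 1" using len by simp
  show "y ! 0 \<le> (butlast y @ [c]) ! 0" "(butlast y @ [c]) ! d \<le> y ! d"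
    using len d2 c by (auto simp: nth_append nth_butlast)
  show "(butlast y @ [c]) ! i \<le> (butlast y @ [c]) ! (i + 1)" if i: "i < d" for i
  proof (cases "i + 1 = d")
    case True then show ?thesis using len c i by (auto simp: nth_append nth_butlast)
  next
    case False then show ?thesis using len i J_step[OF y i] by (auto simp: nth_append nth_butlast)
  qed
qed

lemma nth_butlast_append:
  assumes "y \<in> J" "i \<le> d"
  shows "(butlast y @ [c]) ! i = (if i < d then y ! i else c)"
  using assms J_len[OF assms(1)] by (auto simp: nth_append nth_butlast)

lemma butlast_append_last: "y \<in> J \<Longrightarrow> butlast y @ [y ! d] = y"
  using J_len by (metis append_butlast_last_id last_conv_nth length_0_conv add_diff_cancel_right' add_is_0 one_neq_zero)

lemma reach_attained:
  assumes up: "upper_closed" and y: "y \<in> J" and c: "c \<in> reach y"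
  shows "butlast y @ [c] \<in> I" "c \<le> y ! d"
proof -
  obtain u where u: "u \<in> I" "interlace d u y" "c = u ! d" using c by (auto simp: reach_def)
  have uJ: "u \<in> J" using u IJ by blast
  have "y ! (d - 1) \<le> u ! d" using u(2) d2 by (auto simp: interlace_def dest!: spec[of _ "d - 1"])
  moreover show cy: "c \<le> y ! d" using u by (simp add: interlace_def)
  ultimately have yJ: "butlast y @ [c] \<in> J" using butlast_append_J[OF y] u(3) by simp
  have "tuple_le u (butlast y @ [c])"
    unfolding tuple_le_iff using J_len[OF uJ] J_len[OF yJ] nth_butlast_append[OF y] u
    by (auto simp: interlace_def less_Suc_eq)
  moreover have "u ! d = (butlast y @ [c]) ! d" using nth_butlast_append[OF y] u by simp
  ultimately show "butlast y @ [c] \<in> I" using up uJ yJ u(1) unfolding upper_closed_def by blast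
qed

end

locale torsion_setup = index_set n d \<ll> I + hom_family C cmp pls "os_kup \<ll> (Suc d)" Mo "interlace d" b
  for n d :: nat and \<ll> :: "nat list" and I :: "nat list set"
    and C :: "('o, 'm) precat" and cmp (infixr "\<star>" 70) and pls (infixl "\<uplus>" 65)
    and Mo :: "nat list \<Rightarrow> 'o" and b :: "nat list \<Rightarrow> nat list \<Rightarrow> 'm" +
  assumes ks: "K \<subseteq> os_kup \<ll> (Suc d) \<Longrightarrow> ks_category C cmp pls (Mo ` K)"
begin

abbreviation MM :: "'o set" where "MM \<equiv> dsums C (Mo ` J)"
abbreviation UU :: "'o set" where "UU \<equiv> dsums C (Mo ` I)"

lemma Mo_MM: "x \<in> J \<Longrightarrow> Mo x \<in> MM"
  using ks_category.B_dsums[OF ks[of J]] by blast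

lemma Mo_UU: "x \<in> I \<Longrightarrow> Mo x \<in> UU"
  using ks_category.B_dsums[OF ks[OF IJ]] by blast

lemma UU_MM: "UU \<subseteq> MM"
  using dsums_mono[of _ C "Mo ` I" "Mo ` J"] IJ by blast

lemma MM_Objs: "MM \<subseteq> Objs C"
  by (rule subsetI) (rule dsums_Objs)

definition torsion_at :: "'o \<Rightarrow> bool" where
  "torsion_at Y \<longleftrightarrow> (\<exists>X f. torsion_seq MM d UU X f \<and> X 1 = Y)"

lemma d_torsion_class_iff_torsion_at: "d_torsion_class C MM d UU \<longleftrightarrow> (\<forall>Y\<in>MM. torsion_at Y)"
  unfolding d_torsion_class_iff[OF MM_Objs d2] torsion_at_def
  using ks_category.subcategory_dsums[OF ks[OF IJ]] UU_MM by blast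

lemma stair_exact:
  assumes x: "x \<in> J" "x ! d < t" "butlast x @ [t] \<in> J"
    and E: "E = (\<lambda>k. stair x t (d + 1 - k))"
    and X: "X = (\<lambda>k. Mo (E k))" and f: "f = (\<lambda>k. step (E k) (E (k + 1)))"
  shows "seq_arr MM d X f" "\<forall>W\<in>MM. kernel_exact_at W d X f \<and> cokernel_exact_at W d X f"
proof -
  have EJ: "E k \<in> J" if "k \<le> d + 1" for k
    unfolding E using stair_J[OF x] by simp
  have st: "interlace d (E k) (E (k + 1))" if "k \<le> d" for k
    using interlace_stair_step[OF x(1,2), of "d - k"] that by (simp add: E Suc_diff_le)
  have st': "interlace d (E (i - 1)) (E i)" if "1 \<le> i" "i \<le> d" for i
    using st[of "i - 1"] that by simp
  have post: "(interlace d w (E (i - 1)) \<and> interlace d (E (i - 1)) (E i) \<and> \<not> interlace d w (E (i + 1))) \<or>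
     (\<not> interlace d w (E (i - 1)) \<and> interlace d w (E (i + 1)) \<and> interlace d (E i) (E (i + 1)))"
    if "w \<in> J" "1 \<le> i" "i \<le> d" "interlace d w (E i)" for w i
    using interlace_to_stair[OF x(1,2), of "d + 1 - i" w] that st[of i] st'[of i] by (auto simp: E Suc_diff_le)
  have pre: "(interlace d (E (i + 1)) w \<and> interlace d (E i) (E (i + 1)) \<and> \<not> interlace d (E (i - 1)) w) \<or>
     (\<not> interlace d (E (i + 1)) w \<and> interlace d (E (i - 1)) w \<and> interlace d (E (i - 1)) (E i))"
    if "w \<in> J" "1 \<le> i" "i \<le> d" "interlace d (E i) w" for w i
    using interlace_from_stair[OF x(1,2), of "d + 1 - i" w] that st[of i] st'[of i] by (auto simp: E Suc_diff_le)
  have post_0: "interlace d w (E 1) \<and> interlace d (E 0) (E 1)" if "w \<in> J" "interlace d w (E 0)" for w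
    using interlace_to_stair_top[OF x(1,2), of w] st[of 0] that by (simp add: E)
  have pre_d: "interlace d (E d) w \<and> interlace d (E d) (E (d + 1))" if "w \<in> J" "interlace d (E (d + 1)) w" for w
    using interlace_from_stair_bottom[OF x(1), of t w] st[of d] that by (simp add: E)
  note r = step_seq_exact[OF EJ subset_refl refl Mo_MM[OF EJ] post_0 post pre_d pre X f]
  show "seq_arr MM d X f" "\<forall>W\<in>MM. kernel_exact_at W d X f \<and> cokernel_exact_at W d X f"
    using r by blast+
qed

text \<open>The subobject \<open>u\<close> of \<open>z\<close> found by factoring \<open>M\<^sub>x \<rightarrow> M\<^sub>z\<close> has \<open>z\<^sub>d = x\<^sub>d \<le> u\<^sub>d \<le> z\<^sub>d\<close>, and being a subobject
  forces agreement in the other coordinates.\<close>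
lemma torsion_imp_last_eq:
  assumes T: "torsion_at (Mo z)" and x: "x \<in> I" and z: "z \<in> J" and xz: "interlace d x z" "x ! d = z ! d"
  shows "z \<in> I"
proof -
  obtain X f where X: "torsion_seq MM d UU X f" "X 1 = Mo z" using T unfolding torsion_at_def by blast
  obtain u where u: "u \<in> I" "interlace d x u" "interlace d u z" and uw: "\<forall>w\<in>J. interlace d w u \<longrightarrow> interlace d w z"
    using torsion_class_summand[OF X d2 refl refl UU_MM Mo_MM IJ x Mo_UU[OF x] z xz(1)] by blast
  have uJ: "u \<in> J" using u IJ by blast
  have last: "u ! d = z ! d" 
  proof (rule order_antisym)
    show "u ! d \<le> z ! d" using u(3) by (simp add: interlace_def)
    have "x ! d \<le> u ! d" using u(2) by (simp add: interlace_def)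
    then show "z ! d \<le> u ! d" using xz(2) by simp
  qed
  have "z ! i \<le> u ! i" if i: "i < d" for i
  proof (rule ccontr)
    assume n: "\<not> z ! i \<le> u ! i"
    \<comment> \<open>\<open>w\<close> maps to \<open>u\<close> but, as \<open>w\<^sub>i\<^sub>+\<^sub>1 = u\<^sub>i < z\<^sub>i\<close>, not to \<open>z\<close>.\<close>
    define w where "w = u[i + 1 := u ! i]"
    have wn: "w ! k = (if k = i + 1 then u ! i else u ! k)" if "k \<le> d" for k
      using that i J_len[OF uJ] by (auto simp: w_def nth_list_update)
    have wJ: "w \<in> J"
    proof (rule J_shrink[OF uJ])
      show "length w = d + 1" using J_len[OF uJ] by (simp add: w_def)
      show "u ! 0 \<le> w ! 0" using wn by simp
      show "w ! d \<le> u ! d" using wn[of d] J_step[OF uJ i] by auto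
      show "w ! k \<le> w ! (k + 1)" if k: "k < d" for k
        using wn[of k] wn[of "k + 1"] k J_step[OF uJ k] J_step[OF uJ i] by auto
    qed
    have "interlace d w u"
      unfolding interlace_def
    proof (intro conjI allI impI)
      show "w ! k \<le> u ! k" if "k \<le> d" for k using wn[OF that] J_step[OF uJ i] by auto
      show "u ! k \<le> w ! (k + 1)" if "k < d" for k using wn[of "k + 1"] J_step[OF uJ that] that by auto
    qed
    then have "interlace d w z" using uw wJ by blast
    then show False using n wn[of "i + 1"] i by (auto simp: interlace_def)
  qed
  then have "u ! i = z ! i" if "i < d + 1" for i
    using u(3) last that by (auto simp: interlace_def less_Suc_eq intro: order_antisym)
  then have "u = z" using J_len[OF uJ] J_len[OF z] by (intro nth_equalityI) auto
  then show ?thesis using u by blast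
qed

text \<open>Replacing the coordinates of \<open>x\<close> by those of \<open>z\<close> one at a time, from the last to the first, passes
  through interlaced tuples only.\<close>
lemma torsion_imp_upper_closed:
  assumes T: "\<And>y. y \<in> J \<Longrightarrow> torsion_at (Mo y)"
  shows upper_closed
  unfolding upper_closed_def
proof (intro ballI impI; elim conjE)
  fix x z assume x: "x \<in> J" and z: "z \<in> J" and xI: "x \<in> I" and xz: "tuple_le x z" "x ! d = z ! d"
  have len: "length x = d + 1" "length z = d + 1" using J_len x z by auto
  have le: "x ! i \<le> z ! i" if "i \<le> d" for i using xz len that by (auto simp: tuple_le_iff)
  define m where "m k = take k x @ drop k z" for k
  have mn: "m k ! i = (if i < k then x ! i else z ! i)" if "k \<le> d + 1" "i \<le> d" for k i
    using that len by (auto simp: m_def nth_append)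
  have mJ: "m k \<in> J" if k: "k \<le> d" for k
  proof (rule J_shrink[OF x])
    show "length (m k) = d + 1" using len k by (simp add: m_def)
    show "x ! 0 \<le> m k ! 0" "m k ! d \<le> x ! d" using mn[of k 0] mn[of k d] k le[of 0] xz(2) by auto
    show "m k ! i \<le> m k ! (i + 1)" if i: "i < d" for i
      using mn[of k i] mn[of k "i + 1"] k i J_step[OF x i] J_step[OF z i] le[of "i + 1"] by auto
  qed
  have "m k \<in> I" if "k \<le> d" for k
    using that
  proof (induction k rule: inc_induct)
    case base
    have "m d = x" using len mn[of d] xz(2) by (intro nth_equalityI) (auto simp: m_def less_Suc_eq)
    then show ?case using xI by simp
  next
    case (step k)
    have "interlace d (m (Suc k)) (m k)"
      unfolding interlace_def
    proof (intro conjI allI impI)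
      show "m (Suc k) ! i \<le> m k ! i" if "i \<le> d" for i using mn[of k i] mn[of "Suc k" i] le[OF that] that step by auto
      show "m k ! i \<le> m (Suc k) ! (i + 1)" if i: "i < d" for i
        using mn[of k i] mn[of "Suc k" "i + 1"] step i J_step[OF x i] J_step[OF z i] by auto
    qed
    moreover have "m (Suc k) ! d = m k ! d" using mn[of k d] mn[of "Suc k" d] step xz(2) by auto
    ultimately show ?case using torsion_imp_last_eq[OF T step.IH] mJ[of k] step by simp
  qed
  from this[of 0] show "z \<in> I" by (simp add: m_def)
qed

text \<open>If \<open>c\<close>, the last coordinate of the torsion subobject of \<open>y\<close>, were smaller than \<open>z\<^sub>d\<close>, the comparison would show
  that \<open>z\<close>, which is interlaced with the last term of the explicit sequence, is also interlaced with the
  term before it; that term begins with \<open>x\<^sub>0 < z\<^sub>0\<close>.\<close>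
lemma torsion_imp_last_swap:
  assumes T: "\<And>y. y \<in> J \<Longrightarrow> torsion_at (Mo y)"
    and x: "x \<in> I" and z: "z \<in> I" and xz: "strictly_interlaced x z" and y: "butlast x @ [z ! d] \<in> J"
  shows "butlast x @ [z ! d] \<in> I"
proof -
  have up: upper_closed using torsion_imp_upper_closed T by blast
  have xJ: "x \<in> J" and zJ: "z \<in> J" using x z IJ by auto
  let ?y = "butlast x @ [z ! d]" and ?t = "z ! d"
  note yn = nth_butlast_append[OF xJ, of _ ?t]
  have "interlace d x ?y"
    using xz J_step[OF xJ] yn by (auto simp: interlace_def strictly_interlaced_def less_imp_le)
  then have xr: "x ! d \<in> reach ?y" using x by (auto simp: reach_def)
  define c where "c = Max (reach ?y)"
  have c: "c \<in> reach ?y" "x ! d \<le> c" "\<And>u. u \<in> I \<Longrightarrow> interlace d u ?y \<Longrightarrow> u ! d \<le> c"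
  proof -
    show "c \<in> reach ?y" unfolding c_def using Max_in[OF finite_reach] xr by blast
    show "x ! d \<le> c" unfolding c_def by (rule Max_ge[OF finite_reach xr])
    show "u ! d \<le> c" if "u \<in> I" "interlace d u ?y" for u
      unfolding c_def by (rule Max_ge[OF finite_reach]) (use that in \<open>auto simp: reach_def\<close>)
  qed
  define x' where "x' = butlast x @ [c]"
  have x': "x' \<in> I" "c \<le> ?t" using reach_attained[OF up y c(1)] yn[of d] by (auto simp: x'_def)
  then have x'J: "x' \<in> J" using IJ by blast
  note xn = nth_butlast_append[OF xJ, of _ c, folded x'_def]
  show ?thesis
  proof (cases "c = ?t")
    case True then show ?thesis using x' x'_def by simp
  next
    case False
    then have ct: "x' ! d < ?t" using x' xn by simp
    define E where "E = (\<lambda>k. stair x' ?t (d + 1 - k))"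
    have len: "length x' = d + 1" using J_len[OF x'J] .
    have yE: "butlast x' @ [?t] = ?y" by (simp add: x'_def)
    have E0: "E 0 = x'" "E 1 = ?y" using stair_Suc_d[OF len, of ?t] stair_d[OF len, of ?t] yE by (auto simp: E_def)
    have EJ: "E k \<in> J" if "k \<le> d + 1" for k
      unfolding E_def using stair_J[OF x'J ct] y yE by simp
    have R: "interlace d z (E d)"
    proof -
      obtain X f where X: "torsion_seq MM d UU X f" "X 1 = Mo (E 1)"
        using T[OF y] E0 unfolding torsion_at_def by auto
      show ?thesis
      proof (rule torsion_class_compare[where E = E, OF X d2 MM_Objs refl UU_MM IJ])
        show "Mo ` I \<subseteq> UU" using Mo_UU by blast
        show "E k \<in> J" if "k \<le> d + 1" for k using EJ that .
        show "interlace d (E k) (E k)" if "k \<le> d + 1" for k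
          by (rule interlace_refl[OF subsetD[OF J_os EJ[OF that]]])
        show "interlace d (E k) (E (k + 1))" if "k \<le> d" for k
          using interlace_stair_step[OF x'J ct, of "d - k"] that by (simp add: E_def Suc_diff_le)
        show "seq_arr MM d (\<lambda>k. Mo (E k)) (\<lambda>k. step (E k) (E (k + 1)))"
          "\<forall>W\<in>MM. kernel_exact_at W d (\<lambda>k. Mo (E k)) (\<lambda>k. step (E k) (E (k + 1))) \<and>
            cokernel_exact_at W d (\<lambda>k. Mo (E k)) (\<lambda>k. step (E k) (E (k + 1)))"
          by (rule stair_exact[OF x'J ct y[folded yE] E_def refl refl])+
        show "E 0 \<in> I" using E0 x' by simp
        show "\<not> interlace d w (E 2)" if w: "w \<in> I" "interlace d w (E 1)" for w
        proof
          assume "interlace d w (E 2)"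
          then have "E 2 ! (d - 1) \<le> w ! d" using d2 by (auto simp: interlace_def dest: spec[of _ "d - 1"])
          moreover have "E 2 ! (d - 1) = Suc c"
            using nth_stair[OF len, of "d - 1" "d - 1" ?t] d2 xn[of d] by (auto simp: E_def numeral_2_eq_2)
          ultimately show False using c(3)[OF w(1)] w(2) E0 by simp
        qed
        show "z \<in> I" by (rule z)
        show "interlace d z (E (d + 1))"
          unfolding interlace_def
        proof (intro conjI allI impI)
          have En: "E (d + 1) ! i = (if i < d then Suc (x' ! (i + 1)) else ?t)" if "i \<le> d" for i
            using nth_stair[OF len, of 0 i ?t] that by (simp add: E_def)
          have xx: "x ! i \<le> x' ! i" if "i \<le> d" for i using xn[OF that] c(2) that by auto
          show "z ! i \<le> E (d + 1) ! i" if "i \<le> d" for i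
          proof (cases "i < d")
            case True
            then have "z ! i \<le> Suc (x ! (i + 1))" using xz by (simp add: strictly_interlaced_def)
            then show ?thesis using En[OF that] True xx[of "i + 1"] by simp
          qed (use En[OF that] that in simp)
          show "E (d + 1) ! i \<le> z ! (i + 1)" if i: "i < d" for i
          proof (cases "i + 1 = d")
            case True then show ?thesis using En[of i] i ct by simp
          next
            case False
            then show ?thesis using En[of i] i xn[of "i + 1"] xz by (auto simp: strictly_interlaced_def Suc_le_eq)
          qed
        qed
      qed
    qed
    have "E d ! 0 = x ! 0" using nth_stair[OF len, of 1 0 ?t] xn[of 0] d2 by (simp add: E_def)
    then show ?thesis using R xz by (auto simp: interlace_def strictly_interlaced_def dest!: spec[of _ 0])
  qed
qed

text \<open>By upward closure only the case \<open>y\<^sub>d = z\<^sub>d\<close> matters, and the tuple \<open>(z\<^sub>0, \<dots>, z\<^sub>p\<^sub>-\<^sub>1, x\<^sub>p, \<dots>, x\<^sub>d\<^sub>-\<^sub>1, z\<^sub>d) \<le> y\<close> suffices, where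
  \<open>p\<close> is the first place at which \<open>y\<close> agrees with \<open>x\<close>. It is obtained by swapping the last coordinate of
  \<open>a = (z\<^sub>0, \<dots>, z\<^sub>p\<^sub>-\<^sub>1, x\<^sub>p, \<dots>, x\<^sub>d)\<close>. The swap with \<open>(x, z)\<close> itself may leave \<open>J\<close>, since \<open>x\<^sub>0\<close> can be too far from \<open>z\<^sub>d\<close>; and
  \<open>a\<close> need not be strictly below \<open>z\<close>, which is why the first \<open>p\<close> coordinates of \<open>z\<close> are raised by one to give \<open>z'\<close>.
  Both \<open>a\<close> and \<open>z'\<close> are in \<open>I\<close> by upward closure.\<close>
lemma torsion_imp_mixing_closed:
  assumes T: "\<And>y. y \<in> J \<Longrightarrow> torsion_at (Mo y)"
  shows mixing_closed
  unfolding mixing_closed_def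
proof (intro ballI impI)
  fix x z y assume x: "x \<in> I" and z: "z \<in> I" and xz: "strictly_interlaced x z" and y: "y \<in> J"
    and yxz: "\<forall>i\<le>d. y ! i \<in> {x ! i, z ! i}"
  have up: "tuple_le u v \<Longrightarrow> u ! d = v ! d \<Longrightarrow> u \<in> I \<Longrightarrow> v \<in> J \<Longrightarrow> v \<in> I" for u v
    using torsion_imp_upper_closed[OF T] IJ unfolding upper_closed_def by blast
  have xJ: "x \<in> J" and zJ: "z \<in> J" using x z IJ by auto
  note len = J_len[OF xJ] J_len[OF zJ] J_len[OF y]
  have lt: "x ! i < z ! i" if "i \<le> d" for i using xz that by (simp add: strictly_interlaced_def)
  have ge: "z ! i \<le> Suc (x ! (i + 1))" if "i < d" for i using xz that by (simp add: strictly_interlaced_def)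
  have yx: "y ! i = x ! i \<or> y ! i = z ! i" if "i \<le> d" for i using yxz that by auto
  have xy: "x ! i \<le> y ! i" if "i \<le> d" for i using yx[OF that] lt[OF that] by auto
  show "y \<in> I"
  proof (cases "y ! d = x ! d")
    case True
    then show ?thesis using up[of x y] x y xy len by (auto simp: tuple_le_iff less_Suc_eq_le)
  next
    case False
    then have yd: "y ! d = z ! d" using yx by blast
    show ?thesis
    proof (cases "\<exists>i\<le>d. y ! i = x ! i")
      case False
      then have "y = z" using yx len by (intro nth_equalityI) (auto simp: less_Suc_eq_le)
      then show ?thesis using z by simp
    next
      case True
      define p where "p = (LEAST i. i \<le> d \<and> y ! i = x ! i)"
      have p: "p \<le> d" "y ! p = x ! p" using LeastI_ex[OF True] by (auto simp: p_def)
      have pz: "y ! i = z ! i" if "i < p" for i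
        using not_less_Least[of i "\<lambda>i. i \<le> d \<and> y ! i = x ! i"] that p(1) yx[of i] by (auto simp: p_def)
      have pd: "p < d" using p False by (metis le_neq_implies_less)
      define a where "a = take p z @ drop p x"
      define z' where "z' = map Suc (take p z) @ drop p z"
      have an: "a ! i = (if i < p then z ! i else x ! i)" if "i \<le> d" for i
        using that len p by (auto simp: a_def nth_append)
      have zn: "z' ! i = (if i < p then Suc (z ! i) else z ! i)" if "i \<le> d" for i
        using that len p by (auto simp: z'_def nth_append)
      have la: "length a = d + 1" "length z' = d + 1" using len p by (auto simp: a_def z'_def)
      have zp: "z ! i \<le> x ! p" if "i + 1 = p" for i
        using pz[of i] p that J_step[OF y, of i] by simp
      have aJ: "a \<in> J"
      proof (rule J_shrink[OF xJ la(1)])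
        show "x ! 0 \<le> a ! 0" "a ! d \<le> x ! d" using an[of 0] an[of d] pd lt[of 0] by auto
        show "a ! i \<le> a ! (i + 1)" if i: "i < d" for i
          using an[of i] an[of "i + 1"] i zp[of i] J_step[OF xJ i] J_step[OF zJ i] by (cases "i + 1 = p") auto
      qed
      have aI: "a \<in> I"
        using up[of x a] x aJ an lt pd len la by (auto simp: tuple_le_iff less_Suc_eq_le less_imp_le)
      have z'J: "z' \<in> J"
      proof (rule J_shrink[OF zJ la(2)])
        show "z ! 0 \<le> z' ! 0" "z' ! d \<le> z ! d" using zn[of 0] zn[of d] pd by auto
        show "z' ! i \<le> z' ! (i + 1)" if i: "i < d" for i
          using zn[of i] zn[of "i + 1"] i zp[of i] lt[of p] p(1) J_step[OF zJ i] by (cases "i + 1 = p") auto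
      qed
      have z'I: "z' \<in> I"
        using up[of z z'] z z'J zn pd len la by (auto simp: tuple_le_iff less_Suc_eq_le)
      have az: "strictly_interlaced a z'"
        unfolding strictly_interlaced_def
      proof (intro conjI allI impI)
        show "a ! i < z' ! i" if "i \<le> d" for i using an[OF that] zn[OF that] lt[OF that] by auto
        show "z' ! i \<le> Suc (a ! (i + 1))" if i: "i < d" for i
          using an[of "i + 1"] zn[of i] i zp[of i] ge[OF i] J_step[OF zJ i] by (cases "i + 1 = p") auto
      qed
      let ?b = "butlast a @ [z' ! d]"
      note bn = nth_butlast_append[OF aJ]
      have z'd: "z' ! d = z ! d" using zn[of d] pd by simp
      have lb: "length ?b = d + 1" using la by simp
      have "?b \<in> J"
      proof (rule J_shrink[OF y lb])
        show "y ! 0 \<le> ?b ! 0" using bn[of 0] an[of 0] pz[of 0] p d2 by auto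
        show "?b ! d \<le> y ! d" using bn[of d] z'd yd by simp
        show "?b ! i \<le> ?b ! (i + 1)" if i: "i < d" for i
        proof (cases "i + 1 = d")
          case True
          have "a ! i \<le> a ! d" using J_step[OF aJ i] True by simp
          also have "\<dots> \<le> z ! d" using an[of d] pd lt[of d] by simp
          finally show ?thesis using bn[of i] bn[of "i + 1"] True i z'd by simp
        qed (use bn[of i] bn[of "i + 1"] i J_step[OF aJ i] in auto)
      qed
      then have bI: "?b \<in> I" using torsion_imp_last_swap[OF T aI z'I az] by blast
      have "?b ! i \<le> y ! i" if "i \<le> d" for i
        using bn[OF that] an[OF that] xy[OF that] pz[of i] z'd yd that by (cases "i = d") auto
      then have "tuple_le ?b y" using lb len by (auto simp: tuple_le_iff less_Suc_eq_le)
      then show ?thesis using up bI y bn[of d] z'd yd by simp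
    qed
  qed
qed

text \<open>The degenerate cases: \<open>M\<^sub>y\<close> is in the class (\<open>p = 0\<close>, sequence \<open>M\<^sub>y = M\<^sub>y \<rightarrow> 0\<close>), or receives no map from it
  (\<open>p = 1\<close>, sequence \<open>0 \<rightarrow> M\<^sub>y = M\<^sub>y\<close>).\<close>
lemma torsion_at_constant:
  fixes p :: nat
  assumes y: "y \<in> J" and p: "p = 0 \<and> y \<in> I \<or> p = 1 \<and> reach y = {}"
  shows "torsion_at (Mo y)"
proof -
  obtain Z where Z: "zero_object C Z" using ks_category.zero_exists[OF ks[of J]] by blast
  let ?M = "case_option Z Mo"
  interpret opt: hom_family C cmp pls "insert None (Some ` J)" ?M
    "\<lambda>x y. x \<noteq> None \<and> y \<noteq> None \<and> interlace d (the x) (the y)" "\<lambda>x y. b (the x) (the y)"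
    by (rule hom_family_option[OF Z])
  define E where "E k = (if k = p \<or> k = p + 1 then Some y else None)" for k
  define X where "X = (\<lambda>k. ?M (E k))"
  define f where "f = (\<lambda>k. opt.step (E k) (E (k + 1)))"
  have yy: "interlace d y y" by (rule interlace_refl[OF subsetD[OF J_os y]])
  have im: "?M ` Some ` K = Mo ` K" for K by (auto simp: image_image)
  have ZM: "Z \<in> MM" "Z \<in> UU" using Z by (auto intro: dsums.dsums_zero)
  have EM: "?M (E k) \<in> MM" for k using Mo_MM[OF y] ZM by (auto simp: E_def)
  have p': "p = 0 \<or> p = 1" using p by auto
  have nr: "\<not> interlace d w y" if "p = 1" "w \<in> I" for w using p that by (auto simp: reach_def)
  have ex: "seq_arr MM d X f" "\<forall>W\<in>MM. kernel_exact_at W d X f \<and> cokernel_exact_at W d X f"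
  proof -
    let ?R = "\<lambda>x y. x \<noteq> None \<and> y \<noteq> None \<and> interlace d (the x) (the y)"
    have EJ: "E k \<in> insert None (Some ` J)" if "k \<le> d + 1" for k using y by (auto simp: E_def)
    have post_0: "?R w (E 1) \<and> ?R (E 0) (E 1)" if "w \<in> Some ` J" "?R w (E 0)" for w
      using p' that yy by (auto simp: E_def)
    have pre_d: "?R (E d) w \<and> ?R (E d) (E (d + 1))" if "w \<in> Some ` J" "?R (E (d + 1)) w" for w
      using p' that yy d2 by (auto simp: E_def)
    have i: "i = p \<and> p = 1 \<or> i = p + 1" if "1 \<le> i" "E i \<noteq> None" for i
      using that p' by (auto simp: E_def split: if_splits)
    have post: "(?R w (E (i - 1)) \<and> ?R (E (i - 1)) (E i) \<and> \<not> ?R w (E (i + 1))) \<or>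
        (\<not> ?R w (E (i - 1)) \<and> ?R w (E (i + 1)) \<and> ?R (E i) (E (i + 1)))"
      if "w \<in> Some ` J" "1 \<le> i" "i \<le> d" "?R w (E i)" for w i
      using i[OF that(2)] that(4) yy by (auto simp: E_def)
    have pre: "(?R (E (i + 1)) w \<and> ?R (E i) (E (i + 1)) \<and> \<not> ?R (E (i - 1)) w) \<or>
        (\<not> ?R (E (i + 1)) w \<and> ?R (E (i - 1)) w \<and> ?R (E (i - 1)) (E i))"
      if "w \<in> Some ` J" "1 \<le> i" "i \<le> d" "?R (E i) w" for w i
      using i[OF that(2)] that(4) yy by (auto simp: E_def)
    note r = opt.step_seq_exact[OF EJ subset_insertI im[of J, THEN arg_cong[of _ _ "dsums C"], symmetric] EM post_0 post pre_d pre X_def f_def]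
    show "seq_arr MM d X f" "\<forall>W\<in>MM. kernel_exact_at W d X f \<and> cokernel_exact_at W d X f"
      by (rule r; assumption)+
  qed
  have "torsion_seq MM d UU X f"
  proof (rule opt.step_seq_torsion[OF ex _ _ _ UU_MM X_def f_def d2])
    show "E k \<in> insert None (Some ` J)" for k using y by (auto simp: E_def)
    show "Some ` I \<subseteq> insert None (Some ` J)" using IJ by auto
    show "UU = dsums C (?M ` Some ` I)" using im by simp
    show "?M (E 0) \<in> UU" using p Mo_UU ZM by (auto simp: E_def)
  qed (use p' nr yy d2 in \<open>auto simp: E_def\<close>)
  moreover have "X 1 = Mo y" using p' by (auto simp: X_def E_def)
  ultimately show ?thesis unfolding torsion_at_def by blast
qed

lemma torsion_at_zero:
  assumes Z: "zero_object C Z"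
  shows "torsion_at Z"
proof -
  let ?M = "case_option Z Mo"
  interpret opt: hom_family C cmp pls "insert None (Some ` J)" ?M
    "\<lambda>x y. x \<noteq> None \<and> y \<noteq> None \<and> interlace d (the x) (the y)" "\<lambda>x y. b (the x) (the y)"
    by (rule hom_family_option[OF Z])
  define E :: "nat \<Rightarrow> nat list option" where "E k = None" for k
  define X where "X = (\<lambda>k. ?M (E k))"
  define f where "f = (\<lambda>k. opt.step (E k) (E (k + 1)))"
  have im: "?M ` Some ` K = Mo ` K" for K by (auto simp: image_image)
  have ZM: "Z \<in> MM" "Z \<in> UU" using Z by (auto intro: dsums.dsums_zero)
  have ex: "seq_arr MM d X f" "\<forall>W\<in>MM. kernel_exact_at W d X f \<and> cokernel_exact_at W d X f"
    by (rule opt.step_seq_exact[of d E "Some ` J" MM X f, OF _ _ _ _ _ _ _ _ X_def f_def];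
      use ZM im in \<open>auto simp: E_def\<close>)+
  have "torsion_seq MM d UU X f"
  proof (rule opt.step_seq_torsion[OF ex _ _ _ UU_MM X_def f_def d2])
    show "Some ` I \<subseteq> insert None (Some ` J)" using IJ by auto
    show "UU = dsums C (?M ` Some ` I)" using im by simp
  qed (use ZM in \<open>auto simp: E_def\<close>)
  moreover have "X 1 = Z" by (simp add: X_def E_def)
  ultimately show ?thesis unfolding torsion_at_def by blast
qed

text \<open>Let \<open>c\<close> be the maximum of \<open>reach y\<close> and \<open>x = (y\<^sub>0, \<dots>, y\<^sub>d\<^sub>-\<^sub>1, c)\<close>. Unless the case is degenerate, the explicit sequence
  for \<open>x\<close> and \<open>t = y\<^sub>d\<close> is \<open>d\<close>-exact, and two tests with \<open>w \<in> I\<close> remain.\<close>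
lemma closed_imp_torsion_at:
  assumes up: upper_closed and mix: mixing_closed and y: "y \<in> J"
  shows "torsion_at (Mo y)"
proof (cases "reach y = {}")
  case True then show ?thesis using torsion_at_constant[OF y, of 1] by blast
next
  case False
  define c where "c = Max (reach y)"
  have c: "c \<in> reach y" unfolding c_def using Max_in[OF finite_reach] False by blast
  have cmax: "u ! d \<le> c" if "u \<in> I" "interlace d u y" for u
    unfolding c_def by (rule Max_ge[OF finite_reach]) (use that in \<open>auto simp: reach_def\<close>)
  define x where "x = butlast y @ [c]"
  have xI: "x \<in> I" and cy: "c \<le> y ! d" using reach_attained[OF up y c] by (auto simp: x_def)
  have xJ: "x \<in> J" using xI IJ by blast
  have xn: "x ! i = (if i < d then y ! i else c)" if "i \<le> d" for i
    using nth_butlast_append[OF y that] by (simp add: x_def)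
  show ?thesis
  proof (cases "c = y ! d")
    case True
    then have "x = y" using butlast_append_last[OF y] by (simp add: x_def)
    then show ?thesis using torsion_at_constant[OF y, of 0] xI by blast
  next
    case False
    let ?t = "y ! d"
    have ct: "x ! d < ?t" using cy False xn[of d] by simp
    have len: "length x = d + 1" using J_len[OF xJ] .
    have xt: "butlast x @ [?t] = y" using butlast_append_last[OF y] by (simp add: x_def)
    define E where "E = (\<lambda>k. stair x ?t (d + 1 - k))"
    define X where "X = (\<lambda>k. Mo (E k))"
    define f where "f = (\<lambda>k. step (E k) (E (k + 1)))"
    have E01: "E 0 = x" "E 1 = y" using stair_Suc_d[OF len, of ?t] stair_d[OF len, of ?t] xt by (auto simp: E_def)
    have st: "interlace d (E k) (E (k + 1))" if "k \<le> d" for k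
      using interlace_stair_step[OF xJ ct, of "d - k"] that by (simp add: E_def Suc_diff_le)
    have EJ: "E k \<in> J" if "k \<le> d + 1" for k
      unfolding E_def using stair_J[OF xJ ct] xt y by simp
    have ex: "seq_arr MM d X f" "\<forall>W\<in>MM. kernel_exact_at W d X f \<and> cokernel_exact_at W d X f"
      using stair_exact[OF xJ ct _ E_def X_def f_def] xt y by auto
    have "torsion_seq MM d UU X f"
    proof (rule step_seq_torsion[OF ex EJ IJ refl UU_MM X_def f_def d2])
      show "Mo (E 0) \<in> UU" using E01 Mo_UU[OF xI] by simp
    next
      \<comment> \<open>Injectivity at \<open>V\<^sub>1\<close>: by maximality of \<open>c\<close> such a \<open>w\<close> has no map to \<open>E 1\<close>, hence one to \<open>E 3\<close>.\<close>
      fix w assume w: "w \<in> I" "interlace d w (E 2)"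
      have "E 2 ! (d - 1) \<le> w ! d" using w d2 by (auto simp: interlace_def dest: spec[of _ "d - 1"])
      moreover have "E 2 ! (d - 1) = Suc c"
        using nth_stair[OF len, of "d - 1" "d - 1" ?t] d2 xn[of d] by (auto simp: E_def numeral_2_eq_2)
      ultimately have "\<not> interlace d w y" using cmax[OF w(1)] by auto
      then have "\<not> interlace d w (stair x ?t (d - 1 + 1))" using E01(2) d2 by (simp add: E_def)
      moreover have "interlace d w (stair x ?t (d - 1))" using w(2) by (simp add: E_def numeral_2_eq_2)
      ultimately have "interlace d w (stair x ?t (d - 1 - 1))"
        using interlace_to_stair[OF xJ ct, of "d - 1" w] d2 by auto
      then show "interlace d w (E 3) \<and> interlace d (E 2) (E 3)"
        using st[of 2] d2 by (simp add: E_def numeral_3_eq_3 numeral_2_eq_2)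
    next
      \<comment> \<open>Surjectivity at \<open>V\<^sub>d\<close>: otherwise \<open>x \<leadsto> \<tau>\<^sub>d(w)\<close>, and mixing \<open>x\<close> with \<open>w\<close> raises \<open>c\<close> to \<open>w\<^sub>d\<close>.\<close>
      fix w assume w: "w \<in> I" "interlace d w (E (d + 1))"
      have wJ: "w \<in> J" using w IJ by blast
      have E0n: "E (d + 1) ! i = (if i < d then Suc (x ! (i + 1)) else ?t)" if "i \<le> d" for i
        using nth_stair[OF len, of 0 i ?t] that by (simp add: E_def)
      have E1n: "E d ! i = (if i = 0 then x ! 0 else E (d + 1) ! i)" if "i \<le> d" for i
        using nth_stair[OF len, of 1 i ?t] E0n[OF that] that d2 by (auto simp: E_def)
      have w1: "w ! i \<le> E (d + 1) ! i" if "i \<le> d" for i using w that by (simp add: interlace_def)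
      have w2: "E (d + 1) ! i \<le> w ! (i + 1)" if "i < d" for i using w that by (simp add: interlace_def)
      have "interlace d w (E d)"
      proof (rule ccontr)
        assume n: "\<not> interlace d w (E d)"
        have w0: "x ! 0 < w ! 0"
        proof (rule ccontr)
          assume "\<not> x ! 0 < w ! 0"
          moreover have "x ! 0 \<le> w ! 1" using w2[of 0] E0n[of 0] d2 J_step[OF xJ, of 0] by simp
          ultimately have "interlace d w (E d)"
            unfolding interlace_def using E1n w1 w2 by auto
          then show False using n by simp
        qed
        have "strictly_interlaced x w"
          unfolding strictly_interlaced_def
        proof (intro conjI allI impI)
          show "x ! i < w ! i" if i: "i \<le> d" for i
            using w0 w2[of "i - 1"] E0n[of "i - 1"] i by (cases i) auto
          show "w ! i \<le> Suc (x ! (i + 1))" if "i < d" for i using w1[of i] E0n[of i] that by simp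
        qed
        moreover have wd: "x ! d < w ! d" "w ! d \<le> y ! d"
          using calculation w1[of d] E0n[of d] by (auto simp: strictly_interlaced_def)
        moreover have v: "butlast y @ [w ! d] \<in> J"
          using butlast_append_J[OF y] wd J_step[OF xJ, of "d - 1"] xn[of "d - 1"] d2 by simp
        ultimately have vI: "butlast y @ [w ! d] \<in> I"
          using mix xI w(1) nth_butlast_append[OF y] xn unfolding mixing_closed_def
          by (metis (no_types, lifting) insertCI le_neq_implies_less)
        have "interlace d (butlast y @ [w ! d]) y"
          using wd nth_butlast_append[OF y] J_step[OF y] J_step[OF v] xn[of d] J_step[OF xJ, of "d - 1"]
          unfolding interlace_def by auto
        then show False using cmax[OF vI] nth_butlast_append[OF y, of d] wd xn[of d] by simp
      qed
      then show "interlace d w (E d) \<and> interlace d (E d) (E (d + 1))" using st[of d] by simp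
    qed
    moreover have "X 1 = Mo y" using E01 by (simp add: X_def)
    ultimately show ?thesis unfolding torsion_at_def by blast
  qed
qed

lemma torsion_at_dsums:
  assumes "\<And>y. y \<in> J \<Longrightarrow> torsion_at (Mo y)" "Y \<in> MM"
  shows "torsion_at Y"
  using assms(2)
proof (induction Y rule: dsums.induct)
  case (dsums_zero Z) then show ?case by (rule torsion_at_zero)
next
  case (dsums_add N Y S)
  have "torsion_at N" using dsums_add(1) assms(1) by blast
  then obtain X f X' f' where X: "torsion_seq MM d UU X f" "X 1 = N" "torsion_seq MM d UU X' f'" "X' 1 = Y"
    using dsums_add.IH unfolding torsion_at_def by blast
  then show ?case
    unfolding torsion_at_def
    using torsion_seq_sum[OF ks_category.sums_exist[OF ks[of J]] ks_category.subcategory_dsums[OF ks[of J]]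
      ks_category.subcategory_dsums[OF ks[OF IJ]] UU_MM d2 X(1,3)] dsums_add(3) by simp
qed

theorem d_torsion_class_iff_closed:
  "d_torsion_class C MM d UU \<longleftrightarrow> upper_closed \<and> mixing_closed"
proof
  assume "d_torsion_class C MM d UU"
  then have "torsion_at (Mo y)" if "y \<in> J" for y
    using Mo_MM[OF that] unfolding d_torsion_class_iff_torsion_at by blast
  then show "upper_closed \<and> mixing_closed"
    using torsion_imp_upper_closed torsion_imp_mixing_closed by blast
next
  assume "upper_closed \<and> mixing_closed"
  then show "d_torsion_class C MM d UU"
    unfolding d_torsion_class_iff_torsion_at
    using torsion_at_dsums closed_imp_torsion_at by blast
qed

end

theorem theorem6p1:
  fixes n d :: nat and \<ll> :: "nat list" and I :: "nat list set"
  assumes "n \<ge> 1" and "d \<ge> 2" and "kupisch n \<ll>" and "I \<subseteq> os_kup \<ll> (d + 1)"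
  shows "d_torsion_class (mod_cat (nakayama_alg \<ll> d :: 'k::field bound_cat))
           (nakayama_M \<ll> d) d (U_class \<ll> d I)
     \<longleftrightarrow> (\<forall>x \<in> os_kup \<ll> (d + 1). \<forall>z \<in> os_kup \<ll> (d + 1).
            (tuple_le x z \<and> x ! d = z ! d \<longrightarrow> x \<in> I \<longrightarrow> z \<in> I) \<and>
            (squig (map int x) (tau (map int z)) \<and> x \<in> I \<and> z \<in> I \<longrightarrow>
               (\<forall>y \<in> os_kup \<ll> (d + 1). (\<forall>i\<le>d. y ! i \<in> {x ! i, z ! i}) \<longrightarrow> y \<in> I)))"
proof -
  let ?A = "nakayama_alg \<ll> d :: 'k bound_cat"
  interpret index_set n d \<ll> I
    using assms by unfold_locales auto
  interpret im: interval_modules ?A n d J by (rule interval_modules_nakayama)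
  interpret hom_family "mod_cat ?A" "mod_cmp ?A" "mod_pls ?A" J "M_int n d" "interlace d" "im.scalar_map 1"
    by (rule im.hom_family_M)
  interpret torsion_setup n d \<ll> I "mod_cat ?A" "mod_cmp ?A" "mod_pls ?A" "M_int n d" "im.scalar_map 1"
    by (intro torsion_setup.intro torsion_setup_axioms.intro index_set_axioms im.hom_family_M im.ks_category_M)
  interpret ksI: ks_category "mod_cat ?A" "mod_cmp ?A" "mod_pls ?A" "M_int n d ` I"
    by (rule im.ks_category_M) (rule IJ)
  have "U_class \<ll> d I = dsums (mod_cat ?A) (M_int n d ` I)"
    unfolding U_class_def len by (rule ksI.add_closure_eq_dsums)
  moreover have "nakayama_M \<ll> d = dsums (mod_cat ?A) (M_int n d ` J)"
    by (rule nakayama_M_eq)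
  ultimately have "d_torsion_class (mod_cat ?A) (nakayama_M \<ll> d) d (U_class \<ll> d I) \<longleftrightarrow> upper_closed \<and> mixing_closed"
    using d_torsion_class_iff_closed by simp
  also have "\<dots> \<longleftrightarrow> (\<forall>x\<in>J. \<forall>z\<in>J. (tuple_le x z \<and> x ! d = z ! d \<longrightarrow> x \<in> I \<longrightarrow> z \<in> I) \<and>
     (squig (map int x) (tau (map int z)) \<and> x \<in> I \<and> z \<in> I \<longrightarrow>
        (\<forall>y\<in>J. (\<forall>i\<le>d. y ! i \<in> {x ! i, z ! i}) \<longrightarrow> y \<in> I)))"
    using squig_tau_iff[OF J_len J_len] IJ unfolding upper_closed_def mixing_closed_def by blast
  finally show ?thesis by simp
qed

end
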